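(* Let $1<\alpha<2$ and let $p\ge3$ be an integer. Let $u\in C^{[\alpha]+p+1}(\mathbb{R})$ and suppose all the derivatives of $u$ up to order $[\alpha]+p+2$ exist and belong to $L_1(\mathbb{R})$. For $h>0$ set $$ {}^{L}\mathcal{B}_{p}^{\alpha}u(x)=\frac{1}{h^{\alpha}}\sum_{\ell=0}^{\infty}\kappa_{p,\ell}^{(\alpha)}u\bigl(x-(\ell-1)h\bigr),\qquad {}^{R}\mathcal{B}_{p}^{\alpha}u(x)=\frac{1}{h^{\alpha}}\sum_{\ell=0}^{\infty}\kappa_{p,\ell}^{(\alpha)}u\bigl(x+(\ell-1)h\bigr),$$ where the coefficients $\kappa_{p,\ell}^{(\alpha)}$ ($\ell=0,1,\ldots$) have generating function $$\widetilde W_p(z)=\left((1-z)+\frac{\alpha-2}{2\alpha}(1-z)^2+\sum_{k=3}^{p}\frac{\lambda_{k-1,k-1}^{(\alpha)}}{\alpha}(1-z)^k\right)^{\alpha}=\sum_{\ell=0}^{\infty}\kappa_{p,\ell}^{(\alpha)}z^{\ell},\qquad |z|<1,$$ in which the parameters $\lambda_{k-1,k-1}^{(\alpha)}$ ($k=3,4,\ldots$) are determined by $$\widetilde W_k(\mathrm{e}^{-z})\frac{\mathrm{e}^{z}}{z^{\alpha}}=1-\sum_{\ell=k}^{\infty}\lambda_{k,\ell}^{(\alpha)}z^{\ell},\qquad k=2,3,\ldots$$ Then, as $h\to0$, $$ {}_{RL}D_{-\infty,x}^{\alpha}u(x)={}^{L}\mathcal{B}_{p}^{\alpha}u(x)+\mathcal{O}(h^p)\qquad\text{and}\qquad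 {}_{RL}D_{x,+\infty}^{\alpha}u(x)={}^{R}\mathcal{B}_{p}^{\alpha}u(x)+\mathcal{O}(h^p).$$
   Context: $[\alpha]$ denotes the integer part of $\alpha$. The left and right Liouville derivatives of order $\alpha\in(1,2)$ are $$ {}_{RL}D_{-\infty,x}^{\alpha}u(x)=\frac{1}{\Gamma(2-\alpha)}\frac{d^2}{dx^2}\int_{-\infty}^{x}\frac{u(s)\,ds}{(x-s)^{\alpha-1}},\qquad {}_{RL}D_{x,+\infty}^{\alpha}u(x)=\frac{1}{\Gamma(2-\alpha)}\frac{d^2}{dx^2}\int_{x}^{+\infty}\frac{u(s)\,ds}{(s-x)^{\alpha-1}}.$$ The starting generating function is $$\widetilde W_2(z)=\left((1-z)+\frac{\alpha-2}{2\alpha}(1-z)^2\right)^{\alpha}=\left(\frac{3\alpha-2}{2\alpha}-\frac{2(\alpha-1)}{\alpha}z+\frac{\alpha-2}{2\alpha}z^2\right)^{\alpha}.$$ The definition is recursive: $\widetilde W_2$ determines $\lambda_{2,2}^{(\alpha)}$, which determines $\widetilde W_3$, which determines $\lambda_{3,3}^{(\alpha)}$, which determines $\widetilde W_4$, and so on. Writing $\widetilde W_k=P_k^{\alpha}$ with $P_k$ the polynomial inside the parentheses, $\widetilde W_k(\mathrm{e}^{-z})\mathrm{e}^z/z^\alpha$ is understood near $z=0$ as $\mathrm{e}^z\,(P_k(\mathrm{e}^{-z})/z)^{\alpha}$, where $P_k(\mathrm{e}^{-z})/z\to1$ as $z\to0$, so that it is analytic near $0$ with value $1$ at $0$. *)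

theory Defs
  imports "HOL-Complex_Analysis.Complex_Analysis" "HOL-Library.Landau_Symbols"
begin

definition derivs_exist :: "nat \<Rightarrow> (real \<Rightarrow> real) \<Rightarrow> bool" where
  "derivs_exist n u \<longleftrightarrow> (\<forall>k<n. \<forall>x. (deriv ^^ k) u differentiable at x)"

definition C_class :: "nat \<Rightarrow> (real \<Rightarrow> real) \<Rightarrow> bool" where
  "C_class n u \<longleftrightarrow> derivs_exist n u \<and> continuous_on UNIV ((deriv ^^ n) u)"

text \<open>
  The integrals below are Lebesgue integrals. Since \<open>deriv\<close> and the integral are total
  functions, the values \<open>left_liouville\<close> and \<open>right_liouville\<close> are meaningful only where
  \<open>left_liouville_exists\<close> and \<open>right_liouville_exists\<close>, respectively, hold.
\<close>

definition left_liouville_integral :: "real \<Rightarrow> (real \<Rightarrow> real) \<Rightarrow> real \<Rightarrow> real" where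
  "left_liouville_integral \<alpha> u x = (LINT s:{..<x}|lborel. u s / (x - s) powr (\<alpha> - 1))"

definition right_liouville_integral :: "real \<Rightarrow> (real \<Rightarrow> real) \<Rightarrow> real \<Rightarrow> real" where
  "right_liouville_integral \<alpha> u x = (LINT s:{x<..}|lborel. u s / (s - x) powr (\<alpha> - 1))"

definition left_liouville :: "real \<Rightarrow> (real \<Rightarrow> real) \<Rightarrow> real \<Rightarrow> real" where
  "left_liouville \<alpha> u x = 1 / Gamma (2 - \<alpha>) * (deriv ^^ 2) (left_liouville_integral \<alpha> u) x"

definition right_liouville :: "real \<Rightarrow> (real \<Rightarrow> real) \<Rightarrow> real \<Rightarrow> real" where
  "right_liouville \<alpha> u x = 1 / Gamma (2 - \<alpha>) * (deriv ^^ 2) (right_liouville_integral \<alpha> u) x"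

definition left_liouville_exists :: "real \<Rightarrow> (real \<Rightarrow> real) \<Rightarrow> bool" where
  "left_liouville_exists \<alpha> u \<longleftrightarrow>
     (\<forall>x. set_integrable lborel {..<x} (\<lambda>s. u s / (x - s) powr (\<alpha> - 1))) \<and>
     derivs_exist 2 (left_liouville_integral \<alpha> u)"

definition right_liouville_exists :: "real \<Rightarrow> (real \<Rightarrow> real) \<Rightarrow> bool" where
  "right_liouville_exists \<alpha> u \<longleftrightarrow>
     (\<forall>x. set_integrable lborel {x<..} (\<lambda>s. u s / (s - x) powr (\<alpha> - 1))) \<and>
     derivs_exist 2 (right_liouville_integral \<alpha> u)"

text \<open>
  The polynomial inside the power in the generating function of index \<open>k\<close>; only the
  diagonal parameters \<open>lam 2 2, \<dots>, lam (k - 1) (k - 1)\<close> enter.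
\<close>

definition gen_poly :: "real \<Rightarrow> (nat \<Rightarrow> nat \<Rightarrow> real) \<Rightarrow> nat \<Rightarrow> complex \<Rightarrow> complex" where
  "gen_poly \<alpha> lam k z =
     (1 - z) + of_real ((\<alpha> - 2) / (2 * \<alpha>)) * (1 - z)\<^sup>2
       + (\<Sum>j=3..k. of_real (lam (j - 1) (j - 1) / \<alpha>) * (1 - z) ^ j)"

text \<open>
  For each \<open>k\<close> the equation expresses \<open>lam k l\<close>, \<open>l \<ge> k\<close>, through \<open>lam j j\<close> with
  \<open>j < k\<close>, so it determines these parameters recursively. As \<open>gen_poly \<alpha> lam k (exp (-z)) / z\<close>
  tends to 1 for \<open>z \<rightarrow> 0\<close>, the principal power is the right branch near 0.
\<close>

definition gen_parameters :: "real \<Rightarrow> (nat \<Rightarrow> nat \<Rightarrow> real) \<Rightarrow> bool" where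
  "gen_parameters \<alpha> lam \<longleftrightarrow>
     (\<forall>k\<ge>2. \<forall>\<^sub>F z in at (0::complex).
        summable (\<lambda>l. of_real (lam k (k + l)) * z ^ (k + l)) \<and>
        exp z * (gen_poly \<alpha> lam k (exp (- z)) / z) powr of_real \<alpha>
          = 1 - (\<Sum>l. of_real (lam k (k + l)) * z ^ (k + l)))"

text \<open>
  The generating function on the unit disc: the holomorphic function that coincides with the
  principal power near 0, where \<open>gen_poly\<close> is near a positive real number. The principal power
  itself need not be continuous on the whole disc, since the values of \<open>gen_poly\<close> may cross
  the negative real axis.
\<close>

definition is_gen_fun ::
  "real \<Rightarrow> (nat \<Rightarrow> nat \<Rightarrow> real) \<Rightarrow> nat \<Rightarrow> (complex \<Rightarrow> complex) \<Rightarrow> bool" where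
  "is_gen_fun \<alpha> lam p W \<longleftrightarrow>
     W holomorphic_on ball 0 1 \<and>
     (\<forall>\<^sub>F z in nhds 0. W z = gen_poly \<alpha> lam p z powr of_real \<alpha>)"

definition left_diff :: "real \<Rightarrow> (nat \<Rightarrow> real) \<Rightarrow> (real \<Rightarrow> real) \<Rightarrow> real \<Rightarrow> real \<Rightarrow> real" where
  "left_diff \<alpha> \<kappa> u h x = 1 / h powr \<alpha> * (\<Sum>l. \<kappa> l * u (x - (real l - 1) * h))"

definition right_diff :: "real \<Rightarrow> (nat \<Rightarrow> real) \<Rightarrow> (real \<Rightarrow> real) \<Rightarrow> real \<Rightarrow> real \<Rightarrow> real" where
  "right_diff \<alpha> \<kappa> u h x = 1 / h powr \<alpha> * (\<Sum>l. \<kappa> l * u (x + (real l - 1) * h))"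

end

theory Submission
  imports Defs "HOL-Probability.Characteristic_Functions"
begin

text \<open>
  Everything is compared on the Fourier side. Write \<open>u^\<close> for the Fourier transform of \<open>u\<close>. Since
  \<open>p + 3\<close> derivatives of \<open>u\<close> are integrable, \<open>u^\<close> decays like the power \<open>-(p + 3)\<close>, so that
  \<open>\<bar>\<omega>\<bar> powr (\<alpha> + p)\<close> times \<open>u^\<close> is integrable (here \<open>\<alpha> < 2\<close> enters). The left Liouville derivative
  multiplies \<open>u^\<close> by \<open>(\<i> \<omega>) powr \<alpha>\<close> (\<open>left_liouville_fourier\<close>), and the difference operator multiplies
  it by \<open>h powr (-\<alpha>) exp(z) W(exp(-z))\<close> with \<open>z = \<i> \<omega> h\<close>. If the two symbols satisfy
  \<open>\<bar>exp(z) W(exp(-z)) - z powr \<alpha>\<bar> \<le> C \<bar>z\<bar> powr (\<alpha> + p)\<close>, then Fourier inversion bounds the error by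
  \<open>C h^p\<close> times the integral of \<open>\<bar>\<omega>\<bar> powr (\<alpha> + p) \<bar>u^\<bar>\<close>, up to the factor \<open>2 \<pi>\<close>. The right-hand
  operators are the left-hand ones for the reflected function \<open>u(-x)\<close>.

  The symbols are used only in the open half plane \<open>Re z > 0\<close>, where the series for \<open>W(exp(-z))\<close>
  converges; the imaginary axis is reached by a limit in which the samples of \<open>u\<close>
  (absolutely summable by \<open>summable_samples\<close>) are damped exponentially. For this it
  suffices that the coefficients \<open>\<kappa>\<close> are bounded. The same device, a damping factor \<open>exp(-\<epsilon> t)\<close>,
  makes the kernel \<open>t powr (1 - \<alpha>)\<close> of the Liouville integral integrable; its transform is then a
  Laplace integral.

  The estimate for the symbols (\<open>gen_fun_symbol_error\<close>) has two parts. Away from \<open>0\<close> it needs that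
  \<open>W\<close> is bounded on the disc. Near the zeros of the generating polynomial \<open>P\<close> the power \<open>P powr \<alpha>\<close> has
  no global branch, but \<open>W\<close> satisfies \<open>W' P = \<alpha> W P'\<close>, hence \<open>\<bar>W\<bar> = \<bar>P\<bar> powr \<alpha>\<close>. Near \<open>0\<close> the definition of the
  parameters gives exactly the estimate for \<open>z powr \<alpha> (P(exp(-z))/z) powr \<alpha>\<close>, and it remains to see that
  this is the value of \<open>W(exp(-z))\<close>. Both functions are analytic for \<open>Re z > 0\<close>, but \<open>W\<close> is
  prescribed near \<open>0\<close> in the disc, whereas the estimate concerns the neighbourhood of \<open>1\<close>. The branch could
  change in between if \<open>P\<close> had a zero in the interval \<open>(0, 1)\<close>. It has none: the recursion for the
  parameters says that \<open>P(1 - y)\<close> is the Taylor polynomial of \<open>-ln(1 - y) (1 - y) powr (1/\<alpha>)\<close>, and all derivatives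
  of this positive function from the second on are negative, so that its Taylor polynomials lie above it
  (\<open>gen_poly_pos\<close>).
\<close>

section \<open>Decay of Fourier transforms\<close>

text \<open>
  Integrate \<open>g (x + 1) - g x = \<integral> g' (x + s) ds\<close>, \<open>s\<close> from \<open>0\<close> to \<open>1\<close>, over all \<open>x\<close>: the left-hand side
  gives \<open>0\<close> by translation invariance, the right-hand side gives the integral of \<open>g'\<close> by Fubini. In this form
  the behaviour of \<open>g\<close> at infinity does not enter. The derivative may be discontinuous, so
  the fundamental theorem is the one for the gauge integral.
\<close>

lemma integral_of_derivative_eq_0:
  fixes g g' :: "real \<Rightarrow> 'a::euclidean_space"
  assumes der: "\<And>x. (g has_vector_derivative g' x) (at x)"
    and g: "integrable lborel g" and g': "integrable lborel g'"
  shows "(LINT x|lborel. g' x) = 0"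
proof -
  have [measurable]: "g \<in> borel_measurable borel" "g' \<in> borel_measurable borel"
    using g g' by (auto dest: borel_measurable_integrable)
  have unit_step: "(LINT s|lborel. indicator {0..1} s *\<^sub>R g' (x + s)) = g (x + 1) - g x" for x
  proof -
    have "((\<lambda>s. g' (x + s)) has_integral (g (x + 1) - g (x + 0))) {0..1}"
    proof (rule fundamental_theorem_of_calculus)
      fix s :: real
      have "((\<lambda>s. x + s) has_real_derivative 1) (at s within {0..1})"
        by (auto intro!: derivative_eq_intros)
      then show "((\<lambda>s. g (x + s)) has_vector_derivative g' (x + s)) (at s within {0..1})"
        using vector_diff_chain_within[of "\<lambda>s. x + s" 1 s "{0..1}" g "g' (x+s)"]
        by (auto simp: o_def has_real_derivative_iff_has_vector_derivative
            intro: has_vector_derivative_at_within der)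
    qed auto
    moreover have "set_integrable lborel {0..1} (\<lambda>s. g' (x + s))"
      using lborel_integrable_real_affine[OF g', of 1 x]
      by (auto simp: set_integrable_def intro: integrable_mult_indicator)
    ultimately show ?thesis
      using set_borel_integral_eq_integral(2)[of "{0..1}" "\<lambda>s. g' (x + s)"]
      by (simp add: set_lebesgue_integral_def integral_unique)
  qed
  have ind: "integrable lborel (indicator {0..1} :: real \<Rightarrow> real)"
    using emeasure_lborel_Icc[of 0 1] by (intro integrable_real_indicator) auto
  have shift: "(LINT x|lborel. indicator {0..1} s *\<^sub>R g' (x + s)) = indicator {0..1} s *\<^sub>R (LINT x|lborel. g' x)" for s :: real
    using lborel_integral_real_affine[of 1 g' s] by (simp add: add.commute)
  have norm_shift: "(LINT x|lborel. norm (indicator {0..1} s *\<^sub>R g' (x + s))) = indicator {0..1} s * (LINT x|lborel. norm (g' x))" for s :: real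
    using lborel_integral_real_affine[of 1 "\<lambda>x. norm (g' x)" s] by (simp add: add.commute)
  have "integrable (lborel \<Otimes>\<^sub>M lborel) (\<lambda>(s, x). indicator {0..1} s *\<^sub>R g' (x + s))"
  proof (rule lborel_pair.Fubini_integrable)
    have "integrable lborel (\<lambda>s::real. indicator {0..1} s *\<^sub>R (LINT x|lborel. norm (g' x)))"
      using ind by (intro integrable_scaleR_left)
    then show "integrable lborel (\<lambda>s. LINT x|lborel. norm (case (s, x) of (s, x) \<Rightarrow> indicator {0..1} s *\<^sub>R g' (x + s)))"
      unfolding prod.case norm_shift by simp
    show "AE s in lborel. integrable lborel (\<lambda>x. case (s, x) of (s, x) \<Rightarrow> indicator {0..1} s *\<^sub>R g' (x + s))"
      using lborel_integrable_real_affine[OF g', of 1] by (simp add: add.commute)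
  qed auto
  from lborel_pair.Fubini_integral[OF this]
  have "(LINT x|lborel. LINT s|lborel. indicator {0..1} s *\<^sub>R g' (x + s))
      = (LINT s|lborel. LINT x|lborel. indicator {0..1} s *\<^sub>R g' (x + s))" by simp
  also have "\<dots> = (LINT x|lborel. g' x)"
    unfolding shift using ind by (subst integral_scaleR_left) auto
  finally have "(LINT x|lborel. g' x) = (LINT x|lborel. g (x + 1) - g x)"
    by (simp add: unit_step)
  also have "\<dots> = 0"
    using lborel_integrable_real_affine[OF g, of 1 1] lborel_integral_real_affine[of 1 g 1] g
    by (simp add: add.commute)
  finally show ?thesis .
qed

definition fourier :: "(real \<Rightarrow> real) \<Rightarrow> real \<Rightarrow> complex" where
  "fourier f \<omega> = (LINT t|lborel. of_real (f t) * iexp (- (\<omega> * t)))"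

lemma norm_iexp_eq_1 [simp]: "norm (iexp x) = 1"
  by (simp add: norm_exp_eq_Re)

lemma fourier_measurable [measurable]:
  assumes [measurable]: "f \<in> borel_measurable borel"
  shows "fourier f \<in> borel_measurable borel"
  unfolding fourier_def by measurable

lemma integrable_times_iexp:
  assumes f: "integrable lborel f" and [measurable]: "g \<in> borel_measurable borel"
  shows "integrable lborel (\<lambda>t. complex_of_real (f t) * iexp (g t))"
proof (rule Bochner_Integration.integrable_bound[OF f])
  have [measurable]: "f \<in> borel_measurable borel" using f by (auto dest: borel_measurable_integrable)
  show "(\<lambda>t. complex_of_real (f t) * iexp (g t)) \<in> borel_measurable lborel" by measurable
qed (simp add: norm_mult)

lemma norm_fourier_le:
  assumes f: "integrable lborel f"
  shows "norm (fourier f \<omega>) \<le> (LINT t|lborel. \<bar>f t\<bar>)"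
proof -
  have "norm (fourier f \<omega>) \<le> (LINT t|lborel. norm (of_real (f t) * iexp (- (\<omega> * t))))"
    unfolding fourier_def by (rule integral_norm_bound)
  then show ?thesis by (simp add: norm_mult)
qed

lemma has_vector_derivative_iexp_linear:
  "((\<lambda>t. iexp (c * t)) has_vector_derivative \<i> * c * iexp (c * t)) (at t within S)"
proof -
  have "((\<lambda>z. exp (\<i> * (of_real c * z))) has_field_derivative \<i> * c * iexp (c * t)) (at (of_real t))"
    by (auto intro!: derivative_eq_intros)
  from has_vector_derivative_real_field[OF this] show ?thesis by simp
qed

text \<open>
  The integral of the derivative of \<open>f t exp(-\<i> \<omega> t)\<close> vanishes.
\<close>

lemma fourier_deriv:
  assumes der: "\<And>x. f differentiable at x"
    and f: "integrable lborel f" and f': "integrable lborel (deriv f)"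
  shows "fourier (deriv f) \<omega> = \<i> * \<omega> * fourier f \<omega>"
proof -
  have i1: "integrable lborel (\<lambda>t. complex_of_real (f t) * iexp (- (\<omega> * t)))"
    by (rule integrable_times_iexp[OF f]) measurable
  have i2: "integrable lborel (\<lambda>t. complex_of_real (deriv f t) * iexp (- (\<omega> * t)))"
    by (rule integrable_times_iexp[OF f']) measurable
  have i3: "integrable lborel (\<lambda>t. \<i> * \<omega> * (complex_of_real (f t) * iexp (- (\<omega> * t))))"
    using i1 by (rule integrable_mult_right)
  have "(LINT t|lborel. of_real (deriv f t) * iexp (- (\<omega> * t)) - \<i> * \<omega> * (of_real (f t) * iexp (- (\<omega> * t)))) = 0"
  proof (rule integral_of_derivative_eq_0)
    fix t
    have "(f has_real_derivative deriv f t) (at t)"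
      using der DERIV_deriv_iff_real_differentiable by blast
    then have "((\<lambda>t. complex_of_real (f t)) has_vector_derivative of_real (deriv f t)) (at t)"
      by (intro has_vector_derivative_of_real) 
    then show "((\<lambda>t. complex_of_real (f t) * iexp (- (\<omega> * t))) has_vector_derivative
        of_real (deriv f t) * iexp (- (\<omega> * t)) - \<i> * \<omega> * (of_real (f t) * iexp (- (\<omega> * t)))) (at t)"
      using has_vector_derivative_mult[OF _ has_vector_derivative_iexp_linear[of "-\<omega>" t UNIV],
          of "\<lambda>t. of_real (f t)" "of_real (deriv f t)"]
      by (simp add: algebra_simps)
    show "integrable lborel (\<lambda>t. of_real (deriv f t) * iexp (- (\<omega> * t)) - \<i> * \<omega> * (of_real (f t) * iexp (- (\<omega> * t))))"
      using i2 i3 by (rule Bochner_Integration.integrable_diff)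
  qed (rule i1)
  then show ?thesis
    unfolding fourier_def Bochner_Integration.integral_diff[OF i2 i3] integral_mult_right_zero by simp
qed

definition integrable_derivs :: "nat \<Rightarrow> (real \<Rightarrow> real) \<Rightarrow> bool" where
  "integrable_derivs n u \<longleftrightarrow> derivs_exist n u \<and> (\<forall>k\<le>n. integrable lborel ((deriv ^^ k) u))"

lemma integrable_derivs_DERIV:
  assumes "integrable_derivs n u" "1 \<le> n"
  shows "(u has_real_derivative deriv u t) (at t)" "integrable lborel u" "integrable lborel (deriv u)"
proof -
  have "u differentiable at t"
    using assms unfolding integrable_derivs_def derivs_exist_def
    by (metis (no_types) One_nat_def Suc_le_eq funpow_0)
  then show "(u has_real_derivative deriv u t) (at t)"
    using DERIV_deriv_iff_real_differentiable by blast
  show "integrable lborel u" "integrable lborel (deriv u)"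
    using assms unfolding integrable_derivs_def
    by (metis (no_types) funpow_0 le0, metis (no_types) One_nat_def funpow_simps_right(1,2) o_apply id_apply)
qed

lemma fourier_iterated_deriv:
  assumes "integrable_derivs n u" "k \<le> n"
  shows "fourier ((deriv ^^ k) u) \<omega> = (\<i> * \<omega>) ^ k * fourier u \<omega>"
  using assms(2)
proof (induction k)
  case (Suc k)
  have "fourier (deriv ((deriv ^^ k) u)) \<omega> = \<i> * \<omega> * fourier ((deriv ^^ k) u) \<omega>"
  proof (rule fourier_deriv)
    show "(deriv ^^ k) u differentiable at x" for x
      using assms Suc by (auto simp: integrable_derivs_def derivs_exist_def)
    show "integrable lborel ((deriv ^^ k) u)"
      using assms Suc by (auto simp: integrable_derivs_def)
    show "integrable lborel (deriv ((deriv ^^ k) u))"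
      using assms Suc(2) by (auto simp: integrable_derivs_def dest!: spec[of _ "Suc k"])
  qed
  then show ?case using Suc by simp
qed simp

lemma integrable_two_powers:
  fixes a b :: real
  assumes "-1 < a" "b < -1"
  shows "integrable lborel (\<lambda>\<omega>. if \<bar>\<omega>\<bar> \<le> 1 then \<bar>\<omega>\<bar> powr a else \<bar>\<omega>\<bar> powr b)"
proof -
  have si: "set_integrable lborel S f"
    if "f integrable_on S" "\<And>x. x \<in> S \<Longrightarrow> 0 \<le> f x" "S \<in> sets borel" "f \<in> borel_measurable borel"
    for S and f :: "real \<Rightarrow> real"
  proof -
    have "f absolutely_integrable_on S"
      using that absolutely_integrable_on_iff_nonneg by blast
    then show ?thesis
      using that unfolding set_integrable_def
      by (subst (asm) integrable_completion) auto
  qed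
  have *: "set_integrable lborel {0..1} (\<lambda>x::real. x powr a)" "set_integrable lborel {1..} (\<lambda>x::real. x powr b)"
    using integrable_on_powr_from_0[of a 1] has_integral_powr_to_inf[of b 1] assms
    by (auto intro!: si simp: integrable_on_def)
  define g where "g x = indicator {0..1} x * x powr a + indicator {1..} x * x powr b" for x :: real
  have g: "integrable lborel g"
    using * unfolding g_def set_integrable_def by (auto intro: Bochner_Integration.integrable_add)
  then have "integrable lborel (\<lambda>x. g (- x))"
    using lborel_integrable_real_affine[OF g, of "-1" 0] by simp
  with g have "integrable lborel (\<lambda>x. g x + g (- x))" by simp
  then show ?thesis
    by (rule Bochner_Integration.integrable_bound) (auto simp: g_def indicator_def)
qed

text \<open>
  For \<open>\<bar>\<omega>\<bar> \<le> 1\<close> the transform is bounded by the \<open>L1\<close> norm of \<open>u\<close>, and for larger \<open>\<bar>\<omega>\<bar>\<close> the \<open>L1\<close> norm of the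
  \<open>n\<close>-th derivative gives the decay \<open>\<bar>\<omega>\<bar> powr (-n)\<close>.
\<close>

lemma integrable_powr_fourier:
  assumes u: "integrable_derivs n u" and \<beta>: "-1 < \<beta>" "\<beta> + 1 < n"
  shows "integrable lborel (\<lambda>\<omega>. \<bar>\<omega>\<bar> powr \<beta> * norm (fourier u \<omega>))"
proof -
  have int: "integrable lborel u" "integrable lborel ((deriv ^^ n) u)"
    using u by (auto simp: integrable_derivs_def dest: spec[of _ 0])
  then have [measurable]: "u \<in> borel_measurable borel" by (auto dest: borel_measurable_integrable)
  define M where "M = max (LINT t|lborel. \<bar>u t\<bar>) (LINT t|lborel. \<bar>(deriv ^^ n) u t\<bar>)"
  have "M \<ge> 0" by (simp add: M_def le_max_iff_disj)
  have le: "\<bar>\<omega>\<bar> powr \<beta> * norm (fourier u \<omega>)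
      \<le> M * (if \<bar>\<omega>\<bar> \<le> 1 then \<bar>\<omega>\<bar> powr \<beta> else \<bar>\<omega>\<bar> powr (\<beta> - n))" for \<omega>
  proof (cases "\<bar>\<omega>\<bar> \<le> 1")
    case True
    have "norm (fourier u \<omega>) \<le> M"
      using norm_fourier_le[OF int(1), of \<omega>] by (simp add: M_def)
    with True show ?thesis by (simp add: mult.commute mult_right_mono)
  next
    case False
    have "norm (fourier ((deriv ^^ n) u) \<omega>) \<le> M"
      using norm_fourier_le[OF int(2), of \<omega>] by (simp add: M_def)
    then have "\<bar>\<omega>\<bar> ^ n * norm (fourier u \<omega>) \<le> M"
      using fourier_iterated_deriv[OF u order_refl] by (simp add: norm_mult norm_power)
    then have "norm (fourier u \<omega>) \<le> M / \<bar>\<omega>\<bar> ^ n"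
      using False by (simp add: field_simps)
    then have "\<bar>\<omega>\<bar> powr \<beta> * norm (fourier u \<omega>) \<le> \<bar>\<omega>\<bar> powr \<beta> * (M / \<bar>\<omega>\<bar> ^ n)"
      by (intro mult_left_mono) auto
    also have "\<dots> = M * \<bar>\<omega>\<bar> powr (\<beta> - n)"
      using False by (simp add: powr_diff powr_realpow)
    finally show ?thesis using False by simp
  qed
  have "integrable lborel (\<lambda>\<omega>. M * (if \<bar>\<omega>\<bar> \<le> 1 then \<bar>\<omega>\<bar> powr \<beta> else \<bar>\<omega>\<bar> powr (\<beta> - n)))"
    using integrable_two_powers[of \<beta> "\<beta> - n"] \<beta> by (intro integrable_mult_right) auto
  then show ?thesis
    by (rule Bochner_Integration.integrable_bound) (use le \<open>M \<ge> 0\<close> in \<open>auto simp: abs_mult split: if_splits\<close>)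
qed

lemma integrable_norm_fourier:
  assumes u: "integrable_derivs n u" "2 \<le> n"
  shows "integrable lborel (\<lambda>\<omega>. norm (fourier u \<omega>))" "integrable lborel (fourier u)"
proof -
  have [measurable]: "u \<in> borel_measurable borel"
    using integrable_derivs_DERIV(2)[OF u(1)] u(2) by (auto dest: borel_measurable_integrable)
  show "integrable lborel (\<lambda>\<omega>. norm (fourier u \<omega>))"
  proof (rule integrable_cong_AE_imp)
    show "integrable lborel (\<lambda>\<omega>. \<bar>\<omega>\<bar> powr 0 * norm (fourier u \<omega>))"
      by (rule integrable_powr_fourier[OF u(1)]) (use u(2) in auto)
    show "AE \<omega> in lborel. \<bar>\<omega>\<bar> powr 0 * norm (fourier u \<omega>) = norm (fourier u \<omega>)"
      using AE_lborel_singleton[of "0::real"] by (rule eventually_mono) simp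
  qed measurable
  then show "integrable lborel (fourier u)"
    by (subst (asm) integrable_norm_iff) auto
qed

section \<open>Fourier inversion\<close>

text \<open>
  The form of the integrability condition in which Fubini's theorem is applied below: domination by a
  product of integrable functions.
\<close>

lemma integrable_pair_bound:
  fixes F :: "real \<Rightarrow> real \<Rightarrow> complex"
  assumes f: "integrable lborel f" and g: "integrable lborel g"
    and [measurable]: "case_prod F \<in> borel_measurable (borel \<Otimes>\<^sub>M borel)"
    and bound: "\<And>x y. norm (F x y) \<le> f x * g y"
  shows "integrable (lborel \<Otimes>\<^sub>M lborel) (case_prod F)"
proof (rule Bochner_Integration.integrable_bound)
  have [measurable]: "f \<in> borel_measurable borel" "g \<in> borel_measurable borel"
    using f g by (auto dest: borel_measurable_integrable)
  show "integrable (lborel \<Otimes>\<^sub>M lborel) (\<lambda>(x, y). f x * g y)"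
  proof (rule lborel_pair.Fubini_integrable)
    have "integrable lborel (\<lambda>x. \<bar>f x\<bar> * (LINT y|lborel. \<bar>g y\<bar>))"
      using f by (intro integrable_mult_left integrable_abs)
    then show "integrable lborel (\<lambda>x. LINT y|lborel. norm (case (x, y) of (x, y) \<Rightarrow> f x * g y))"
      by (simp add: abs_mult)
  qed (use g in auto)
  show "case_prod F \<in> borel_measurable (lborel \<Otimes>\<^sub>M lborel)" by measurable
  have "norm (F x y) \<le> \<bar>f x * g y\<bar>" for x y using bound[of x y] by linarith
  then show "AE x in lborel \<Otimes>\<^sub>M lborel. norm (case_prod F x) \<le> norm (case x of (x, y) \<Rightarrow> f x * g y)"
    by auto
qed

lemma std_normal_fourier:
  "(LINT v|lborel. std_normal_density v *\<^sub>R iexp (y * v)) = of_real (exp (- y\<^sup>2 / 2))"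
proof -
  have "char std_normal_distribution y = (LINT v|lborel. std_normal_density v *\<^sub>R iexp (y * v))"
    unfolding char_def by (subst integral_density) (auto simp: normal_density_nonneg)
  then show ?thesis
    by (simp add: char_std_normal_distribution)
qed

text \<open>
  Gaussian summation: with the weight \<open>n(\<epsilon> \<omega>)\<close>, \<open>n\<close> the standard normal density, Fubini's theorem
  turns the inversion integral into an average of \<open>u\<close> over a normal distribution
  with mean \<open>x\<close> and standard deviation \<open>\<epsilon>\<close>. As \<open>\<epsilon>\<close> tends to \<open>0\<close>, both sides converge by dominated
  convergence.
\<close>

lemma fourier_inversion:
  assumes u: "integrable lborel u" and cont: "continuous_on UNIV u" and bd: "\<And>t. \<bar>u t\<bar> \<le> B"
    and uh: "integrable lborel (fourier u)"
  shows "(LINT \<omega>|lborel. fourier u \<omega> * iexp (\<omega> * x)) = 2 * pi * u x"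
proof -
  let ?n = "std_normal_density"
  define \<epsilon> where "\<epsilon> k = inverse (real (Suc k))" for k
  have \<epsilon>: "\<epsilon> k > 0" for k by (simp add: \<epsilon>_def)
  have \<epsilon>0: "\<epsilon> \<longlonglongrightarrow> 0" unfolding \<epsilon>_def by (rule LIMSEQ_inverse_real_of_nat)
  have [measurable]: "u \<in> borel_measurable borel" using u by (auto dest: borel_measurable_integrable)
  have n_int: "integrable lborel ?n" by (rule integrable_normal_density) simp
  have n_le: "?n v \<le> 1 / sqrt (2 * pi)" for v
    by (simp add: std_normal_density_def divide_right_mono)
  have n_cont: "isCont ?n v" for v
    unfolding std_normal_density_def by (intro continuous_intros) auto
  have "(LINT \<omega>|lborel. ?n (\<epsilon> k * \<omega>) *\<^sub>R (fourier u \<omega> * iexp (\<omega> * x)))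
      = (LINT v|lborel. (sqrt (2 * pi) * ?n v) *\<^sub>R complex_of_real (u (x - \<epsilon> k * v)))" for k
  proof -
    define F where "F \<omega> t = ?n (\<epsilon> k * \<omega>) *\<^sub>R (complex_of_real (u t) * iexp (- (\<omega> * t)) * iexp (\<omega> * x))" for \<omega> t
    have "integrable (lborel \<Otimes>\<^sub>M lborel) (case_prod F)"
    proof (rule integrable_pair_bound)
      show "integrable lborel (\<lambda>\<omega>. ?n (\<epsilon> k * \<omega>))"
        using lborel_integrable_real_affine[OF n_int, of "\<epsilon> k" 0] \<epsilon>[of k] by simp
      show "integrable lborel (\<lambda>t. \<bar>u t\<bar>)" using u by simp
      show "case_prod F \<in> borel_measurable (borel \<Otimes>\<^sub>M borel)" unfolding F_def by measurable
    qed (simp add: F_def norm_mult)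
    from lborel_pair.Fubini_integral[OF this]
    have eq: "(LINT t|lborel. LINT \<omega>|lborel. F \<omega> t) = (LINT \<omega>|lborel. LINT t|lborel. F \<omega> t)" .
    have 1: "(LINT t|lborel. F \<omega> t) = ?n (\<epsilon> k * \<omega>) *\<^sub>R (fourier u \<omega> * iexp (\<omega> * x))" for \<omega>
      unfolding F_def fourier_def by simp
    have 2: "(LINT \<omega>|lborel. F \<omega> t) = (sqrt (2 * pi) * ?n ((x - t) / \<epsilon> k) / \<epsilon> k) *\<^sub>R complex_of_real (u t)" for t
    proof -
      have "F \<omega> t = complex_of_real (u t) * (?n (\<epsilon> k * \<omega>) *\<^sub>R iexp ((x - t) / \<epsilon> k * (\<epsilon> k * \<omega>)))" for \<omega>
      proof -
        have "(x - t) / \<epsilon> k * (\<epsilon> k * \<omega>) = - (\<omega> * t) + \<omega> * x"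
          using \<epsilon>[of k] by (simp add: field_simps)
        then have "iexp ((x - t) / \<epsilon> k * (\<epsilon> k * \<omega>)) = iexp (- (\<omega> * t)) * iexp (\<omega> * x)"
          by (simp only: of_real_add distrib_left exp_add)
        then show ?thesis by (simp add: F_def)
      qed
      then have "(LINT \<omega>|lborel. F \<omega> t)
          = complex_of_real (u t) * (LINT \<omega>|lborel. ?n (\<epsilon> k * \<omega>) *\<^sub>R iexp ((x - t) / \<epsilon> k * (\<epsilon> k * \<omega>)))"
        by (simp only: integral_mult_right_zero)
      also have "(LINT \<omega>|lborel. ?n (\<epsilon> k * \<omega>) *\<^sub>R iexp ((x - t) / \<epsilon> k * (\<epsilon> k * \<omega>)))
          = (1 / \<epsilon> k) *\<^sub>R complex_of_real (exp (- ((x - t) / \<epsilon> k)\<^sup>2 / 2))"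
      proof -
        define c where "c = (x - t) / \<epsilon> k"
        have "(LINT v|lborel. ?n v *\<^sub>R iexp (c * v))
            = \<epsilon> k *\<^sub>R (LINT \<omega>|lborel. ?n (\<epsilon> k * \<omega>) *\<^sub>R iexp (c * (\<epsilon> k * \<omega>)))"
          using lborel_integral_real_affine[of "\<epsilon> k" "\<lambda>v. ?n v *\<^sub>R iexp (c * v)" 0] \<epsilon>[of k] by simp
        then show ?thesis
          unfolding std_normal_fourier c_def[symmetric] using \<epsilon>[of k] by (simp add: scaleR_conv_of_real field_simps)
      qed
      also have "exp (- ((x - t) / \<epsilon> k)\<^sup>2 / 2) = sqrt (2 * pi) * ?n ((x - t) / \<epsilon> k)"
        by (simp add: std_normal_density_def)
      finally show ?thesis by (simp add: scaleR_conv_of_real)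
    qed
    have "(LINT \<omega>|lborel. ?n (\<epsilon> k * \<omega>) *\<^sub>R (fourier u \<omega> * iexp (\<omega> * x)))
        = (LINT t|lborel. (sqrt (2 * pi) * ?n ((x - t) / \<epsilon> k) / \<epsilon> k) *\<^sub>R complex_of_real (u t))"
      using eq by (simp only: 1 2)
    also have "\<dots> = \<bar>- \<epsilon> k\<bar> *\<^sub>R (LINT v|lborel. (sqrt (2 * pi) * ?n ((x - (x + - \<epsilon> k * v)) / \<epsilon> k) / \<epsilon> k) *\<^sub>R complex_of_real (u (x + - \<epsilon> k * v)))"
      by (rule lborel_integral_real_affine) (use \<epsilon>[of k] in auto)
    also have "\<dots> = (LINT v|lborel. \<bar>- \<epsilon> k\<bar> *\<^sub>R ((sqrt (2 * pi) * ?n ((x - (x + - \<epsilon> k * v)) / \<epsilon> k) / \<epsilon> k) *\<^sub>R complex_of_real (u (x + - \<epsilon> k * v))))"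
      by (rule integral_scaleR_right[symmetric])
    also have "\<dots> = (LINT v|lborel. (sqrt (2 * pi) * ?n v) *\<^sub>R complex_of_real (u (x - \<epsilon> k * v)))"
      by (rule Bochner_Integration.integral_cong) (use \<epsilon>[of k] in auto)
    finally show ?thesis .
  qed
  moreover have "(\<lambda>k. LINT \<omega>|lborel. ?n (\<epsilon> k * \<omega>) *\<^sub>R (fourier u \<omega> * iexp (\<omega> * x)))
      \<longlonglongrightarrow> (LINT \<omega>|lborel. ?n 0 *\<^sub>R (fourier u \<omega> * iexp (\<omega> * x)))"
  proof (rule integral_dominated_convergence)
    show "integrable lborel (\<lambda>\<omega>. (1 / sqrt (2 * pi)) * norm (fourier u \<omega>))"
      using uh by (intro integrable_mult_right integrable_norm)
    have "(\<lambda>k. \<epsilon> k * \<omega>) \<longlonglongrightarrow> 0" for \<omega> using tendsto_mult_left_zero[OF \<epsilon>0] .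
    then have "(\<lambda>k. ?n (\<epsilon> k * \<omega>)) \<longlonglongrightarrow> ?n 0" for \<omega>
      using isCont_tendsto_compose[OF n_cont] by blast
    then show "AE \<omega> in lborel. (\<lambda>k. ?n (\<epsilon> k * \<omega>) *\<^sub>R (fourier u \<omega> * iexp (\<omega> * x))) \<longlonglongrightarrow> ?n 0 *\<^sub>R (fourier u \<omega> * iexp (\<omega> * x))"
      by (auto intro!: tendsto_scaleR)
    show "AE \<omega> in lborel. norm (?n (\<epsilon> k * \<omega>) *\<^sub>R (fourier u \<omega> * iexp (\<omega> * x))) \<le> (1 / sqrt (2 * pi)) * norm (fourier u \<omega>)" for k
      by (rule AE_I2) (use mult_right_mono[OF n_le norm_ge_zero] in \<open>simp add: norm_mult\<close>)
  qed measurable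
  moreover have "(\<lambda>k. LINT v|lborel. (sqrt (2 * pi) * ?n v) *\<^sub>R complex_of_real (u (x - \<epsilon> k * v)))
      \<longlonglongrightarrow> (LINT v|lborel. (sqrt (2 * pi) * ?n v) *\<^sub>R complex_of_real (u x))"
  proof (rule integral_dominated_convergence)
    show "integrable lborel (\<lambda>v. sqrt (2 * pi) * ?n v * B)"
      using n_int by (intro integrable_mult_left integrable_mult_right)
    have "(\<lambda>k. x - \<epsilon> k * v) \<longlonglongrightarrow> x - 0" for v by (intro tendsto_intros tendsto_mult_left_zero[OF \<epsilon>0])
    then have "(\<lambda>k. u (x - \<epsilon> k * v)) \<longlonglongrightarrow> u x" for v
      using isCont_tendsto_compose[of x u] cont by (auto simp: continuous_on_eq_continuous_at)
    then show "AE v in lborel. (\<lambda>k. (sqrt (2 * pi) * ?n v) *\<^sub>R complex_of_real (u (x - \<epsilon> k * v))) \<longlonglongrightarrow> (sqrt (2 * pi) * ?n v) *\<^sub>R complex_of_real (u x)"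
      by (auto intro!: tendsto_intros)
    show "AE v in lborel. norm ((sqrt (2 * pi) * ?n v) *\<^sub>R complex_of_real (u (x - \<epsilon> k * v))) \<le> sqrt (2 * pi) * ?n v * B" for k
      using bd by (auto intro!: mult_left_mono simp: abs_mult simp del: mult_le_cancel_left)
  qed measurable
  ultimately have "(LINT \<omega>|lborel. ?n 0 *\<^sub>R (fourier u \<omega> * iexp (\<omega> * x)))
      = (LINT v|lborel. (sqrt (2 * pi) * ?n v) *\<^sub>R complex_of_real (u x))"
    by (metis (no_types, lifting) LIMSEQ_unique ext)
  also have "(LINT v|lborel. (sqrt (2 * pi) * ?n v) *\<^sub>R complex_of_real (u x)) = (sqrt (2 * pi) * (LINT v|lborel. ?n v)) *\<^sub>R complex_of_real (u x)"
    using n_int by (subst integral_scaleR_left) auto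
  also have "(LINT v|lborel. ?n v) = 1" by (rule integral_normal_density) simp
  finally have "?n 0 *\<^sub>R (LINT \<omega>|lborel. fourier u \<omega> * iexp (\<omega> * x)) = sqrt (2 * pi) *\<^sub>R complex_of_real (u x)"
    by simp
  then have "sqrt (2 * pi) *\<^sub>R (?n 0 *\<^sub>R (LINT \<omega>|lborel. fourier u \<omega> * iexp (\<omega> * x))) = sqrt (2 * pi) *\<^sub>R (sqrt (2 * pi) *\<^sub>R complex_of_real (u x))"
    by simp
  then show ?thesis
    unfolding scaleR_scaleR by (simp add: std_normal_density_def scaleR_conv_of_real)
qed

section \<open>Boundedness and summability of samples\<close>

lemma bounded_of_integrable_deriv:
  assumes u: "integrable_derivs n u" "1 \<le> n"
  obtains B where "\<And>t. \<bar>u t\<bar> \<le> B"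
proof -
  have der: "(u has_real_derivative deriv u t) (at t)" for t
    using integrable_derivs_DERIV(1)[OF u] .
  have int: "integrable lborel (\<lambda>t. \<bar>deriv u t\<bar>)"
    using integrable_derivs_DERIV(3)[OF u] by simp
  have "\<bar>u b - u a\<bar> \<le> (LINT t|lborel. \<bar>deriv u t\<bar>)" if "a \<le> b" for a b
  proof -
    have *: "(deriv u has_integral (u b - u a)) {a..b}"
      by (rule fundamental_theorem_of_calculus[OF that])
        (use der in \<open>auto simp: has_real_derivative_iff_has_vector_derivative intro: has_vector_derivative_at_within\<close>)
    have i: "(\<lambda>t. \<bar>deriv u t\<bar>) integrable_on {a..b}"
      using integrable_on_lborel[OF int] integrable_on_subcbox[of "\<lambda>t. \<bar>deriv u t\<bar>" UNIV a b] by simp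
    have "norm (integral {a..b} (deriv u)) \<le> integral {a..b} (\<lambda>t. \<bar>deriv u t\<bar>)"
      using * i by (intro integral_norm_bound_integral) auto
    also have "\<dots> \<le> integral UNIV (\<lambda>t. \<bar>deriv u t\<bar>)"
      using i integrable_on_lborel[OF int] by (intro integral_subset_le) auto
    finally show ?thesis using * integral_lborel[OF int] by (auto dest: integral_unique)
  qed
  from this[of 0] this[of _ 0] have "\<bar>u t\<bar> \<le> \<bar>u 0\<bar> + (LINT t|lborel. \<bar>deriv u t\<bar>)" for t
    by (cases "0 \<le> t") (smt (verit))+
  then show ?thesis by (rule that)
qed

text \<open>
  On a cell of length \<open>h\<close> the modulus of \<open>u\<close> at the right end point exceeds its mean by at most the
  integral of \<open>\<bar>u'\<bar>\<close>, and the cells do not overlap.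
\<close>

lemma summable_samples:
  assumes u: "integrable_derivs n u" "1 \<le> n" and h: "0 < h"
  shows "summable (\<lambda>l. \<bar>u (a - real l * h)\<bar>)"
proof -
  define g where "g t = \<bar>u t\<bar> + h * \<bar>deriv u t\<bar>" for t
  have der: "(u has_real_derivative deriv u t) (at t)" for t
    using integrable_derivs_DERIV(1)[OF u] .
  have int: "integrable lborel u" "integrable lborel (deriv u)"
    using integrable_derivs_DERIV(2,3)[OF u] by simp_all
  then have g: "integrable lborel g" "integrable lborel (\<lambda>t. \<bar>u t\<bar>)" "integrable lborel (\<lambda>t. \<bar>deriv u t\<bar>)"
    "integrable lborel (\<lambda>t. h * \<bar>deriv u t\<bar>)"
    unfolding g_def by (auto intro!: Bochner_Integration.integrable_add integrable_mult_right)
  have sub: "f integrable_on {c..d}" if "integrable lborel f" for f :: "real \<Rightarrow> real" and c d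
    using integrable_on_lborel[OF that] integrable_on_subcbox[of f UNIV c d] by simp
  have cell: "h * \<bar>u b\<bar> \<le> integral {b - h..b} g" for b
  proof -
    let ?J = "integral {b - h..b} (\<lambda>t. \<bar>deriv u t\<bar>)"
    have "\<bar>u b\<bar> \<le> \<bar>u s\<bar> + ?J" if s: "s \<in> {b - h..b}" for s
    proof -
      have *: "(deriv u has_integral (u b - u s)) {s..b}"
        by (rule fundamental_theorem_of_calculus)
          (use der s in \<open>auto simp: has_real_derivative_iff_has_vector_derivative intro: has_vector_derivative_at_within\<close>)
      have "norm (integral {s..b} (deriv u)) \<le> integral {s..b} (\<lambda>t. \<bar>deriv u t\<bar>)"
        using * sub g by (intro integral_norm_bound_integral) auto
      also have "\<dots> \<le> ?J"
        using s sub g by (intro integral_subset_le) auto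
      finally show ?thesis using * by (auto dest: integral_unique)
    qed
    then have "integral {b - h..b} (\<lambda>s. \<bar>u b\<bar>) \<le> integral {b - h..b} (\<lambda>s. \<bar>u s\<bar> + ?J)"
      by (intro integral_le integrable_add sub g integrable_const_ivl) auto
    also have "\<dots> = integral {b - h..b} (\<lambda>s. \<bar>u s\<bar>) + h * ?J"
      using h by (subst integral_add) (auto intro: sub g)
    also have "\<dots> = integral {b - h..b} g"
      unfolding g_def by (subst integral_add) (auto intro: sub g)
    finally show ?thesis using h by simp
  qed
  have g0: "0 \<le> g t" for t using h by (simp add: g_def)
  have cells: "(\<Sum>l<N. h * \<bar>u (a - real l * h)\<bar>) \<le> integral {a - real N * h..a} g" for N
  proof (induction N)
    case (Suc N)
    have "integral {a - real N * h - h..a - real N * h} g + integral {a - real N * h..a} g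
        = integral {a - real N * h - h..a} g"
      by (rule Henstock_Kurzweil_Integration.integral_combine) (use h sub g in auto)
    moreover have e: "a - real (Suc N) * h = a - real N * h - h" by (simp add: algebra_simps)
    ultimately show ?case
      using Suc cell[of "a - real N * h"] unfolding e sum.lessThan_Suc by linarith
  qed simp
  have "summable (\<lambda>l. h * \<bar>u (a - real l * h)\<bar>)"
  proof (rule summableI_nonneg_bounded)
    fix N
    have "integral {a - real N * h..a} g \<le> integral UNIV g"
      using g0 sub g integrable_on_lborel by (intro integral_subset_le) auto
    with cells[of N] show "(\<Sum>l<N. h * \<bar>u (a - real l * h)\<bar>) \<le> integral UNIV g" by linarith
  qed (use h in auto)
  then show ?thesis using h by (simp add: summable_cmult_iff)
qed

section \<open>The Laplace transform of a power\<close>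

lemma Gamma_integral_scaled:
  fixes x a :: real
  assumes "0 < x" "0 < a"
  shows "has_bochner_integral lborel (\<lambda>t. indicator {0<..} t * (t powr (x - 1) * exp (- a * t))) (Gamma x * a powr - x)"
proof -
  define f where "f t = indicator {0<..} t * (t powr (x - 1) * exp (- t))" for t :: real
  have f_meas: "f \<in> borel_measurable lborel" unfolding f_def by measurable
  have "(\<integral>\<^sup>+t. ennreal (f t) \<partial>lborel) = (\<integral>\<^sup>+t. ennreal (indicator {0..} t * t powr (x - 1) / exp t) \<partial>lborel)"
    by (intro nn_integral_cong) (auto simp: f_def indicator_def exp_minus field_simps)
  then have nn: "(\<integral>\<^sup>+t. ennreal (f t) \<partial>lborel) = ennreal (Gamma x)"
    using Gamma_conv_nn_integral_real[OF assms(1)] by simp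
  have f: "integrable lborel f" "integral\<^sup>L lborel f = Gamma x"
    using nn_integral_eq_integrable[OF f_meas, of "Gamma x"] nn assms Gamma_real_pos[of x]
    by (auto simp: f_def)
  have eq: "indicator {0<..} t * (t powr (x - 1) * exp (- a * t)) = a powr (1 - x) * f (0 + a * t)" for t
    using assms by (auto simp: f_def indicator_def powr_mult zero_less_mult_iff powr_diff)
  have "integrable lborel (\<lambda>t. a powr (1 - x) * f (0 + a * t))"
    using lborel_integrable_real_affine[OF f(1), of a 0] assms by auto
  moreover have "(LINT t|lborel. a powr (1 - x) * f (0 + a * t)) = Gamma x * a powr - x"
    using lborel_integral_real_affine[of a f 0] assms f(2)
    by (simp add: powr_diff powr_minus field_simps)
  ultimately show ?thesis
    unfolding has_bochner_integral_iff eq by blast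
qed

lemma gbinomial_Gamma:
  fixes s :: real
  assumes "0 < s"
  shows "Gamma (s + real k) / fact k = Gamma s * (-1) ^ k * (- s gchoose k)"
proof -
  have "pochhammer s k = Gamma (s + real k) / Gamma s"
    using assms by (intro pochhammer_Gamma) (auto simp: nonpos_Ints_def)
  then have "Gamma (s + real k) = Gamma s * pochhammer s k"
    using Gamma_real_pos[OF assms] by simp
  then show ?thesis
    by (simp add: gbinomial_pochhammer power_mult_distrib[symmetric])
qed

lemma of_real_gbinomial: "complex_of_real (a gchoose k) = (of_real a gchoose k)"
  by (simp add: gbinomial_prod_rev)

text \<open>
  Analytic continuation from the positive axis, in a single step: for a sufficiently large real \<open>a\<close> the point \<open>w\<close> lies in
  the disc of radius \<open>a\<close> around \<open>a\<close>. Expanding \<open>exp((a - w) t)\<close> and integrating term by term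
  gives Gamma integrals, and their sum is the binomial series of \<open>(1 - (a - w)/a) powr (-s)\<close>.
\<close>

lemma Laplace_transform_powr:
  fixes s :: real and w :: complex
  assumes s: "0 < s" and w: "0 < Re w"
  shows "(LINT t|lborel. of_real (indicator {0<..} t * t powr (s - 1)) * exp (- w * of_real t))
       = of_real (Gamma s) * w powr (- of_real s)"
proof -
  \<comment> \<open>Any \<open>a > \<bar>w\<bar>\<^sup>2 / (2 Re w)\<close> satisfies \<open>\<bar>a - w\<bar> < a\<close>.\<close>
  define a where "a = (norm w)\<^sup>2 / (2 * Re w) + 1"
  define q where "q = of_real a - w"
  have a: "0 < a" using w by (simp add: a_def add_nonneg_pos)
  have "(norm q)\<^sup>2 = a\<^sup>2 - 2 * a * Re w + (norm w)\<^sup>2"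
    unfolding q_def cmod_power2 by (simp add: power2_eq_square algebra_simps)
  also have "2 * a * Re w = (norm w)\<^sup>2 + 2 * Re w"
    using w by (simp add: a_def field_simps)
  finally have "(norm q)\<^sup>2 < a\<^sup>2" using w by simp
  then have qa: "norm q < a" using a power2_less_imp_less by force
  define f where "f n t = of_real (indicator {0<..} t * (t powr (s + real n - 1) * exp (- a * t))) * (q ^ n / fact n)" for n :: nat and t :: real
  have eqt: "indicator {0<..} t * (t powr (s + real n - 1) * exp (- a * t))
      = indicator {0<..} t * (t powr (s - 1) * exp (- a * t)) * t ^ n" for t :: real and n :: nat
    by (auto simp: indicator_def powr_add powr_diff powr_realpow)
  have f_term: "f n t = of_real (indicator {0<..} t * (t powr (s - 1) * exp (- a * t))) * ((q * of_real t) ^ n / fact n)" for n t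
    unfolding f_def eqt by (simp add: power_mult_distrib)
  have f_int: "integrable lborel (f n)" for n
    using Gamma_integral_scaled[of "s + real n" a] s a
    unfolding f_def by (intro integrable_mult_left integrable_of_real) (auto simp: has_bochner_integral_iff)
  have f_val: "(LINT t|lborel. f n t) = of_real (Gamma (s + real n) * a powr - (s + real n)) * (q ^ n / fact n)" for n
  proof -
    have "(LINT t|lborel. indicator {0<..} t * (t powr (s + real n - 1) * exp (- a * t))) = Gamma (s + real n) * a powr - (s + real n)"
      using Gamma_integral_scaled[of "s + real n" a] s a by (simp add: has_bochner_integral_iff)
    then show ?thesis unfolding f_def integral_mult_left_zero integral_complex_of_real by (simp only:)
  qed
  have f_norm: "(LINT t|lborel. norm (f n t)) = Gamma (s + real n) * a powr - (s + real n) * (norm q ^ n / fact n)" for n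
  proof -
    have "norm (f n t) = indicator {0<..} t * (t powr (s + real n - 1) * exp (- a * t)) * (norm q ^ n / fact n)" for t
      by (simp add: f_def norm_mult norm_divide norm_power abs_mult)
    then show ?thesis
      using Gamma_integral_scaled[of "s + real n" a] s a
      by (simp add: has_bochner_integral_iff)
  qed
  have coeff: "Gamma (s + real n) * a powr - (s + real n) / fact n = Gamma s * a powr - s * ((- s gchoose n) * (- 1 / a) ^ n)" for n
  proof -
    have "Gamma (s + real n) * a powr - (s + real n) / fact n = (Gamma (s + real n) / fact n) * a powr (- s) / a ^ n"
      using a by (simp add: powr_diff powr_realpow)
    then show ?thesis unfolding gbinomial_Gamma[OF s]
      by (simp add: power_minus[of "1 / a"] power_divide)
  qed
  have "(\<lambda>n. f n t) sums (of_real (indicator {0<..} t * t powr (s - 1)) * exp (- w * of_real t))" for t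
  proof -
    have "(\<lambda>n. (q * of_real t) ^ n / fact n) sums exp (q * of_real t)"
      using exp_converges[of "q * of_real t"] by (simp add: scaleR_conv_of_real divide_inverse mult.commute)
    from sums_mult[OF this, of "of_real (indicator {0<..} t * (t powr (s - 1) * exp (- a * t)))"]
    have "(\<lambda>n. f n t) sums (of_real (indicator {0<..} t * (t powr (s - 1) * exp (- a * t))) * exp (q * of_real t))"
      unfolding f_term .
    also have "of_real (indicator {0<..} t * (t powr (s - 1) * exp (- a * t))) * exp (q * of_real t)
        = of_real (indicator {0<..} t * t powr (s - 1)) * (exp (of_real (- a * t)) * exp (q * of_real t))"
      by (simp flip: exp_of_real)
    also have "exp (of_real (- a * t)) * exp (q * of_real t) = exp (- w * of_real t)"
      by (simp add: exp_add[symmetric] q_def algebra_simps)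
    finally show ?thesis .
  qed
  then have f_sum: "(\<Sum>n. f n t) = of_real (indicator {0<..} t * t powr (s - 1)) * exp (- w * of_real t)" for t
    using sums_unique by metis
  have "(\<lambda>n. LINT t|lborel. f n t) sums (LINT t|lborel. (\<Sum>n. f n t))"
  proof (rule sums_integral[OF f_int])
    have "summable (\<lambda>n. norm (f n t))" for t
    proof -
      have "summable (\<lambda>n. (norm (q * of_real t)) ^ n / fact n)"
        using summable_exp[of "norm (q * of_real t)"] by (simp add: divide_inverse mult.commute)
      then show ?thesis
        unfolding f_term norm_mult norm_divide norm_power by (intro summable_mult) simp
    qed
    then show "AE t in lborel. summable (\<lambda>n. norm (f n t))" by simp
    have "(\<lambda>n. (- s gchoose n) * (- norm q / a) ^ n) sums (1 + (- norm q / a)) powr (- s)"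
      by (rule gen_binomial_real) (use qa a in simp)
    then have S: "summable (\<lambda>n. Gamma s * a powr - s * ((- s gchoose n) * (- norm q / a) ^ n))"
      by (intro summable_mult sums_summable)
    have "Gamma s * a powr - s * ((- s gchoose n) * (- norm q / a) ^ n) = (LINT t|lborel. norm (f n t))" for n
      using coeff[of n] unfolding f_norm
      by (simp add: field_simps power_minus')
    with S show "summable (\<lambda>n. LINT t|lborel. norm (f n t))" by (simp only:)
  qed
  moreover have "(LINT t|lborel. f n t) = of_real (Gamma s * a powr - s) * ((- of_real s gchoose n) * (- q / of_real a) ^ n)" for n
  proof -
    have "(LINT t|lborel. f n t) = of_real (Gamma (s + real n) * a powr - (s + real n) / fact n) * q ^ n"
      unfolding f_val by simp
    also have "\<dots> = of_real (Gamma s * a powr - s) * ((- of_real s gchoose n) * ((- 1 / of_real a) ^ n * q ^ n))"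
      unfolding coeff using of_real_gbinomial[of "-s" n] by simp
    also have "(- 1 / of_real a) ^ n * q ^ n = (- q / of_real a) ^ n"
      by (simp add: power_mult_distrib[symmetric])
    finally show ?thesis .
  qed
  ultimately have "(\<lambda>n. of_real (Gamma s * a powr - s) * ((- of_real s gchoose n) * (- q / of_real a) ^ n)) sums
      (LINT t|lborel. of_real (indicator {0<..} t * t powr (s - 1)) * exp (- w * of_real t))"
    unfolding f_sum by simp
  moreover have "(\<lambda>n. (- of_real s gchoose n) * (- q / of_real a) ^ n) sums (1 + (- q / of_real a)) powr (- of_real s)"
    by (rule gen_binomial_complex) (use qa a in \<open>simp add: norm_divide\<close>)
  then have "(\<lambda>n. of_real (Gamma s * a powr - s) * ((- of_real s gchoose n) * (- q / of_real a) ^ n)) sums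
      (of_real (Gamma s * a powr - s) * (1 + (- q / of_real a)) powr (- of_real s))"
    by (rule sums_mult)
  moreover have "1 + (- q / of_real a) = w / of_real a"
    using a by (simp add: q_def field_simps)
  moreover have "of_real (a powr - s) * (w / of_real a) powr (- of_real s) = w powr (- of_real s)"
  proof -
    have "of_real (a powr - s) * (w / of_real a) powr (- of_real s)
        = of_real a powr (- of_real s) * (w / of_real a) powr (- of_real s)"
      using a powr_of_real[of a "- s"] by simp
    also have "\<dots> = (of_real a * (w / of_real a)) powr (- of_real s)"
      using a by (subst powr_times_real_left) auto
    finally show ?thesis using a by simp
  qed
  ultimately show ?thesis
    using sums_unique2 by (metis (no_types, lifting) mult.assoc of_real_mult)
qed

section \<open>The Liouville derivative as a Fourier multiplier\<close>

text \<open>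
  The principal power jumps only on the negative real axis, so along the imaginary axis it is
  continuous except at \<open>0\<close>.
\<close>

lemma measurable_imaginary_powr [measurable]:
  "(\<lambda>\<omega>. (\<i> * complex_of_real \<omega>) powr complex_of_real r) \<in> borel_measurable borel"
proof -
  have "continuous_on (- {0}) (\<lambda>\<omega>. (\<i> * complex_of_real \<omega>) powr complex_of_real r)"
    by (intro continuous_intros) (auto simp: complex_nonpos_Reals_iff)
  then have "(\<lambda>\<omega>. indicator (- {0}) \<omega> *\<^sub>R (\<i> * complex_of_real \<omega>) powr complex_of_real r) \<in> borel_measurable borel"
    by (intro borel_measurable_continuous_on_indicator) auto
  also have "(\<lambda>\<omega>. indicator (- {0}) \<omega> *\<^sub>R (\<i> * complex_of_real \<omega>) powr complex_of_real r)
      = (\<lambda>\<omega>. (\<i> * complex_of_real \<omega>) powr complex_of_real r)"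
    by (auto simp: indicator_def)
  finally show ?thesis .
qed

lemma norm_imaginary_powr: "norm ((\<i> * complex_of_real \<omega>) powr complex_of_real r) = \<bar>\<omega>\<bar> powr r"
  by (simp add: norm_powr_real_powr' norm_mult)

text \<open>
  Near \<open>0\<close> the kernel is integrable and \<open>u\<close> is bounded; away from \<open>0\<close> the kernel is bounded by \<open>1\<close> and \<open>u\<close> is
  integrable.
\<close>

lemma fractional_kernel_integrable:
  assumes u: "integrable_derivs n u" "1 \<le> n" and s: "0 < s" "s < 1"
  shows "integrable lborel (\<lambda>t. indicator {0<..} t * (t powr (s - 1) * u (x - t)))"
proof -
  obtain B where B: "\<bar>u t\<bar> \<le> B" for t using bounded_of_integrable_deriv[OF u] by blast
  have u_int: "integrable lborel u" using integrable_derivs_DERIV[OF u] by simp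
  then have [measurable]: "u \<in> borel_measurable borel" by (auto dest: borel_measurable_integrable)
  have B0: "0 \<le> B" using B[of 0] by linarith
  let ?w = "\<lambda>t::real. if \<bar>t\<bar> \<le> 1 then \<bar>t\<bar> powr (s - 1) else \<bar>t\<bar> powr (- 2)"
  show ?thesis
  proof (rule Bochner_Integration.integrable_bound)
    have "integrable lborel (\<lambda>t. u (x - t))"
      using lborel_integrable_real_affine[OF u_int, of "-1" x] by simp
    then show "integrable lborel (\<lambda>t. B * ?w t + \<bar>u (x - t)\<bar>)"
      using s by (intro Bochner_Integration.integrable_add integrable_mult_right integrable_two_powers integrable_abs) auto
    have "\<bar>indicator {0<..} t * (t powr (s - 1) * u (x - t))\<bar> \<le> B * ?w t + \<bar>u (x - t)\<bar>" for t
    proof (cases "0 < t \<and> 1 < t")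
      case True
      then have "t powr (s - 1) \<le> 1" using powr_mono[of "s - 1" 0 t] s by simp
      then have "t powr (s - 1) * \<bar>u (x - t)\<bar> \<le> 1 * \<bar>u (x - t)\<bar>" by (intro mult_right_mono) auto
      moreover have "0 \<le> B * ?w t" using B0 by simp
      ultimately show ?thesis using True by (simp add: abs_mult)
    next
      case False
      have "t powr (s - 1) * \<bar>u (x - t)\<bar> \<le> t powr (s - 1) * B" by (intro mult_left_mono B) auto
      then have "t powr (s - 1) * \<bar>u (x - t)\<bar> \<le> B * t powr (s - 1) + \<bar>u (x - t)\<bar>"
        by (simp only: mult.commute[of B])
      then show ?thesis using False B0 by (cases "0 < t") (auto simp: abs_mult)
    qed
    then show "AE t in lborel. norm (indicator {0<..} t * (t powr (s - 1) * u (x - t))) \<le> norm (B * ?w t + \<bar>u (x - t)\<bar>)"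
      by (intro AE_I2) (simp add: abs_mult order_trans[OF _ abs_ge_self])
  qed measurable
qed

text \<open>
  The kernel \<open>t powr (s - 1)\<close> is not integrable at infinity, hence the integrals cannot be exchanged directly. With the
  factor \<open>exp(-\<epsilon> t)\<close> they can, and the kernel has the transform \<open>Gamma s (\<epsilon> + \<i> \<omega>) powr (-s)\<close>. The
  limit for \<open>\<epsilon>\<close> to \<open>0\<close> is dominated on both sides, since \<open>\<bar>\<epsilon> + \<i> \<omega>\<bar> \<ge> \<bar>\<omega>\<bar>\<close>.
\<close>

lemma fractional_integral_fourier:
  assumes u: "integrable_derivs n u" "2 \<le> n" and s: "0 < s" "s < 1"
  shows "2 * pi * complex_of_real (LINT t|lborel. indicator {0<..} t * (t powr (s - 1) * u (x - t)))
       = of_real (Gamma s) * (LINT \<omega>|lborel. fourier u \<omega> * (\<i> * \<omega>) powr of_real (- s) * iexp (\<omega> * x))"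
proof -
  have n1: "1 \<le> n" using u by simp
  have u_int: "integrable lborel u" using integrable_derivs_DERIV[OF u(1) n1] by simp
  then have [measurable]: "u \<in> borel_measurable borel" by (auto dest: borel_measurable_integrable)
  obtain B where B: "\<bar>u t\<bar> \<le> B" for t using bounded_of_integrable_deriv[OF u(1) n1] by blast
  have cont: "continuous_on UNIV u"
    using integrable_derivs_DERIV(1)[OF u(1) n1]
    by (meson DERIV_isCont continuous_at_imp_continuous_on)
  have uh: "integrable lborel (\<lambda>\<omega>. \<bar>\<omega>\<bar> powr \<beta> * norm (fourier u \<omega>))" if "-1 < \<beta>" "\<beta> < 1" for \<beta>
    using integrable_powr_fourier[OF u(1), of \<beta>] that u(2) by simp
  note uh0n = integrable_norm_fourier(1)[OF u] and uh0 = integrable_norm_fourier(2)[OF u]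
  have inv: "(LINT \<omega>|lborel. fourier u \<omega> * iexp (\<omega> * x)) = 2 * pi * u x" for x
    by (rule fourier_inversion[OF u_int cont B uh0])
  define \<epsilon> where "\<epsilon> k = inverse (real (Suc k))" for k
  have \<epsilon>: "\<epsilon> k > 0" for k by (simp add: \<epsilon>_def)
  have \<epsilon>0: "\<epsilon> \<longlonglongrightarrow> 0" unfolding \<epsilon>_def by (rule LIMSEQ_inverse_real_of_nat)
  define K where "K t = indicator {0<..} t * t powr (s - 1)" for t :: real
  have [measurable]: "K \<in> borel_measurable borel" unfolding K_def by measurable
  have damped: "(LINT t|lborel. complex_of_real (2 * pi * (exp (- \<epsilon> k * t) * (K t * u (x - t)))))
      = of_real (Gamma s) * (LINT \<omega>|lborel. fourier u \<omega> * (of_real (\<epsilon> k) + \<i> * \<omega>) powr of_real (- s) * iexp (\<omega> * x))" for k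
  proof -
    define F where "F t \<omega> = complex_of_real (K t * exp (- \<epsilon> k * t)) * (fourier u \<omega> * iexp (\<omega> * (x - t)))" for t \<omega>
    have "integrable (lborel \<Otimes>\<^sub>M lborel) (case_prod F)"
    proof (rule integrable_pair_bound)
      show "integrable lborel (\<lambda>t. K t * exp (- \<epsilon> k * t))"
        using Gamma_integral_scaled[OF s(1) \<epsilon>[of k]] unfolding K_def has_bochner_integral_iff
        by (simp add: mult.assoc)
      show "case_prod F \<in> borel_measurable (borel \<Otimes>\<^sub>M borel)" unfolding F_def by measurable
      show "norm (F t \<omega>) \<le> K t * exp (- \<epsilon> k * t) * norm (fourier u \<omega>)" for t \<omega>
      proof -
        have "norm (F t \<omega>) = \<bar>K t * exp (- \<epsilon> k * t)\<bar> * norm (fourier u \<omega>)"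
          unfolding F_def norm_mult[of "complex_of_real (K t * exp (- \<epsilon> k * t))"] norm_of_real
          by (simp add: norm_mult)
        then show ?thesis by (simp add: K_def abs_mult)
      qed
    qed (rule uh0n)
    from lborel_pair.Fubini_integral[OF this]
    have "(LINT \<omega>|lborel. LINT t|lborel. F t \<omega>) = (LINT t|lborel. LINT \<omega>|lborel. F t \<omega>)" .
    moreover have "(LINT \<omega>|lborel. F t \<omega>) = complex_of_real (2 * pi * (exp (- \<epsilon> k * t) * (K t * u (x - t))))" for t
      unfolding F_def integral_mult_right_zero inv by simp
    moreover have "(LINT t|lborel. F t \<omega>)
        = of_real (Gamma s) * (fourier u \<omega> * (of_real (\<epsilon> k) + \<i> * \<omega>) powr of_real (- s) * iexp (\<omega> * x))" for \<omega>
    proof -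
      have "F t \<omega> = fourier u \<omega> * iexp (\<omega> * x) * (of_real (K t) * exp (- (of_real (\<epsilon> k) + \<i> * \<omega>) * of_real t))" for t
      proof -
        have "exp (complex_of_real (- \<epsilon> k * t)) * iexp (\<omega> * (x - t)) = iexp (\<omega> * x) * exp (- (of_real (\<epsilon> k) + \<i> * \<omega>) * of_real t)"
          unfolding exp_add[symmetric] by (simp add: algebra_simps)
        then show ?thesis unfolding F_def by (simp flip: exp_of_real)
      qed
      then have "(LINT t|lborel. F t \<omega>) = fourier u \<omega> * iexp (\<omega> * x) * (LINT t|lborel. of_real (K t) * exp (- (of_real (\<epsilon> k) + \<i> * \<omega>) * of_real t))"
        by (simp only: integral_mult_right_zero)
      also have "(LINT t|lborel. of_real (K t) * exp (- (of_real (\<epsilon> k) + \<i> * \<omega>) * of_real t))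
          = of_real (Gamma s) * (of_real (\<epsilon> k) + \<i> * \<omega>) powr (- of_real s)"
        unfolding K_def by (rule Laplace_transform_powr[OF s(1)]) (use \<epsilon> in simp)
      finally show ?thesis by simp
    qed
    ultimately show ?thesis by (simp only: integral_mult_right_zero)
  qed
  have "(\<lambda>k. LINT t|lborel. complex_of_real (2 * pi * (exp (- \<epsilon> k * t) * (K t * u (x - t)))))
      \<longlonglongrightarrow> (LINT t|lborel. complex_of_real (2 * pi * (1 * (K t * u (x - t)))))"
  proof (rule integral_dominated_convergence)
    have Ku: "integrable lborel (\<lambda>t. K t * u (x - t))"
      using fractional_kernel_integrable[OF u(1) n1 s, of x] by (simp add: K_def mult.assoc)
    then show "integrable lborel (\<lambda>t. 2 * pi * \<bar>K t * u (x - t)\<bar>)" by (intro integrable_mult_right integrable_abs)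
    have "(\<lambda>k. exp (- \<epsilon> k * t)) \<longlonglongrightarrow> exp (- 0 * t)" for t
      by (intro tendsto_intros \<epsilon>0)
    then show "AE t in lborel. (\<lambda>k. complex_of_real (2 * pi * (exp (- \<epsilon> k * t) * (K t * u (x - t))))) \<longlonglongrightarrow> complex_of_real (2 * pi * (1 * (K t * u (x - t))))"
      by (intro AE_I2 tendsto_of_real tendsto_mult tendsto_const) simp
    have "\<bar>exp (- \<epsilon> k * t) * (K t * u (x - t))\<bar> \<le> 1 * \<bar>K t * u (x - t)\<bar>" for k t
    proof (cases "0 < t")
      case True
      then show ?thesis using \<epsilon>[of k] unfolding abs_mult by (intro mult_right_mono) auto
    qed (simp add: K_def)
    then have "norm (complex_of_real (2 * pi * (exp (- \<epsilon> k * t) * (K t * u (x - t))))) \<le> 2 * pi * \<bar>K t * u (x - t)\<bar>" for k t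
      unfolding norm_of_real abs_mult[of "2 * pi"] by simp
    then show "AE t in lborel. norm (complex_of_real (2 * pi * (exp (- \<epsilon> k * t) * (K t * u (x - t))))) \<le> 2 * pi * \<bar>K t * u (x - t)\<bar>" for k
      by (intro AE_I2)
  qed measurable
  moreover have "(\<lambda>k. LINT \<omega>|lborel. fourier u \<omega> * (of_real (\<epsilon> k) + \<i> * \<omega>) powr of_real (- s) * iexp (\<omega> * x))
      \<longlonglongrightarrow> (LINT \<omega>|lborel. fourier u \<omega> * (\<i> * \<omega>) powr of_real (- s) * iexp (\<omega> * x))"
  proof (rule integral_dominated_convergence)
    show "integrable lborel (\<lambda>\<omega>. \<bar>\<omega>\<bar> powr (- s) * norm (fourier u \<omega>))"
      by (rule uh) (use s in auto)
    have "continuous_on UNIV (\<lambda>\<omega>. (of_real (\<epsilon> k) + \<i> * complex_of_real \<omega>) powr complex_of_real (- s))" for k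
      using \<epsilon>[of k] by (intro continuous_intros) (auto simp: complex_nonpos_Reals_iff complex_eq_iff)
    then have [measurable]: "(\<lambda>\<omega>. (of_real (\<epsilon> k) + \<i> * complex_of_real \<omega>) powr complex_of_real (- s)) \<in> borel_measurable borel" for k
      by (rule borel_measurable_continuous_onI)
    show "(\<lambda>\<omega>. fourier u \<omega> * (of_real (\<epsilon> k) + \<i> * \<omega>) powr of_real (- s) * iexp (\<omega> * x)) \<in> borel_measurable lborel" for k
      by measurable
    have "(\<lambda>k. (of_real (\<epsilon> k) + \<i> * \<omega>) powr complex_of_real (- s)) \<longlonglongrightarrow> (of_real 0 + \<i> * \<omega>) powr complex_of_real (- s)"
      if "\<omega> \<noteq> 0" for \<omega> :: real
      by (intro tendsto_intros \<epsilon>0) (use that in \<open>auto simp: complex_nonpos_Reals_iff\<close>)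
    then have "(\<lambda>k. fourier u \<omega> * (of_real (\<epsilon> k) + \<i> * \<omega>) powr of_real (- s) * iexp (\<omega> * x))
        \<longlonglongrightarrow> fourier u \<omega> * (\<i> * \<omega>) powr of_real (- s) * iexp (\<omega> * x)" if "\<omega> \<noteq> 0" for \<omega> :: real
      using that by (intro tendsto_mult tendsto_const) simp
    then show "AE \<omega> in lborel. (\<lambda>k. fourier u \<omega> * (of_real (\<epsilon> k) + \<i> * \<omega>) powr of_real (- s) * iexp (\<omega> * x))
        \<longlonglongrightarrow> fourier u \<omega> * (\<i> * \<omega>) powr of_real (- s) * iexp (\<omega> * x)"
      using AE_lborel_singleton[of "0::real"] by (auto elim!: eventually_mono)
    have "norm (fourier u \<omega> * (of_real (\<epsilon> k) + \<i> * \<omega>) powr of_real (- s) * iexp (\<omega> * x)) \<le> \<bar>\<omega>\<bar> powr (- s) * norm (fourier u \<omega>)"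
      if "\<omega> \<noteq> 0" for \<omega> :: real and k
    proof -
      have "\<bar>\<omega>\<bar> \<le> norm (of_real (\<epsilon> k) + \<i> * complex_of_real \<omega>)"
        using abs_Im_le_cmod[of "of_real (\<epsilon> k) + \<i> * complex_of_real \<omega>"] by simp
      then have "norm (of_real (\<epsilon> k) + \<i> * complex_of_real \<omega>) powr (- s) \<le> \<bar>\<omega>\<bar> powr (- s)"
        using that s by (intro powr_mono2') auto
      then show ?thesis
        unfolding norm_mult norm_iexp_eq_1 by (simp add: norm_powr_real_powr' mult.commute mult_left_mono)
    qed
    then show "AE \<omega> in lborel. norm (fourier u \<omega> * (of_real (\<epsilon> k) + \<i> * \<omega>) powr of_real (- s) * iexp (\<omega> * x)) \<le> \<bar>\<omega>\<bar> powr (- s) * norm (fourier u \<omega>)" for k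
      using AE_lborel_singleton[of "0::real"] by (auto elim!: eventually_mono)
  qed measurable
  then have "(\<lambda>k. of_real (Gamma s) * (LINT \<omega>|lborel. fourier u \<omega> * (of_real (\<epsilon> k) + \<i> * \<omega>) powr of_real (- s) * iexp (\<omega> * x)))
      \<longlonglongrightarrow> of_real (Gamma s) * (LINT \<omega>|lborel. fourier u \<omega> * (\<i> * \<omega>) powr of_real (- s) * iexp (\<omega> * x))"
    by (rule tendsto_mult_left)
  ultimately have "(LINT t|lborel. complex_of_real (2 * pi * (1 * (K t * u (x - t)))))
      = of_real (Gamma s) * (LINT \<omega>|lborel. fourier u \<omega> * (\<i> * \<omega>) powr of_real (- s) * iexp (\<omega> * x))"
    unfolding damped by (rule LIMSEQ_unique)
  moreover have "(LINT t|lborel. complex_of_real (2 * pi * (1 * (K t * u (x - t))))) = complex_of_real (2 * pi * (LINT t|lborel. K t * u (x - t)))"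
    by (simp only: mult_1 integral_complex_of_real integral_mult_right_zero)
  ultimately show ?thesis
    by (simp add: K_def mult.assoc)
qed

text \<open>
  The second moment of \<open>G\<close> controls the remainder, because \<open>\<bar>exp(\<i> a) - 1 - \<i> a\<bar> \<le> a\<^sup>2/2\<close>.
\<close>

lemma fourier_integral_has_vector_derivative:
  fixes G :: "real \<Rightarrow> complex"
  assumes [measurable]: "G \<in> borel_measurable borel"
    and int: "\<And>k. k \<le> 2 \<Longrightarrow> integrable lborel (\<lambda>\<omega>. \<bar>\<omega>\<bar> ^ k * norm (G \<omega>))"
  shows "((\<lambda>x. LINT \<omega>|lborel. G \<omega> * iexp (\<omega> * x)) has_vector_derivative
      (LINT \<omega>|lborel. \<i> * \<omega> * G \<omega> * iexp (\<omega> * x))) (at x)"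
proof -
  let ?C = "LINT \<omega>|lborel. \<bar>\<omega>\<bar> ^ 2 * norm (G \<omega>)"
  have i0: "integrable lborel (\<lambda>\<omega>. G \<omega> * iexp (\<omega> * y))" for y
    by (rule Bochner_Integration.integrable_bound[OF int[of 0]]) (simp_all add: norm_mult)
  have i1: "integrable lborel (\<lambda>\<omega>. \<i> * \<omega> * G \<omega> * iexp (\<omega> * y))" for y
    by (rule Bochner_Integration.integrable_bound[OF int[of 1]]) (simp_all add: norm_mult)
  have main: "norm ((LINT \<omega>|lborel. G \<omega> * iexp (\<omega> * y)) - (LINT \<omega>|lborel. G \<omega> * iexp (\<omega> * x))
      - (y - x) *\<^sub>R (LINT \<omega>|lborel. \<i> * \<omega> * G \<omega> * iexp (\<omega> * x))) \<le> (y - x)\<^sup>2 / 2 * ?C" for y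
  proof -
    \<comment> \<open>The first order remainder of the integrand.\<close>
    define R where "R \<omega> = G \<omega> * iexp (\<omega> * x) * (iexp (\<omega> * (y - x)) - (1 + \<i> * (\<omega> * (y - x))))" for \<omega>
    have R_eq: "R \<omega> = (G \<omega> * iexp (\<omega> * y) - G \<omega> * iexp (\<omega> * x)) - (y - x) *\<^sub>R (\<i> * \<omega> * G \<omega> * iexp (\<omega> * x))" for \<omega>
    proof -
      have "iexp (\<omega> * y) = iexp (\<omega> * x) * iexp (\<omega> * (y - x))"
        unfolding exp_add[symmetric] by (simp add: algebra_simps)
      then show ?thesis
        unfolding R_def by (simp only:) (simp add: scaleR_conv_of_real algebra_simps)
    qed
    have "(LINT \<omega>|lborel. R \<omega>) = (LINT \<omega>|lborel. G \<omega> * iexp (\<omega> * y)) - (LINT \<omega>|lborel. G \<omega> * iexp (\<omega> * x))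
        - (y - x) *\<^sub>R (LINT \<omega>|lborel. \<i> * \<omega> * G \<omega> * iexp (\<omega> * x))"
      unfolding R_eq
      using Bochner_Integration.integral_diff[OF Bochner_Integration.integrable_diff[OF i0[of y] i0[of x]]
          integrable_scaleR_right[OF i1[of x], of "y - x"]]
        Bochner_Integration.integral_diff[OF i0[of y] i0[of x]]
      by (simp only: integral_scaleR_right)
    moreover have "norm (LINT \<omega>|lborel. R \<omega>) \<le> (LINT \<omega>|lborel. (y - x)\<^sup>2 / 2 * (\<bar>\<omega>\<bar> ^ 2 * norm (G \<omega>)))"
    proof (rule Bochner_Integration.integral_norm_bound_integral)
      show "integrable lborel R"
        unfolding R_eq by (intro Bochner_Integration.integrable_diff integrable_scaleR_right i0 i1)
      show "integrable lborel (\<lambda>\<omega>. (y - x)\<^sup>2 / 2 * (\<bar>\<omega>\<bar> ^ 2 * norm (G \<omega>)))"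
        by (intro integrable_mult_right int) simp
      fix \<omega>
      have "norm (iexp (\<omega> * (y - x)) - (1 + \<i> * (\<omega> * (y - x)))) \<le> (\<omega> * (y - x))\<^sup>2 / 2"
        using iexp_approx1[of "\<omega> * (y - x)" 1] by (simp add: numeral_2_eq_2[symmetric])
      then have "norm (G \<omega>) * norm (iexp (\<omega> * (y - x)) - (1 + \<i> * (\<omega> * (y - x)))) \<le> norm (G \<omega>) * ((\<omega> * (y - x))\<^sup>2 / 2)"
        by (rule mult_left_mono) simp
      moreover have "norm (R \<omega>) = norm (G \<omega>) * norm (iexp (\<omega> * (y - x)) - (1 + \<i> * (\<omega> * (y - x))))"
        unfolding R_def norm_mult norm_iexp_eq_1 mult_1_right by (rule refl)
      ultimately have "norm (R \<omega>) \<le> norm (G \<omega>) * ((\<omega> * (y - x))\<^sup>2 / 2)" by (simp only:)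
      then show "norm (R \<omega>) \<le> (y - x)\<^sup>2 / 2 * (\<bar>\<omega>\<bar> ^ 2 * norm (G \<omega>))"
        by (simp add: power_mult_distrib mult_ac)
    qed
    ultimately show ?thesis by simp
  qed
  define F where "F y = (LINT \<omega>|lborel. G \<omega> * iexp (\<omega> * y))" for y
  define D where "D = (LINT \<omega>|lborel. \<i> * \<omega> * G \<omega> * iexp (\<omega> * x))"
  define C where "C = ?C"
  have quad: "norm (F y - F x - (y - x) *\<^sub>R D) \<le> (y - x)\<^sup>2 / 2 * C" for y
    unfolding F_def D_def C_def by (rule main)
  have "(F has_vector_derivative D) (at x)"
    unfolding has_vector_derivative_def
  proof (rule has_derivativeI_sandwich[of 1])
    show "bounded_linear (\<lambda>h. h *\<^sub>R D)"
      by (rule bounded_linear_scaleR_left)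
    show "norm (F y - F x - (y - x) *\<^sub>R D) / norm (y - x) \<le> \<bar>y - x\<bar> / 2 * C" if "y \<noteq> x" for y
    proof -
      have "(y - x)\<^sup>2 = \<bar>y - x\<bar> * \<bar>y - x\<bar>" by (simp add: power2_eq_square)
      with quad[of y] that show ?thesis by (simp add: pos_divide_le_eq mult_ac)
    qed
    have "((\<lambda>y. \<bar>y - x\<bar> / 2 * C) \<longlongrightarrow> \<bar>x - x\<bar> / 2 * C) (at x)"
      by (intro tendsto_intros) simp
    then show "((\<lambda>y. \<bar>y - x\<bar> / 2 * C) \<longlongrightarrow> 0) (at x)" by simp
  qed auto
  then show ?thesis unfolding F_def[abs_def] D_def .
qed

text \<open>
  Transfers differentiability from a complex representation of a real function; the
  derivative of the representation is then real as well.
\<close>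

lemma real_derivative_of_complex:
  assumes eq: "\<And>x. complex_of_real (f x) = F x" and der: "(F has_vector_derivative D) (at x)"
  shows "(f has_real_derivative Re D) (at x)" "complex_of_real (deriv f x) = D"
proof -
  have f: "f = (\<lambda>x. Re (F x))" and im: "(\<lambda>x. Im (F x)) = (\<lambda>x. 0)"
    unfolding eq[symmetric] by simp_all
  have re: "((\<lambda>x. Re (F x)) has_vector_derivative Re D) (at x)"
    using bounded_linear.has_vector_derivative[OF bounded_linear_Re der] .
  then show d: "(f has_real_derivative Re D) (at x)"
    unfolding f has_real_derivative_iff_has_vector_derivative .
  have "((\<lambda>x. Im (F x)) has_vector_derivative Im D) (at x)"
    using bounded_linear.has_vector_derivative[OF bounded_linear_Im der] .
  then have "Im D = 0"
    unfolding im using vector_derivative_unique_at has_vector_derivative_const by blast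
  with DERIV_imp_deriv[OF d] show "complex_of_real (deriv f x) = D"
    by (simp add: complex_eq_iff)
qed

lemma left_liouville_integral_eq:
  "left_liouville_integral \<alpha> u x = (LINT t|lborel. indicator {0<..} t * (t powr (2 - \<alpha> - 1) * u (x - t)))"
  "set_integrable lborel {..<x} (\<lambda>s. u s / (x - s) powr (\<alpha> - 1))
    \<longleftrightarrow> integrable lborel (\<lambda>t. indicator {0<..} t * (t powr (2 - \<alpha> - 1) * u (x - t)))"
proof -
  have eq: "indicator {..<x} (x + (-1) * t) *\<^sub>R (u (x + (-1) * t) / (x - (x + (-1) * t)) powr (\<alpha> - 1))
      = indicator {0<..} t * (t powr (2 - \<alpha> - 1) * u (x - t))" for t
  proof -
    have "t powr (2 - \<alpha> - 1) = 1 / t powr (\<alpha> - 1)"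
      using powr_minus_divide[of t "\<alpha> - 1"] by simp
    then show ?thesis by (auto simp: indicator_def)
  qed
  show "left_liouville_integral \<alpha> u x = (LINT t|lborel. indicator {0<..} t * (t powr (2 - \<alpha> - 1) * u (x - t)))"
    unfolding left_liouville_integral_def set_lebesgue_integral_def
    by (subst lborel_integral_real_affine[of "-1" _ x], simp) (simp only: eq, simp)
  show "set_integrable lborel {..<x} (\<lambda>s. u s / (x - s) powr (\<alpha> - 1))
    \<longleftrightarrow> integrable lborel (\<lambda>t. indicator {0<..} t * (t powr (2 - \<alpha> - 1) * u (x - t)))"
    unfolding set_integrable_def
    by (subst lborel_integrable_real_affine_iff[of "-1" _ x, symmetric], simp) (simp only: eq)
qed

text \<open>
  The fractional integral has the symbol \<open>(\<i> \<omega>) powr (\<alpha> - 2)\<close>, and each of the two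
  differentiations contributes a factor \<open>\<i> \<omega>\<close>. The differentiation of the integral costs two further
  powers of \<open>\<omega>\<close>, which is why four derivatives of \<open>u\<close> are used.
\<close>

lemma left_liouville_fourier:
  assumes \<alpha>: "1 < \<alpha>" "\<alpha> < 2" and u: "integrable_derivs n u" "4 \<le> n"
  shows "left_liouville_exists \<alpha> u"
    and "2 * pi * complex_of_real (left_liouville \<alpha> u x)
      = (LINT \<omega>|lborel. fourier u \<omega> * (\<i> * \<omega>) powr of_real \<alpha> * iexp (\<omega> * x))"
proof -
  define s where "s = 2 - \<alpha>"
  have s: "0 < s" "s < 1" using \<alpha> by (auto simp: s_def)
  have n: "1 \<le> n" "2 \<le> n" using u by auto
  have [measurable]: "u \<in> borel_measurable borel"
    using integrable_derivs_DERIV(2)[OF u(1) n(1)] by (auto dest: borel_measurable_integrable)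
  \<comment> \<open>\<open>G j\<close> is the symbol of the \<open>j\<close>-th derivative of the fractional integral, applied to \<open>u\<close>, up to the factor
    \<open>Gamma s\<close>.\<close>
  define G where "G j \<omega> = (\<i> * complex_of_real \<omega>) ^ j * (fourier u \<omega> * (\<i> * \<omega>) powr of_real (- s))" for j \<omega>
  have [measurable]: "G j \<in> borel_measurable borel" for j
    unfolding G_def by measurable
  have G_norm: "\<bar>\<omega>\<bar> ^ k * norm (G j \<omega>) = \<bar>\<omega>\<bar> powr (real (k + j) - s) * norm (fourier u \<omega>)" for k j \<omega>
  proof (cases "\<omega> = 0")
    case False
    then have "\<bar>\<omega>\<bar> powr (real (k + j) - s) = \<bar>\<omega>\<bar> ^ (k + j) * \<bar>\<omega>\<bar> powr (- s)"
      using powr_add[of "\<bar>\<omega>\<bar>" "real (k + j)" "- s"] by (simp add: powr_realpow del: of_nat_add)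
    then show ?thesis
      by (simp add: G_def norm_mult norm_power norm_imaginary_powr power_add del: of_real_minus)
  qed (simp add: G_def)
  have G_int: "integrable lborel (\<lambda>\<omega>. \<bar>\<omega>\<bar> ^ k * norm (G j \<omega>))" if "k + j \<le> 3" for k j
    unfolding G_norm using that s u(2) by (intro integrable_powr_fourier[OF u(1)]) auto
  define c where "c = complex_of_real (Gamma s / (2 * pi))"
  define \<Phi> where "\<Phi> j x = c * (LINT \<omega>|lborel. G j \<omega> * iexp (\<omega> * x))" for j x
  have der: "(\<Phi> j has_vector_derivative \<Phi> (Suc j) x) (at x)" if "j \<le> 1" for j x
  proof -
    have "((\<lambda>x. LINT \<omega>|lborel. G j \<omega> * iexp (\<omega> * x)) has_vector_derivative
      (LINT \<omega>|lborel. \<i> * \<omega> * G j \<omega> * iexp (\<omega> * x))) (at x)"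
      by (rule fourier_integral_has_vector_derivative) (use that G_int in auto)
    moreover have "\<i> * \<omega> * G j \<omega> = G (Suc j) \<omega>" for \<omega> by (simp add: G_def)
    ultimately show ?thesis
      unfolding \<Phi>_def by (intro has_vector_derivative_mult_right) simp
  qed
  have I0: "complex_of_real (left_liouville_integral \<alpha> u x) = \<Phi> 0 x" for x
    using fractional_integral_fourier[OF u(1) n(2) s, of x]
    unfolding left_liouville_integral_eq \<Phi>_def c_def G_def s_def by (simp add: field_simps)
  have I1: "complex_of_real (deriv (left_liouville_integral \<alpha> u) x) = \<Phi> 1 x" for x
    using real_derivative_of_complex(2)[OF I0 der] by simp
  have I2: "complex_of_real (deriv (deriv (left_liouville_integral \<alpha> u)) x) = \<Phi> 2 x" for x
    using real_derivative_of_complex(2)[OF I1 der] by (simp add: numeral_2_eq_2)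
  have "derivs_exist 2 (left_liouville_integral \<alpha> u)"
    unfolding derivs_exist_def
  proof (intro allI impI)
    fix k :: nat and x :: real
    assume "k < 2"
    then consider "k = 0" | "k = 1" by linarith
    then show "(deriv ^^ k) (left_liouville_integral \<alpha> u) differentiable at x"
      using real_derivative_of_complex(1)[OF I0 der] real_derivative_of_complex(1)[OF I1 der]
      by cases (auto simp: real_differentiable_def)
  qed
  then show "left_liouville_exists \<alpha> u"
    using fractional_kernel_integrable[OF u(1) n(1) s]
    unfolding left_liouville_exists_def left_liouville_integral_eq(2) s_def by blast
  have "Gamma s \<noteq> 0" using Gamma_real_pos[OF s(1)] by simp
  then have "2 * pi * complex_of_real (left_liouville \<alpha> u x) = (LINT \<omega>|lborel. G 2 \<omega> * iexp (\<omega> * x))"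
    using I2[of x] unfolding left_liouville_def \<Phi>_def c_def s_def[symmetric]
    by (simp add: numeral_2_eq_2 field_simps)
  moreover have "G 2 \<omega> = fourier u \<omega> * (\<i> * \<omega>) powr of_real \<alpha>" for \<omega>
  proof (cases "\<omega> = 0")
    case False
    have "(\<i> * complex_of_real \<omega>) powr of_real \<alpha> = (\<i> * complex_of_real \<omega>) powr (of_nat 2 + of_real (- s))"
      by (simp add: s_def)
    also have "\<dots> = (\<i> * complex_of_real \<omega>) ^ 2 * (\<i> * \<omega>) powr of_real (- s)"
      using False unfolding powr_add by (subst powr_complexpow) auto
    finally show ?thesis by (simp add: G_def)
  qed (simp add: G_def)
  ultimately show "2 * pi * complex_of_real (left_liouville \<alpha> u x)
      = (LINT \<omega>|lborel. fourier u \<omega> * (\<i> * \<omega>) powr of_real \<alpha> * iexp (\<omega> * x))"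
    by simp
qed

section \<open>Taylor coefficients of the generating polynomial\<close>

text \<open>
  Every derivative of \<open>-ln(1 - y) (1 - y) powr \<beta>\<close> is \<open>(1 - y) powr (\<beta> - n)\<close> times \<open>a + b ln(1 - y)\<close>; this is the
  recursion for the pairs \<open>(a, b)\<close>.
\<close>

primrec ln_powr_coeffs :: "real \<Rightarrow> nat \<Rightarrow> real \<times> real" where
  "ln_powr_coeffs \<beta> 0 = (0, - 1)"
| "ln_powr_coeffs \<beta> (Suc n) = (case ln_powr_coeffs \<beta> n of (a, b) \<Rightarrow> ((real n - \<beta>) * a - b, (real n - \<beta>) * b))"

definition ln_powr_deriv :: "real \<Rightarrow> nat \<Rightarrow> real \<Rightarrow> real" where
  "ln_powr_deriv \<beta> n y = (1 - y) powr (\<beta> - real n) * (fst (ln_powr_coeffs \<beta> n) + snd (ln_powr_coeffs \<beta> n) * ln (1 - y))"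

lemma DERIV_ln_powr_deriv:
  assumes "y < 1"
  shows "(ln_powr_deriv \<beta> n has_real_derivative ln_powr_deriv \<beta> (Suc n) y) (at y)"
proof -
  obtain a b where ab: "ln_powr_coeffs \<beta> n = (a, b)" by fastforce
  define c where "c = \<beta> - real n"
  have "((\<lambda>y. (1 - y) powr c) has_real_derivative c * (1 - y) powr (c - 1) * (- 1)) (at y)"
    by (rule DERIV_chain2[OF has_real_derivative_powr]) (use assms in \<open>auto intro!: derivative_eq_intros\<close>)
  moreover have "((\<lambda>y. a + b * ln (1 - y)) has_real_derivative - b / (1 - y)) (at y)"
    using assms by (auto intro!: derivative_eq_intros)
  ultimately have "((\<lambda>y. (1 - y) powr c * (a + b * ln (1 - y))) has_real_derivative
      c * (1 - y) powr (c - 1) * (- 1) * (a + b * ln (1 - y)) + - b / (1 - y) * (1 - y) powr c) (at y)"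
    by (rule DERIV_mult)
  also have "c * (1 - y) powr (c - 1) * (- 1) * (a + b * ln (1 - y)) + - b / (1 - y) * (1 - y) powr c
      = (1 - y) powr (c - 1) * (- c * (a + b * ln (1 - y)) - b)"
  proof -
    have "(1 - y) powr c = (1 - y) powr (c - 1) * (1 - y)" using assms by (simp add: powr_diff)
    then have "- b / (1 - y) * (1 - y) powr c = - b * (1 - y) powr (c - 1)" using assms by simp
    then show ?thesis by (simp only:) (simp add: algebra_simps)
  qed
  also have "\<dots> = ln_powr_deriv \<beta> (Suc n) y"
    by (simp add: ln_powr_deriv_def ab c_def algebra_simps)
  finally show ?thesis unfolding ln_powr_deriv_def[of \<beta> n, abs_def] ab c_def by simp
qed

text \<open>
  The first pairs are \<open>(0, -1)\<close>, \<open>(1, \<beta>)\<close> and \<open>(1 - 2\<beta>, (1 - \<beta>)\<beta>)\<close>. From the second derivative on the factor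
  \<open>n - \<beta>\<close> is positive, and the recursion preserves the signs.
\<close>

lemma ln_powr_coeffs_sign:
  assumes "1 / 2 < \<beta>" "\<beta> < 1" "2 \<le> n"
  shows "fst (ln_powr_coeffs \<beta> n) < 0 \<and> 0 < snd (ln_powr_coeffs \<beta> n)"
  using assms(3)
proof (induction n rule: dec_induct)
  case base
  show ?case using assms by (simp add: numeral_2_eq_2)
next
  case (step n)
  obtain a b where ab: "ln_powr_coeffs \<beta> n = (a, b)" by fastforce
  have "0 < real n - \<beta>" using step assms by simp
  then have "(real n - \<beta>) * a < 0" "0 < (real n - \<beta>) * b"
    using step ab by (simp_all add: mult_pos_neg)
  then show ?case using step ab by simp
qed

definition ln_powr_taylor :: "real \<Rightarrow> nat \<Rightarrow> real" where
  "ln_powr_taylor \<beta> m = fst (ln_powr_coeffs \<beta> m) / fact m"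

lemma ln_powr_taylor_expansion:
  assumes \<beta>: "1 / 2 < \<beta>" "\<beta> < 1" and p: "1 \<le> p" and y: "0 < y" "y < 1"
  shows "\<exists>t. 0 < t \<and> t < y \<and> - ln (1 - y) * (1 - y) powr \<beta>
    = (\<Sum>m\<le>p. ln_powr_taylor \<beta> m * y ^ m) + ln_powr_deriv \<beta> (Suc p) t / fact (Suc p) * y ^ Suc p"
proof -
  have "\<exists>t. 0 < t \<and> t < y \<and> ln_powr_deriv \<beta> 0 y
    = (\<Sum>m<Suc p. ln_powr_deriv \<beta> m 0 / fact m * y ^ m) + ln_powr_deriv \<beta> (Suc p) t / fact (Suc p) * y ^ Suc p"
    by (rule Maclaurin) (use y DERIV_ln_powr_deriv in auto)
  then show ?thesis
    by (simp add: ln_powr_deriv_def ln_powr_taylor_def lessThan_Suc_atMost mult.commute)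
qed

lemma ln_powr_deriv_neg:
  assumes \<beta>: "1 / 2 < \<beta>" "\<beta> < 1" and n: "2 \<le> n" and t: "0 < t" "t < 1"
  shows "ln_powr_deriv \<beta> n t < 0"
proof -
  have "fst (ln_powr_coeffs \<beta> n) < 0" "snd (ln_powr_coeffs \<beta> n) * ln (1 - t) \<le> 0"
    using ln_powr_coeffs_sign[OF \<beta> n] t by (auto intro!: mult_nonneg_nonpos)
  then show ?thesis
    unfolding ln_powr_deriv_def using t by (intro mult_pos_neg) auto
qed

text \<open>
  The Lagrange remainder is negative, so the Taylor polynomial exceeds the function, which is positive on
  \<open>(0, 1)\<close>.
\<close>

lemma ln_powr_taylor_pos:
  assumes \<beta>: "1 / 2 < \<beta>" "\<beta> < 1" and p: "1 \<le> p" and y: "0 < y" "y < 1"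
  shows "0 < (\<Sum>m\<le>p. ln_powr_taylor \<beta> m * y ^ m)"
proof -
  obtain t where t: "0 < t" "t < y" and eq: "- ln (1 - y) * (1 - y) powr \<beta>
    = (\<Sum>m\<le>p. ln_powr_taylor \<beta> m * y ^ m) + ln_powr_deriv \<beta> (Suc p) t / fact (Suc p) * y ^ Suc p"
    using ln_powr_taylor_expansion[OF assms] by blast
  have "ln_powr_deriv \<beta> (Suc p) t / fact (Suc p) * y ^ Suc p < 0"
    using ln_powr_deriv_neg[OF \<beta>, of "Suc p" t] t y p
    by (intro mult_neg_pos divide_neg_pos zero_less_power) auto
  moreover have "0 < - ln (1 - y) * (1 - y) powr \<beta>"
    using y by (intro mult_pos_pos) auto
  ultimately show ?thesis using eq by linarith
qed

lemma ln_powr_taylor_error: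
  assumes \<beta>: "1 / 2 < \<beta>" "\<beta> < 1" and p: "1 \<le> p"
  obtains K where "\<And>y. 0 < y \<Longrightarrow> y \<le> 1 / 2 \<Longrightarrow>
    \<bar>- ln (1 - y) * (1 - y) powr \<beta> - (\<Sum>m\<le>p. ln_powr_taylor \<beta> m * y ^ m)\<bar> \<le> K * y ^ Suc p"
proof -
  have "continuous_on {0..1/2} (ln_powr_deriv \<beta> (Suc p))"
    by (rule DERIV_continuous_on, rule has_field_derivative_at_within, rule DERIV_ln_powr_deriv) auto
  then have "bounded (ln_powr_deriv \<beta> (Suc p) ` {0..1/2})"
    by (intro compact_imp_bounded compact_continuous_image) auto
  then obtain K where "\<forall>v\<in>ln_powr_deriv \<beta> (Suc p) ` {0..1/2}. norm v \<le> K"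
    unfolding bounded_iff by blast
  then have K: "\<And>t. t \<in> {0..1/2} \<Longrightarrow> \<bar>ln_powr_deriv \<beta> (Suc p) t\<bar> \<le> K" by simp
  show ?thesis
  proof (rule that[of "K / fact (Suc p)"])
    fix y :: real assume y: "0 < y" "y \<le> 1 / 2"
    obtain t where t: "0 < t" "t < y" and eq: "- ln (1 - y) * (1 - y) powr \<beta>
      = (\<Sum>m\<le>p. ln_powr_taylor \<beta> m * y ^ m) + ln_powr_deriv \<beta> (Suc p) t / fact (Suc p) * y ^ Suc p"
      using ln_powr_taylor_expansion[OF \<beta> p, of y] y by auto
    have "\<bar>ln_powr_deriv \<beta> (Suc p) t / fact (Suc p) * y ^ Suc p\<bar> \<le> K / fact (Suc p) * y ^ Suc p"
    proof -
      have "\<bar>ln_powr_deriv \<beta> (Suc p) t\<bar> / fact (Suc p) * y ^ Suc p \<le> K / fact (Suc p) * y ^ Suc p"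
        by (rule mult_right_mono[OF divide_right_mono]) (use K[of t] t y in \<open>auto simp del: fact_Suc\<close>)
      then show ?thesis using y by (simp add: abs_mult del: fact_Suc)
    qed
    then show "\<bar>- ln (1 - y) * (1 - y) powr \<beta> - (\<Sum>m\<le>p. ln_powr_taylor \<beta> m * y ^ m)\<bar> \<le> K / fact (Suc p) * y ^ Suc p"
      using eq by simp
  qed
qed

lemma polynomial_vanishing_order:
  fixes d :: "nat \<Rightarrow> real"
  assumes "0 < \<delta>" and "\<And>y. 0 < y \<Longrightarrow> y < \<delta> \<Longrightarrow> \<bar>\<Sum>j\<le>p. d j * y ^ j\<bar> \<le> K * y ^ Suc p"
  shows "\<forall>j\<le>p. d j = 0"
  using assms(2)
proof (induction p arbitrary: d)
  case (0 d)
  have "((\<lambda>y. \<bar>d 0\<bar>) \<longlongrightarrow> \<bar>d 0\<bar>) (at_right 0)" by simp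
  moreover have "((\<lambda>y. K * y) \<longlongrightarrow> K * 0) (at_right (0::real))" by (intro tendsto_intros)
  moreover have "eventually (\<lambda>y. \<bar>d 0\<bar> \<le> K * y) (at_right 0)"
    unfolding eventually_at_right_field using 0 assms(1) by auto
  ultimately have "\<bar>d 0\<bar> \<le> K * 0" by (intro tendsto_le[OF trivial_limit_at_right_real])
  then show ?case by simp
next
  case (Suc p d)
  have split: "(\<Sum>j\<le>Suc p. d j * y ^ j) = d 0 + y * (\<Sum>j\<le>p. d (Suc j) * y ^ j)" for y
    by (subst sum.atMost_Suc_shift) (simp add: sum_distrib_left mult_ac)
  have "((\<lambda>y. \<bar>\<Sum>j\<le>Suc p. d j * y ^ j\<bar>) \<longlongrightarrow> \<bar>d 0 + 0 * (\<Sum>j\<le>p. d (Suc j) * 0 ^ j)\<bar>) (at_right 0)"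
    unfolding split by (intro tendsto_intros)
  moreover have "((\<lambda>y. K * y ^ Suc (Suc p)) \<longlongrightarrow> K * 0 ^ Suc (Suc p)) (at_right (0::real))" by (intro tendsto_intros)
  moreover have "eventually (\<lambda>y. \<bar>\<Sum>j\<le>Suc p. d j * y ^ j\<bar> \<le> K * y ^ Suc (Suc p)) (at_right 0)"
    unfolding eventually_at_right_field using Suc.prems assms(1) by auto
  ultimately have "\<bar>d 0 + 0 * (\<Sum>j\<le>p. d (Suc j) * 0 ^ j)\<bar> \<le> K * 0 ^ Suc (Suc p)"
    by (intro tendsto_le[OF trivial_limit_at_right_real])
  then have d0: "d 0 = 0" by simp
  have "\<forall>j\<le>p. d (Suc j) = 0"
  proof (rule Suc.IH)
    fix y :: real assume y: "0 < y" "y < \<delta>"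
    have "y * \<bar>\<Sum>j\<le>p. d (Suc j) * y ^ j\<bar> \<le> y * (K * y ^ Suc p)"
      using Suc.prems[OF y] y unfolding split d0 by (simp add: abs_mult mult_ac)
    then show "\<bar>\<Sum>j\<le>p. d (Suc j) * y ^ j\<bar> \<le> K * y ^ Suc p" using y by simp
  qed
  then show ?case using d0 unfolding atMost_iff[symmetric] atMost_Suc_eq_insert_0 by auto
qed

text \<open>
  The coefficients of the generating polynomial with respect to powers of \<open>1 - z\<close>, without the
  restriction to the degree \<open>p\<close>.
\<close>

definition step_coeff :: "real \<Rightarrow> (nat \<Rightarrow> nat \<Rightarrow> real) \<Rightarrow> nat \<Rightarrow> real" where
  "step_coeff \<alpha> lam j = (if j = 0 then 0 else if j = 1 then 1 else if j = 2 then (\<alpha> - 2) / (2 * \<alpha>)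
     else lam (j - 1) (j - 1) / \<alpha>)"

lemma gen_poly_eq_sum:
  assumes "2 \<le> p"
  shows "gen_poly \<alpha> lam p z = (\<Sum>j\<le>p. of_real (step_coeff \<alpha> lam j) * (1 - z) ^ j)"
proof -
  have "{..p} = {0, 1, 2} \<union> {3..p}" using assms by auto
  then have "(\<Sum>j\<le>p. of_real (step_coeff \<alpha> lam j) * (1 - z) ^ j)
      = (\<Sum>j\<in>{0, 1, 2}. of_real (step_coeff \<alpha> lam j) * (1 - z) ^ j)
      + (\<Sum>j=3..p. of_real (step_coeff \<alpha> lam j) * (1 - z) ^ j)"
    by (simp add: sum.union_disjoint)
  also have "(\<Sum>j=3..p. of_real (step_coeff \<alpha> lam j) * (1 - z) ^ j) = (\<Sum>j=3..p. of_real (lam (j - 1) (j - 1) / \<alpha>) * (1 - z) ^ j)"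
    by (intro sum.cong) (auto simp: step_coeff_def)
  finally show ?thesis
    by (simp add: gen_poly_def step_coeff_def)
qed

lemma gen_poly_of_real:
  assumes "2 \<le> p"
  shows "gen_poly \<alpha> lam p (of_real x) = of_real (\<Sum>j\<le>p. step_coeff \<alpha> lam j * (1 - x) ^ j)"
  unfolding gen_poly_eq_sum[OF assms] by simp

lemma gen_poly_holomorphic: "gen_poly \<alpha> lam p holomorphic_on S"
  unfolding gen_poly_def[abs_def] by (intro holomorphic_intros)

text \<open>
  The generating polynomial is \<open>1 - z\<close> times a polynomial with the value \<open>1\<close> at \<open>z = 1\<close>.
\<close>

lemma gen_poly_exp_quotient:
  assumes p: "2 \<le> p"
  shows "((\<lambda>z. gen_poly \<alpha> lam p (exp (- z)) / z) \<longlongrightarrow> 1) (at 0)"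
proof -
  obtain m where m: "p = Suc m" using p by (cases p) auto
  have "((\<lambda>z::complex. 1 - exp (- z)) has_field_derivative 1) (at 0)"
    by (auto intro!: derivative_eq_intros)
  then have "((\<lambda>z::complex. (1 - exp (- z)) / z) \<longlongrightarrow> 1) (at 0)"
    by (simp add: has_field_derivative_iff)
  moreover have "((\<lambda>z::complex. \<Sum>j\<le>m. complex_of_real (step_coeff \<alpha> lam (Suc j)) * (1 - exp (- z)) ^ j) \<longlongrightarrow> 1) (at 0)"
  proof -
    have "complex_of_real (step_coeff \<alpha> lam (Suc j)) * (1 - exp (- 0)) ^ j = (if j = 0 then 1 else 0)" for j
      by (cases j) (simp_all add: step_coeff_def)
    then have "(\<Sum>j\<le>m. complex_of_real (step_coeff \<alpha> lam (Suc j)) * (1 - exp (- 0)) ^ j) = 1"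
      by (simp only:) simp
    moreover have "((\<lambda>z::complex. \<Sum>j\<le>m. complex_of_real (step_coeff \<alpha> lam (Suc j)) * (1 - exp (- z)) ^ j) \<longlongrightarrow>
        (\<Sum>j\<le>m. complex_of_real (step_coeff \<alpha> lam (Suc j)) * (1 - exp (- 0)) ^ j)) (at 0)"
      by (intro tendsto_intros)
    ultimately show ?thesis by (simp only:)
  qed
  ultimately have "((\<lambda>z::complex. (1 - exp (- z)) / z * (\<Sum>j\<le>m. complex_of_real (step_coeff \<alpha> lam (Suc j)) * (1 - exp (- z)) ^ j)) \<longlongrightarrow> 1 * 1) (at 0)"
    by (rule tendsto_mult)
  moreover have "gen_poly \<alpha> lam p (exp (- z)) / z = (1 - exp (- z)) / z * (\<Sum>j\<le>m. complex_of_real (step_coeff \<alpha> lam (Suc j)) * (1 - exp (- z)) ^ j)" for z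
    unfolding gen_poly_eq_sum[OF p, unfolded m] m
  proof (subst sum.atMost_Suc_shift)
    have "step_coeff \<alpha> lam 0 = 0" by (simp add: step_coeff_def)
    then show "((complex_of_real (step_coeff \<alpha> lam 0) * (1 - exp (- z)) ^ 0) + (\<Sum>j\<le>m. complex_of_real (step_coeff \<alpha> lam (Suc j)) * (1 - exp (- z)) ^ Suc j)) / z
        = (1 - exp (- z)) / z * (\<Sum>j\<le>m. complex_of_real (step_coeff \<alpha> lam (Suc j)) * (1 - exp (- z)) ^ j)"
      by (simp add: sum_distrib_left sum_divide_distrib mult_ac)
  qed
  ultimately show ?thesis by (simp only: mult_1_right)
qed

text \<open>
  The tail series starts with the power \<open>z^p\<close>, and the series divided by \<open>z^p\<close> converges absolutely in a
  smaller disc.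
\<close>

lemma gen_parameters_bound:
  assumes par: "gen_parameters \<alpha> lam" and p: "2 \<le> p"
  obtains \<delta> C where "0 < \<delta>" "0 \<le> C" "\<And>z. z \<noteq> 0 \<Longrightarrow> norm z < \<delta> \<Longrightarrow>
      norm (exp z * (gen_poly \<alpha> lam p (exp (- z)) / z) powr of_real \<alpha> - 1) \<le> C * norm z ^ p"
proof -
  let ?b = "\<lambda>l. complex_of_real (lam p (p + l))"
  have "eventually (\<lambda>z::complex. summable (\<lambda>l. ?b l * z ^ (p + l)) \<and>
        exp z * (gen_poly \<alpha> lam p (exp (- z)) / z) powr of_real \<alpha> = 1 - (\<Sum>l. ?b l * z ^ (p + l))) (at 0)"
    using par p unfolding gen_parameters_def by blast
  then obtain d where d: "d > 0" and D: "\<And>z. z \<noteq> 0 \<Longrightarrow> norm z < d \<Longrightarrow> summable (\<lambda>l. ?b l * z ^ (p + l)) \<and>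
        exp z * (gen_poly \<alpha> lam p (exp (- z)) / z) powr of_real \<alpha> = 1 - (\<Sum>l. ?b l * z ^ (p + l))"
    unfolding eventually_at by (auto simp: dist_norm)
  \<comment> \<open>A point of convergence other than \<open>0\<close>; the bound is proved in the disc of half the radius.\<close>
  define r where "r = d / 2"
  have r: "0 < r" "r < d" using d by (auto simp: r_def)
  have "summable (\<lambda>l. ?b l * of_real r ^ (p + l))" using D[of "of_real r"] r by simp
  then have "summable (\<lambda>l. ?b l * of_real r ^ (p + l) * inverse (of_real r ^ p))" by (rule summable_mult2)
  then have "summable (\<lambda>l. ?b l * of_real r ^ l)" using r by (simp add: power_add field_simps)
  from powser_insidea[OF this, of "of_real (r / 2)"]
  have S: "summable (\<lambda>l. norm (?b l) * (r / 2) ^ l)" using r by (simp add: norm_mult norm_power)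
  show ?thesis
  proof (rule that[of "r / 2" "\<Sum>l. norm (?b l) * (r / 2) ^ l"])
    show "0 \<le> (\<Sum>l. norm (?b l) * (r / 2) ^ l)" using S r by (intro suminf_nonneg) auto
    fix z :: complex assume z: "z \<noteq> 0" "norm z < r / 2"
    have "norm (\<Sum>l. ?b l * z ^ (p + l)) \<le> (\<Sum>l. norm (?b l) * (r / 2) ^ l * norm z ^ p)"
    proof (rule norm_suminf_le)
      show "summable (\<lambda>l. norm (?b l) * (r / 2) ^ l * norm z ^ p)" using S by (rule summable_mult2)
      fix l
      have "norm (?b l * z ^ (p + l)) = norm (?b l) * norm z ^ l * norm z ^ p"
        by (simp add: norm_mult norm_power power_add mult_ac)
      also have "\<dots> \<le> norm (?b l) * (r / 2) ^ l * norm z ^ p"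
        using z by (intro mult_right_mono mult_left_mono power_mono) auto
      finally show "norm (?b l * z ^ (p + l)) \<le> norm (?b l) * (r / 2) ^ l * norm z ^ p" .
    qed
    also have "\<dots> = (\<Sum>l. norm (?b l) * (r / 2) ^ l) * norm z ^ p"
      using S by (rule suminf_mult2[symmetric])
    finally have le: "norm (\<Sum>l. ?b l * z ^ (p + l)) \<le> (\<Sum>l. norm (?b l) * (r / 2) ^ l) * norm z ^ p" .
    have "exp z * (gen_poly \<alpha> lam p (exp (- z)) / z) powr of_real \<alpha> - 1 = - (\<Sum>l. ?b l * z ^ (p + l))"
      using D[of z] z r by simp
    with le show "norm (exp z * (gen_poly \<alpha> lam p (exp (- z)) / z) powr of_real \<alpha> - 1) \<le> (\<Sum>l. norm (?b l) * (r / 2) ^ l) * norm z ^ p"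
      by simp
  qed (use r in auto)
qed

text \<open>
  Used to take the \<open>\<alpha>\<close>-th root of an approximate identity without loss in the order.
\<close>

lemma powr_contraction_at_1:
  fixes v b :: real
  assumes "0 < v" "0 < b" "b \<le> 1"
  shows "\<bar>v powr b - 1\<bar> \<le> \<bar>v - 1\<bar>"
proof (cases "1 \<le> v")
  case True
  then have "v powr b \<le> v powr 1" "1 powr b \<le> v powr b" using assms by (intro powr_mono powr_mono2; simp)+
  then show ?thesis using True by simp
next
  case False
  then have "v powr 1 \<le> v powr b" "v powr b \<le> 1" using powr_mono'[of b 1 v] powr_le1[of b v] assms by simp_all
  then show ?thesis using False assms by simp
qed

text \<open>
  The parameters make \<open>exp(x) (P(exp(-x))/x) powr \<alpha>\<close> equal to \<open>1\<close> up to order \<open>p\<close>. Taking the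
  \<open>\<alpha>\<close>-th root and solving for \<open>P\<close> gives \<open>P(exp(-x)) = x exp(-x/\<alpha>)\<close> up to order \<open>p + 1\<close>. In the variable
  \<open>y = 1 - exp(-x)\<close> the right-hand side is \<open>-ln(1 - y) (1 - y) powr (1/\<alpha>)\<close>, so the polynomial
  \<open>P(1 - y)\<close> of degree at most \<open>p\<close> must be its Taylor polynomial.
\<close>

lemma step_coeff_eq_taylor:
  assumes \<alpha>: "1 < \<alpha>" "\<alpha> < 2" and p: "2 \<le> p" and par: "gen_parameters \<alpha> lam" and j: "j \<le> p"
  shows "step_coeff \<alpha> lam j = ln_powr_taylor (1 / \<alpha>) j"
proof -
  define \<beta> where "\<beta> = 1 / \<alpha>"
  have \<beta>: "1 / 2 < \<beta>" "\<beta> < 1" using \<alpha> by (auto simp: \<beta>_def field_simps)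
  define S where "S y = (\<Sum>j\<le>p. step_coeff \<alpha> lam j * y ^ j)" for y
  obtain \<delta> C where \<delta>: "0 < \<delta>" "0 \<le> C" and bound: "\<And>z. z \<noteq> 0 \<Longrightarrow> norm z < \<delta> \<Longrightarrow>
      norm (exp z * (gen_poly \<alpha> lam p (exp (- z)) / z) powr of_real \<alpha> - 1) \<le> C * norm z ^ p"
    using gen_parameters_bound[OF par p] by metis
  have "eventually (\<lambda>z. dist (gen_poly \<alpha> lam p (exp (- z)) / z) 1 < 1) (at 0)"
    using gen_poly_exp_quotient[OF p] by (rule tendstoD) simp
  then obtain \<eta> where \<eta>: "0 < \<eta>" and near: "\<And>z. z \<noteq> 0 \<Longrightarrow> norm z < \<eta> \<Longrightarrow> norm (gen_poly \<alpha> lam p (exp (- z)) / z - 1) < 1"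
    unfolding eventually_at by (auto simp: dist_norm)
  obtain K where K: "\<And>y. 0 < y \<Longrightarrow> y \<le> 1 / 2 \<Longrightarrow>
    \<bar>- ln (1 - y) * (1 - y) powr \<beta> - (\<Sum>m\<le>p. ln_powr_taylor \<beta> m * y ^ m)\<bar> \<le> K * y ^ Suc p"
    using ln_powr_taylor_error[OF \<beta>, of p] p by auto
  have small: "\<bar>\<Sum>j\<le>p. (step_coeff \<alpha> lam j - ln_powr_taylor \<beta> j) * y ^ j\<bar> \<le> (C * 2 ^ Suc p + K) * y ^ Suc p"
    if y: "0 < y" "y < min (1 / 2) (min \<delta> \<eta> / 2)" for y
  proof -
    define x where "x = - ln (1 - y)"
    have "ln (1 / (1 - y)) \<le> 1 / (1 - y) - 1" using y by (intro ln_le_minus_one) auto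
    also have "1 / (1 - y) - 1 \<le> 2 * y"
    proof -
      have "1 / (1 - y) - 1 = y / (1 - y)" using y by (simp add: field_simps)
      also have "\<dots> \<le> y / (1 / 2)" using y by (intro divide_left_mono) auto
      finally show ?thesis by simp
    qed
    finally have x: "0 < x" "x \<le> 2 * y" using y by (auto simp: x_def ln_div)
    have xs: "x < \<delta>" "x < \<eta>" using x y by auto
    have ex: "exp (- x) = 1 - y" using y by (simp add: x_def)
    define r where "r = S y / x"
    have P: "gen_poly \<alpha> lam p (exp (- of_real x)) / of_real x = of_real r"
    proof -
      have "exp (- complex_of_real x) = of_real (1 - y)"
        unfolding ex[symmetric] by (simp flip: exp_of_real)
      then have "gen_poly \<alpha> lam p (exp (- of_real x)) = of_real (S y)"
        unfolding S_def using gen_poly_of_real[OF p, of \<alpha> lam "1 - y"] by simp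
      then show ?thesis by (simp add: r_def)
    qed
    have "norm (complex_of_real (r - 1)) < 1"
      using near[of "of_real x"] x xs unfolding P by simp
    then have r: "0 < r" unfolding norm_of_real by simp
    define v where "v = exp x * r powr \<alpha>"
    have "norm (complex_of_real (v - 1)) \<le> C * x ^ p"
      using bound[of "of_real x"] x xs r unfolding P v_def by (simp add: powr_of_real exp_of_real)
    then have v1: "\<bar>v - 1\<bar> \<le> C * x ^ p" unfolding norm_of_real .
    have "v powr \<beta> = exp (x / \<alpha>) * r"
    proof -
      have "v powr \<beta> = exp x powr \<beta> * (r powr \<alpha>) powr \<beta>" unfolding v_def by (simp add: powr_mult)
      also have "(r powr \<alpha>) powr \<beta> = r" using r \<alpha> by (simp add: powr_powr \<beta>_def)
      also have "exp x powr \<beta> = exp (x / \<alpha>)" by (simp add: powr_def \<beta>_def)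
      finally show ?thesis .
    qed
    moreover have "\<bar>v powr \<beta> - 1\<bar> \<le> \<bar>v - 1\<bar>"
      using r \<beta> by (intro powr_contraction_at_1) (auto simp: v_def)
    ultimately have "\<bar>exp (x / \<alpha>) * r - 1\<bar> \<le> C * x ^ p" using v1 by simp
    then have "exp (- x / \<alpha>) * \<bar>exp (x / \<alpha>) * r - 1\<bar> \<le> 1 * (C * x ^ p)"
      using x \<alpha> by (intro mult_mono) auto
    also have "exp (- x / \<alpha>) * \<bar>exp (x / \<alpha>) * r - 1\<bar> = \<bar>r - exp (- x / \<alpha>)\<bar>"
    proof -
      have "r - exp (- x / \<alpha>) = exp (- x / \<alpha>) * (exp (x / \<alpha>) * r - 1)"
        by (simp add: right_diff_distrib mult.assoc[symmetric] exp_add[symmetric])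
      then show ?thesis by (simp add: abs_mult)
    qed
    finally have "x * \<bar>r - exp (- x / \<alpha>)\<bar> \<le> x * (C * x ^ p)" using x by (intro mult_left_mono) auto
    moreover have "x * \<bar>r - exp (- x / \<alpha>)\<bar> = \<bar>S y - x * exp (- x / \<alpha>)\<bar>"
    proof -
      have "S y - x * exp (- x / \<alpha>) = x * (r - exp (- x / \<alpha>))"
        using x by (simp add: r_def right_diff_distrib)
      then show ?thesis using x by (simp add: abs_mult)
    qed
    moreover have "exp (- x / \<alpha>) = (1 - y) powr \<beta>"
      using y by (simp add: powr_def x_def \<beta>_def)
    ultimately have "\<bar>S y - - ln (1 - y) * (1 - y) powr \<beta>\<bar> \<le> C * x ^ Suc p"
      by (simp add: x_def mult_ac)
    also have "\<dots> \<le> C * (2 * y) ^ Suc p"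
      using x \<delta> by (intro mult_left_mono power_mono) auto
    finally have 1: "\<bar>S y - - ln (1 - y) * (1 - y) powr \<beta>\<bar> \<le> C * 2 ^ Suc p * y ^ Suc p"
      by (simp add: power_mult_distrib mult_ac)
    have 2: "\<bar>- ln (1 - y) * (1 - y) powr \<beta> - (\<Sum>m\<le>p. ln_powr_taylor \<beta> m * y ^ m)\<bar> \<le> K * y ^ Suc p"
      using K[of y] y by auto
    have "(\<Sum>j\<le>p. (step_coeff \<alpha> lam j - ln_powr_taylor \<beta> j) * y ^ j) = S y - (\<Sum>m\<le>p. ln_powr_taylor \<beta> m * y ^ m)"
      unfolding S_def by (simp add: left_diff_distrib sum_subtractf)
    then have "\<bar>\<Sum>j\<le>p. (step_coeff \<alpha> lam j - ln_powr_taylor \<beta> j) * y ^ j\<bar> \<le> C * 2 ^ Suc p * y ^ Suc p + K * y ^ Suc p"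
      using 1 2 by linarith
    then show ?thesis by (simp only: distrib_right)
  qed
  have "\<forall>j\<le>p. step_coeff \<alpha> lam j - ln_powr_taylor \<beta> j = 0"
    by (rule polynomial_vanishing_order[of "min (1 / 2) (min \<delta> \<eta> / 2)", OF _ small]) (use \<delta> \<eta> in auto)
  then show ?thesis using j by (auto simp: \<beta>_def)
qed

text \<open>
  This excludes zeros between \<open>0\<close>, where the branch of the power is prescribed, and \<open>1\<close>, where the
  expansion in the step size takes place.
\<close>

lemma gen_poly_pos:
  assumes \<alpha>: "1 < \<alpha>" "\<alpha> < 2" and p: "2 \<le> p" and par: "gen_parameters \<alpha> lam" and x: "0 < x" "x < 1"
  obtains r where "0 < r" "gen_poly \<alpha> lam p (of_real x) = of_real r"
proof -
  have "1 / 2 < 1 / \<alpha>" "1 / \<alpha> < 1" using \<alpha> by (auto simp: field_simps)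
  from ln_powr_taylor_pos[OF this, of p "1 - x"] p x
  have "0 < (\<Sum>m\<le>p. ln_powr_taylor (1 / \<alpha>) m * (1 - x) ^ m)" by simp
  also have "\<dots> = (\<Sum>j\<le>p. step_coeff \<alpha> lam j * (1 - x) ^ j)"
    by (intro sum.cong) (auto simp: step_coeff_eq_taylor[OF \<alpha> p par])
  finally show ?thesis using that gen_poly_of_real[OF p] by blast
qed

section \<open>The generating function on the unit disc\<close>

text \<open>
  Locally \<open>P = exp g\<close>, and the differential equation says that \<open>W exp(-\<alpha> g)\<close> is constant. The modulus of this
  function depends on \<open>P\<close> only, so the local constants agree although the branches of \<open>g\<close> need not.
\<close>

lemma norm_of_power_ode_solution:
  fixes P W :: "complex \<Rightarrow> complex" and \<alpha> :: real
  assumes S: "open S" "connected S" and P: "P holomorphic_on S" and W: "W holomorphic_on S"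
    and nz: "\<And>z. z \<in> S \<Longrightarrow> P z \<noteq> 0"
    and ode: "\<And>z. z \<in> S \<Longrightarrow> deriv W z * P z = of_real \<alpha> * W z * deriv P z"
  shows "(\<lambda>z. norm (W z) * norm (P z) powr (- \<alpha>)) constant_on S"
proof (rule locally_constant_imp_constant[OF S(2)])
  fix a assume a: "a \<in> S"
  obtain e where e: "0 < e" "ball a e \<subseteq> S" using a S(1) open_contains_ball by blast
  have hol: "P holomorphic_on ball a e" "W holomorphic_on ball a e"
    using P W e holomorphic_on_subset by blast+
  obtain g where g: "g holomorphic_on ball a e" "\<And>z. z \<in> ball a e \<Longrightarrow> P z = exp (g z)"
    using contractible_imp_holomorphic_log[OF hol(1) convex_imp_contractible[OF convex_ball]] nz e by blast
  let ?F = "\<lambda>z. W z * exp (- of_real \<alpha> * g z)"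
  have "\<exists>c. \<forall>z\<in>ball a e. ?F z = c"
  proof (rule has_field_derivative_zero_constant[OF convex_ball])
    fix z assume z: "z \<in> ball a e"
    have dg: "(g has_field_derivative deriv g z) (at z)"
      using holomorphic_derivI[OF g(1) open_ball z] .
    have dW: "(W has_field_derivative deriv W z) (at z)"
      using holomorphic_derivI[OF hol(2) open_ball z] .
    have "((\<lambda>z. exp (g z)) has_field_derivative exp (g z) * deriv g z) (at z)"
      using dg by (auto intro!: derivative_eq_intros)
    then have "(P has_field_derivative exp (g z) * deriv g z) (at z)"
      by (rule has_field_derivative_transform_within_open[OF _ open_ball z]) (simp add: g(2))
    then have "deriv P z = P z * deriv g z"
      using g(2)[OF z] DERIV_imp_deriv by metis
    moreover have "z \<in> S" using z e by blast
    ultimately have "deriv W z * P z = (of_real \<alpha> * W z * deriv g z) * P z"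
      using ode[of z] by (simp add: mult_ac)
    then have "deriv W z = of_real \<alpha> * W z * deriv g z" using nz[OF \<open>z \<in> S\<close>] by simp
    then have "(?F has_field_derivative 0) (at z)"
      using dW dg by (auto intro!: derivative_eq_intros simp: algebra_simps)
    then show "(?F has_field_derivative 0) (at z within ball a e)"
      by (rule has_field_derivative_at_within)
  qed
  then obtain c where c: "\<And>z. z \<in> ball a e \<Longrightarrow> ?F z = c" by blast
  have "norm (W z) * norm (P z) powr (- \<alpha>) = norm c" if z: "z \<in> ball a e" for z
  proof -
    have "norm (P z) powr (- \<alpha>) = norm (exp (- of_real \<alpha> * g z))"
      using g(2)[OF z] by (simp add: powr_def)
    moreover have "norm c = norm (W z) * norm (exp (- of_real \<alpha> * g z))"
      unfolding c[OF z, symmetric] by (rule norm_mult)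
    ultimately show ?thesis by (simp only:)
  qed
  then have "\<forall>z\<in>ball a e. norm (W z) * norm (P z) powr (- \<alpha>) = norm (W a) * norm (P a) powr (- \<alpha>)"
    using e(1) by simp
  then show "\<exists>T. openin (top_of_set S) T \<and> a \<in> T \<and> (\<forall>z\<in>T. norm (W z) * norm (P z) powr (- \<alpha>) = norm (W a) * norm (P a) powr (- \<alpha>))"
    using open_subset[OF e(2) open_ball] centre_in_ball[THEN iffD2, OF e(1)] by blast
qed

text \<open>
  The equation holds for the principal power near a point \<open>x0\<close> of \<open>(0, 1)\<close> close to \<open>0\<close>, since
  \<open>P\<close> is positive there; it extends to the disc by analytic continuation.
\<close>

lemma gen_fun_ode:
  assumes \<alpha>: "1 < \<alpha>" "\<alpha> < 2" and p: "2 \<le> p" and par: "gen_parameters \<alpha> lam"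
    and W: "is_gen_fun \<alpha> lam p W"
  obtains x0 where "0 < x0" "x0 < 1" "W (of_real x0) = gen_poly \<alpha> lam p (of_real x0) powr of_real \<alpha>"
    "\<And>z. z \<in> ball 0 1 \<Longrightarrow> deriv W z * gen_poly \<alpha> lam p z = of_real \<alpha> * W z * deriv (gen_poly \<alpha> lam p) z"
proof -
  let ?P = "gen_poly \<alpha> lam p"
  have hW: "W holomorphic_on ball 0 1" using W by (simp add: is_gen_fun_def)
  obtain e where e: "0 < e" and We: "\<And>z. norm z < e \<Longrightarrow> W z = ?P z powr of_real \<alpha>"
    using W unfolding is_gen_fun_def eventually_nhds_metric by auto
  \<comment> \<open>Any point of \<open>(0, 1)\<close> within the neighbourhood of \<open>0\<close> where \<open>W\<close> is the principal power.\<close>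
  define x0 where "x0 = min e 1 / 2"
  have x0: "0 < x0" "x0 < 1" "x0 < e" using e by (auto simp: x0_def min_def)
  obtain r where r: "0 < r" "?P (of_real x0) = of_real r"
    using gen_poly_pos[OF \<alpha> p par x0(1,2)] by blast
  have contP: "continuous_on UNIV ?P"
    using gen_poly_holomorphic holomorphic_on_imp_continuous_on by blast
  \<comment> \<open>A neighbourhood of \<open>x0\<close> on which the principal power is analytic and equal to \<open>W\<close>.\<close>
  define U where "U = {z. ?P z \<in> - \<real>\<^sub>\<le>\<^sub>0} \<inter> ball 0 (min e 1)"
  have "open {z. ?P z \<in> - \<real>\<^sub>\<le>\<^sub>0}"
    using open_vimage[OF _ contP, of "- \<real>\<^sub>\<le>\<^sub>0"] closed_nonpos_Reals_complex by (simp add: vimage_def open_closed)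
  then have U: "open U" "U \<subseteq> ball 0 1" "of_real x0 \<in> U"
    using x0 r by (auto simp: U_def complex_nonpos_Reals_iff)
  have "deriv W z * ?P z - of_real \<alpha> * W z * deriv ?P z = 0" if z: "z \<in> ball 0 1" for z
  proof (rule analytic_continuation[of "\<lambda>z. deriv W z * ?P z - of_real \<alpha> * W z * deriv ?P z" "ball 0 1" U "of_real x0"])
    show "(\<lambda>z. deriv W z * ?P z - of_real \<alpha> * W z * deriv ?P z) holomorphic_on ball 0 1"
      by (intro holomorphic_intros hW gen_poly_holomorphic holomorphic_deriv) auto
    show "of_real x0 islimpt U" using U interior_limit_point interior_open by blast
    fix z assume z: "z \<in> U"
    have dP: "(?P has_field_derivative deriv ?P z) (at z)"
      using holomorphic_derivI[OF gen_poly_holomorphic open_UNIV] by simp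
    have Pz: "?P z \<notin> \<real>\<^sub>\<le>\<^sub>0" "?P z \<noteq> 0" using z by (auto simp: U_def)
    have d: "((\<lambda>z. exp (of_real \<alpha> * Ln (?P z))) has_field_derivative
        exp (of_real \<alpha> * Ln (?P z)) * (of_real \<alpha> * (deriv ?P z / ?P z))) (at z)"
      using dP Pz by (auto intro!: derivative_eq_intros simp: divide_inverse mult_ac)
    have eqW: "exp (of_real \<alpha> * Ln (?P z)) = W z" if "z \<in> U" for z
    proof -
      have "?P z \<noteq> 0" "norm z < e" using that by (auto simp: U_def)
      then show ?thesis using We by (simp add: powr_def)
    qed
    have "(W has_field_derivative W z * (of_real \<alpha> * (deriv ?P z / ?P z))) (at z)"
      using has_field_derivative_transform_within_open[OF d U(1) z eqW] unfolding eqW[OF z] .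
    then have "deriv W z = W z * (of_real \<alpha> * (deriv ?P z / ?P z))" by (rule DERIV_imp_deriv)
    then show "deriv W z * ?P z - of_real \<alpha> * W z * deriv ?P z = 0" using Pz by simp
  qed (use U z x0 in auto)
  then show ?thesis using that[of x0] x0 We[of "of_real x0"] by auto
qed

text \<open>
  The disc without the finitely many zeros of \<open>P\<close> is connected, so the constant modulus can be evaluated at the
  point \<open>x0\<close>.
\<close>

lemma gen_fun_norm:
  assumes \<alpha>: "1 < \<alpha>" "\<alpha> < 2" and p: "2 \<le> p" and par: "gen_parameters \<alpha> lam"
    and W: "is_gen_fun \<alpha> lam p W"
  shows "finite {z \<in> cball 0 1. gen_poly \<alpha> lam p z = 0}"
    and "\<And>z. norm z < 1 \<Longrightarrow> gen_poly \<alpha> lam p z \<noteq> 0 \<Longrightarrow> norm (W z) = norm (gen_poly \<alpha> lam p z) powr \<alpha>"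
proof -
  let ?P = "gen_poly \<alpha> lam p"
  have hW: "W holomorphic_on ball 0 1" using W by (simp add: is_gen_fun_def)
  obtain x0 where x0: "0 < x0" "x0 < 1" "W (of_real x0) = ?P (of_real x0) powr of_real \<alpha>"
    and ode: "\<And>z. z \<in> ball 0 1 \<Longrightarrow> deriv W z * ?P z = of_real \<alpha> * W z * deriv ?P z"
    using gen_fun_ode[OF \<alpha> p par W] by blast
  obtain r where r: "0 < r" "?P (of_real x0) = of_real r"
    using gen_poly_pos[OF \<alpha> p par x0(1,2)] by blast
  have "?P 1 = 0" unfolding gen_poly_def by (simp add: power_0_left)
  then have "\<not> ?P constant_on UNIV"
    using r unfolding constant_on_def by (metis UNIV_I less_irrefl of_real_eq_0_iff)
  then show fin: "finite {z \<in> cball 0 1. ?P z = 0}"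
    by (intro holomorphic_compact_finite_zeros[OF gen_poly_holomorphic, of UNIV]) auto
  define S where "S = ball 0 1 - {z \<in> cball 0 1. ?P z = 0}"
  have S: "open S" "connected S"
    unfolding S_def using fin by (auto intro!: open_Diff finite_imp_closed connected_open_delete_finite)
  have "(\<lambda>z. norm (W z) * norm (?P z) powr (- \<alpha>)) constant_on S"
  proof (rule norm_of_power_ode_solution[OF S])
    show "W holomorphic_on S" using hW by (rule holomorphic_on_subset) (auto simp: S_def)
  qed (use ode gen_poly_holomorphic in \<open>auto simp: S_def\<close>)
  then obtain c where c: "\<And>z. z \<in> S \<Longrightarrow> norm (W z) * norm (?P z) powr (- \<alpha>) = c"
    unfolding constant_on_def by blast
  have "of_real x0 \<in> S" using x0 r by (auto simp: S_def)
  from c[OF this] have "c = 1"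
    using x0 r by (simp add: norm_powr_real_powr' powr_minus)
  fix z :: complex assume z: "norm z < 1" "?P z \<noteq> 0"
  then have "z \<in> S" by (simp add: S_def)
  from c[OF this] \<open>c = 1\<close> show "norm (W z) = norm (?P z) powr \<alpha>"
    using z by (simp add: powr_minus field_simps)
qed

text \<open>
  The zeros of \<open>P\<close> are isolated, and \<open>W\<close> is continuous there.
\<close>

lemma gen_fun_bounded:
  assumes \<alpha>: "1 < \<alpha>" "\<alpha> < 2" and p: "2 \<le> p" and par: "gen_parameters \<alpha> lam"
    and W: "is_gen_fun \<alpha> lam p W"
  obtains M where "\<And>z. norm z < 1 \<Longrightarrow> norm (W z) \<le> M"
proof -
  let ?P = "gen_poly \<alpha> lam p"
  note norm_W = gen_fun_norm[OF \<alpha> p par W]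
  have "bounded (?P ` cball 0 1)"
    by (intro compact_imp_bounded compact_continuous_image holomorphic_on_imp_continuous_on gen_poly_holomorphic) auto
  then obtain B where B: "\<forall>w\<in>?P ` cball 0 1. norm w \<le> B" unfolding bounded_iff by blast
  have off: "norm (W z) \<le> B powr \<alpha>" if "norm z < 1" "?P z \<noteq> 0" for z
    using norm_W(2)[OF that] B that \<alpha> by (auto intro!: powr_mono2)
  have "norm (W z) \<le> B powr \<alpha>" if z: "norm z < 1" for z
  proof -
    have "isCont W z"
      using W z holomorphic_on_imp_continuous_on continuous_on_eq_continuous_at[of "ball 0 1" W]
      by (auto simp: is_gen_fun_def)
    then have "((\<lambda>y. norm (W y)) \<longlongrightarrow> norm (W z)) (at z)"
      by (intro tendsto_norm) (simp add: isCont_def)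
    moreover have "eventually (\<lambda>y. y \<in> ball 0 1 - ({y \<in> cball 0 1. ?P y = 0} - {z})) (at z)"
      by (intro eventually_at_in_open' open_Diff finite_imp_closed) (use norm_W(1) z in auto)
    then have "eventually (\<lambda>y. norm (W y) \<le> B powr \<alpha>) (at z)"
      using eventually_neq_at_within[of z z UNIV]
      by eventually_elim (use off in auto)
    ultimately show ?thesis by (intro tendsto_upperbound) auto
  qed
  then show ?thesis by (rule that)
qed

text \<open>
  Cauchy's estimate on circles of radius \<open>r < 1\<close>, in the limit \<open>r = 1\<close>.
\<close>

lemma bounded_power_series_coeffs:
  fixes c :: "nat \<Rightarrow> complex"
  assumes W: "W holomorphic_on ball 0 1" and sums: "\<And>z. norm z < 1 \<Longrightarrow> (\<lambda>l. c l * z ^ l) sums W z"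
    and M: "\<And>z. norm z < 1 \<Longrightarrow> norm (W z) \<le> M"
  shows "norm (c l) \<le> M"
proof -
  define F where "F = Abs_fps c"
  have "ereal (norm (1 / 2 :: complex)) \<le> conv_radius c"
    by (rule conv_radius_geI) (use sums[of "1 / 2"] in \<open>auto simp: sums_iff\<close>)
  then have "0 < fps_conv_radius F"
    unfolding fps_conv_radius_def F_def by (simp add: less_le_trans[of 0 "ereal (1/2)"] fps_nth_Abs_fps)
  moreover have "eventually (\<lambda>z. eval_fps F z = W z) (nhds 0)"
  proof -
    have "eventually (\<lambda>z. z \<in> ball (0::complex) 1) (nhds 0)" by (intro eventually_nhds_in_open) auto
    then show ?thesis
      by eventually_elim (use sums in \<open>auto simp: eval_fps_def F_def sums_iff\<close>)
  qed
  ultimately have "W has_fps_expansion F" by (simp add: has_fps_expansion_def)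
  from fps_nth_fps_expansion[OF this, of l] have c: "c l = (deriv ^^ l) W 0 / fact l" by (simp add: F_def)
  have bound: "norm (c l) * r ^ l \<le> M" if r: "0 < r" "r < 1" for r :: real
  proof -
    have "norm ((deriv ^^ l) W 0) \<le> fact l * M / r ^ l"
    proof (rule Cauchy_inequality[OF _ _ r(1)])
      show "W holomorphic_on ball 0 r" using W by (rule holomorphic_on_subset) (use r in auto)
      show "continuous_on (cball 0 r) W"
        using holomorphic_on_imp_continuous_on[OF W] by (rule continuous_on_subset) (use r in auto)
    qed (use M r in auto)
    then show ?thesis using r by (simp add: c norm_divide field_simps)
  qed
  have "((\<lambda>r. norm (c l) * r ^ l) \<longlongrightarrow> norm (c l) * 1 ^ l) (at_left 1)" by (intro tendsto_intros)
  moreover have "eventually (\<lambda>r::real. norm (c l) * r ^ l \<le> M) (at_left 1)"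
    using eventually_at_left_real[of 0 1] by (auto elim!: eventually_mono intro: bound)
  ultimately have "norm (c l) * 1 ^ l \<le> M" by (intro tendsto_upperbound) auto
  then show ?thesis by simp
qed

text \<open>
  On \<open>(0, 1)\<close> the function \<open>W\<close> is real, because its coefficients are, and it has the modulus \<open>P powr \<alpha>\<close>, which does not
  vanish. Its sign is therefore constant, and near \<open>0\<close> it is positive.
\<close>

lemma gen_fun_pos:
  fixes \<kappa> :: "nat \<Rightarrow> real"
  assumes \<alpha>: "1 < \<alpha>" "\<alpha> < 2" and p: "2 \<le> p" and par: "gen_parameters \<alpha> lam"
    and W: "is_gen_fun \<alpha> lam p W" and sums: "\<And>z. norm z < 1 \<Longrightarrow> (\<lambda>l. of_real (\<kappa> l) * z ^ l) sums W z"
    and x: "0 < x" "x < 1"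
  shows "W (of_real x) = gen_poly \<alpha> lam p (of_real x) powr of_real \<alpha>"
proof -
  let ?P = "gen_poly \<alpha> lam p"
  have hW: "W holomorphic_on ball 0 1" using W by (simp add: is_gen_fun_def)
  obtain x0 where x0: "0 < x0" "x0 < 1" "W (of_real x0) = ?P (of_real x0) powr of_real \<alpha>"
    using gen_fun_ode[OF \<alpha> p par W] by blast
  have W_real: "W (of_real y) = of_real (Re (W (of_real y)))" if "0 < y" "y < 1" for y :: real
  proof -
    have "(\<lambda>l. Im (of_real (\<kappa> l) * of_real y ^ l)) sums Im (W (of_real y))"
      by (intro sums_Im sums) (use that in simp)
    moreover have "Im (of_real (\<kappa> l) * of_real y ^ l) = 0" for l
      by (metis Im_complex_of_real of_real_mult of_real_power)
    ultimately have "Im (W (of_real y)) = 0" using sums_unique2[OF _ sums_zero] by simp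
    then show ?thesis by (simp add: complex_eq_iff)
  qed
  have W_abs: "norm (W (of_real y)) = r powr \<alpha>" if "0 < y" "y < 1" "?P (of_real y) = of_real r" "0 < r" for y r
    using gen_fun_norm(2)[OF \<alpha> p par W, of "of_real y"] that by simp
  have nz: "Re (W (of_real y)) \<noteq> 0" if y: "0 < y" "y < 1" for y
  proof -
    obtain r where "0 < r" "?P (of_real y) = of_real r" using gen_poly_pos[OF \<alpha> p par y] by blast
    with W_abs[OF y] have "W (of_real y) \<noteq> 0" by auto
    then show ?thesis using W_real[OF y] by auto
  qed
  obtain r0 where r0: "0 < r0" "?P (of_real x0) = of_real r0" using gen_poly_pos[OF \<alpha> p par x0(1,2)] by blast
  have pos0: "0 < Re (W (of_real x0))" using x0(3) r0 by (simp add: powr_of_real)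
  have cont: "continuous_on {0<..<1} (\<lambda>y. Re (W (of_real y)))"
  proof (intro continuous_intros continuous_on_compose2[OF holomorphic_on_imp_continuous_on[OF hW]])
  qed auto
  have "0 < Re (W (of_real x))"
  proof (rule ccontr)
    assume "\<not> 0 < Re (W (of_real x))"
    then have le: "Re (W (of_real x)) \<le> 0" by simp
    have "connected ((\<lambda>y. Re (W (of_real y))) ` {0<..<1})"
      by (intro connected_continuous_image cont) auto
    from connected_contains_Icc[OF this, of "Re (W (of_real x))" "Re (W (of_real x0))"]
    have "{Re (W (of_real x))..Re (W (of_real x0))} \<subseteq> (\<lambda>y. Re (W (of_real y))) ` {0<..<1}"
      using x x0(1,2) by (meson greaterThanLessThan_iff imageI)
    with le pos0 have "0 \<in> (\<lambda>y. Re (W (of_real y))) ` {0<..<1}" by auto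
    then show False using nz by auto
  qed
  moreover obtain r where r: "0 < r" "?P (of_real x) = of_real r" using gen_poly_pos[OF \<alpha> p par x] by blast
  ultimately have "Re (W (of_real x)) = r powr \<alpha>"
    using W_abs[OF x r(2,1)] W_real[OF x] by (metis abs_of_pos norm_of_real)
  then show ?thesis using W_real[OF x] r by (simp add: powr_of_real)
qed

text \<open>
  In the half disc \<open>W(exp(-z)) = z powr \<alpha> (P(exp(-z))/z) powr \<alpha>\<close>, as both sides are analytic and agree for real \<open>z\<close>; there
  the definition of the parameters gives the estimate. For \<open>\<bar>z\<bar> \<ge> \<delta>\<close> both terms on the left-hand side are dominated
  separately.
\<close>

lemma gen_fun_symbol_error:
  fixes \<kappa> :: "nat \<Rightarrow> real"
  assumes \<alpha>: "1 < \<alpha>" "\<alpha> < 2" and p: "2 \<le> p" and par: "gen_parameters \<alpha> lam"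
    and W: "is_gen_fun \<alpha> lam p W" and sums: "\<And>z. norm z < 1 \<Longrightarrow> (\<lambda>l. of_real (\<kappa> l) * z ^ l) sums W z"
  obtains C where "\<And>z. 0 < Re z \<Longrightarrow> Re z \<le> 1 \<Longrightarrow>
    norm (exp z * W (exp (- z)) - z powr of_real \<alpha>) \<le> C * norm z powr (\<alpha> + real p)"
proof -
  let ?P = "gen_poly \<alpha> lam p"
  let ?Q = "\<lambda>z. ?P (exp (- z)) / z"
  have hW: "W holomorphic_on ball 0 1" using W by (simp add: is_gen_fun_def)
  obtain M where M: "\<And>z. norm z < 1 \<Longrightarrow> norm (W z) \<le> M" using gen_fun_bounded[OF \<alpha> p par W] by blast
  obtain \<delta>1 C where \<delta>1: "0 < \<delta>1" "0 \<le> C" and bound: "\<And>z. z \<noteq> 0 \<Longrightarrow> norm z < \<delta>1 \<Longrightarrow>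
      norm (exp z * ?Q z powr of_real \<alpha> - 1) \<le> C * norm z ^ p"
    using gen_parameters_bound[OF par p] by metis
  have "eventually (\<lambda>z. dist (?Q z) 1 < 1) (at 0)"
    using gen_poly_exp_quotient[OF p] by (rule tendstoD) simp
  then obtain \<delta>2 where \<delta>2: "0 < \<delta>2" and near: "\<And>z. z \<noteq> 0 \<Longrightarrow> norm z < \<delta>2 \<Longrightarrow> norm (?Q z - 1) < 1"
    unfolding eventually_at by (auto simp: dist_norm)
  define \<delta> where "\<delta> = min \<delta>1 \<delta>2"
  have \<delta>: "0 < \<delta>" "\<delta> \<le> \<delta>1" "\<delta> \<le> \<delta>2" using \<delta>1 \<delta>2 by (auto simp: \<delta>_def)
  have Q_slit: "?Q z \<notin> \<real>\<^sub>\<le>\<^sub>0" if "z \<noteq> 0" "norm z < \<delta>" for z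
  proof -
    have "\<bar>Re (?Q z - 1)\<bar> < 1" using near[of z] that \<delta> abs_Re_le_cmod[of "?Q z - 1"] by linarith
    then show ?thesis by (auto simp: complex_nonpos_Reals_iff)
  qed
  \<comment> \<open>On this half disc \<open>z\<close> and \<open>P(exp(-z))/z\<close> both avoid the cut of the principal power.\<close>
  define H where "H = ball 0 \<delta> \<inter> {z. 0 < Re z}"
  have H: "open H" "connected H"
    unfolding H_def by (auto intro!: open_Int open_halfspace_Re_gt convex_connected convex_Int convex_halfspace_Re_gt)
  have slit: "z \<notin> \<real>\<^sub>\<le>\<^sub>0" "?Q z \<notin> \<real>\<^sub>\<le>\<^sub>0" "z \<noteq> 0" if "z \<in> H" for z
  proof -
    show "z \<notin> \<real>\<^sub>\<le>\<^sub>0" "z \<noteq> 0" using that by (auto simp: H_def complex_nonpos_Reals_iff)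
    then show "?Q z \<notin> \<real>\<^sub>\<le>\<^sub>0" using that by (intro Q_slit) (auto simp: H_def)
  qed
  have half_disc: "W (exp (- z)) = z powr of_real \<alpha> * ?Q z powr of_real \<alpha>" if z: "z \<in> H" for z
  proof -
    let ?h = "\<lambda>z. W (exp (- z)) - z powr of_real \<alpha> * ?Q z powr of_real \<alpha>"
    let ?U = "complex_of_real ` {0<..<\<delta>}"
    have "?h z = 0"
    proof (rule analytic_continuation[of ?h H ?U "of_real (\<delta> / 2)", OF _ H])
      have "(W \<circ> (\<lambda>z. exp (- z))) holomorphic_on H"
        by (rule holomorphic_on_compose_gen[OF _ hW]) (auto intro!: holomorphic_intros simp: H_def)
      moreover have "((\<lambda>z. ?P z) \<circ> (\<lambda>z. exp (- z))) holomorphic_on H"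
        by (rule holomorphic_on_compose_gen[OF _ gen_poly_holomorphic[of _ _ _ UNIV]]) (auto intro!: holomorphic_intros)
      ultimately show "?h holomorphic_on H"
        unfolding o_def
        by (intro holomorphic_intros) (use slit in auto)
      show "?U \<subseteq> H" by (auto simp: H_def)
      show "of_real (\<delta> / 2) \<in> H" using \<delta> by (auto simp: H_def)
      have "\<delta> / 2 islimpt {0<..<\<delta>}"
        using \<delta> by (intro interior_limit_point) (simp add: interior_open)
      then show "of_real (\<delta> / 2) islimpt ?U"
      proof -
        show ?thesis
          unfolding islimpt_approachable
        proof (intro allI impI)
          fix e :: real assume "0 < e"
          then obtain y where "y \<in> {0<..<\<delta>}" "y \<noteq> \<delta> / 2" "dist y (\<delta> / 2) < e"
            using \<open>\<delta> / 2 islimpt {0<..<\<delta>}\<close> unfolding islimpt_approachable by blast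
          then show "\<exists>x'\<in>?U. x' \<noteq> of_real (\<delta> / 2) \<and> dist x' (of_real (\<delta> / 2)) < e"
            by (intro bexI[of _ "of_real y"]) (auto simp: dist_norm simp flip: of_real_diff of_real_divide)
        qed
      qed
      fix w assume "w \<in> ?U"
      then obtain x where w: "w = of_real x" and x: "0 < x" "x < \<delta>" by auto
      have ex: "exp (- w) = of_real (exp (- x))" unfolding w by (simp flip: exp_of_real)
      obtain r where r: "0 < r" "?P (of_real (exp (- x))) = of_real r"
        using gen_poly_pos[OF \<alpha> p par, of "exp (- x)"] x by auto
      have "W (exp (- w)) = of_real (r powr \<alpha>)"
        unfolding ex using gen_fun_pos[OF \<alpha> p par W sums, of "exp (- x)"] x r by (simp add: powr_of_real)
      moreover have "w powr of_real \<alpha> * ?Q w powr of_real \<alpha> = of_real (x powr \<alpha> * (r / x) powr \<alpha>)"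
        unfolding ex r(2) unfolding w using x r by (simp add: powr_of_real flip: of_real_divide)
      moreover have "x powr \<alpha> * (r / x) powr \<alpha> = r powr \<alpha>"
        using x r by (simp add: powr_divide)
      ultimately show "?h w = 0" by simp
    qed (rule z)
    then show ?thesis by simp
  qed
  define q where "q = \<alpha> + real p"
  have q: "0 < q" using \<alpha> by (simp add: q_def)
  show ?thesis
  proof (rule that[of "max C (exp 1 * M / \<delta> powr q + 1 / \<delta> ^ p)"])
    fix z :: complex assume z: "0 < Re z" "Re z \<le> 1"
    then have z0: "z \<noteq> 0" by auto
    have zp: "norm z powr q = norm z powr \<alpha> * norm z ^ p"
      using z0 by (simp add: q_def powr_add powr_realpow)
    show "norm (exp z * W (exp (- z)) - z powr of_real \<alpha>) \<le> max C (exp 1 * M / \<delta> powr q + 1 / \<delta> ^ p) * norm z powr (\<alpha> + real p)"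
    proof (cases "norm z < \<delta>")
      case True
      have "exp z * W (exp (- z)) - z powr of_real \<alpha> = z powr of_real \<alpha> * (exp z * ?Q z powr of_real \<alpha> - 1)"
        using half_disc[of z] True z by (simp add: H_def algebra_simps)
      then have "norm (exp z * W (exp (- z)) - z powr of_real \<alpha>) = norm z powr \<alpha> * norm (exp z * ?Q z powr of_real \<alpha> - 1)"
        by (simp add: norm_mult norm_powr_real_powr')
      also have "\<dots> \<le> norm z powr \<alpha> * (C * norm z ^ p)"
        using bound[of z] z0 True \<delta> by (intro mult_left_mono) auto
      also have "\<dots> = C * norm z powr q" by (simp add: zp)
      also have "\<dots> \<le> max C (exp 1 * M / \<delta> powr q + 1 / \<delta> ^ p) * norm z powr q"
        by (intro mult_right_mono) auto
      finally show ?thesis by (simp add: q_def)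
    next
      case False
      have M0: "0 \<le> M" using order_trans[OF norm_ge_zero M[of 0]] by simp
      have ratio: "1 \<le> norm z powr q / \<delta> powr q" "1 \<le> norm z ^ p / \<delta> ^ p"
        using False \<delta> q by (auto simp: powr_mono2 power_mono)
      have "norm (exp z * W (exp (- z))) \<le> exp 1 * M"
        unfolding norm_mult using z M[of "exp (- z)"] by (intro mult_mono) auto
      also have "\<dots> \<le> exp 1 * M * (norm z powr q / \<delta> powr q)"
        using mult_left_mono[OF ratio(1), of "exp 1 * M"] M0 by simp
      finally have 1: "norm (exp z * W (exp (- z))) \<le> exp 1 * M / \<delta> powr q * norm z powr q" by simp
      have "norm (z powr of_real \<alpha>) \<le> norm z powr \<alpha> * (norm z ^ p / \<delta> ^ p)"
        using mult_left_mono[OF ratio(2), of "norm z powr \<alpha>"] by (simp add: norm_powr_real_powr')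
      then have 2: "norm (z powr of_real \<alpha>) \<le> 1 / \<delta> ^ p * norm z powr q" by (simp add: zp)
      have "norm (exp z * W (exp (- z)) - z powr of_real \<alpha>) \<le> (exp 1 * M / \<delta> powr q + 1 / \<delta> ^ p) * norm z powr q"
        using norm_triangle_ineq4[of "exp z * W (exp (- z))" "z powr of_real \<alpha>"] 1 2
        by (simp only: distrib_right)
      also have "\<dots> \<le> max C (exp 1 * M / \<delta> powr q + 1 / \<delta> ^ p) * norm z powr q"
        by (intro mult_right_mono) auto
      finally show ?thesis by (simp add: q_def)
    qed
  qed
qed

section \<open>The difference operator as a Fourier multiplier\<close>

text \<open>
  The damped sums \<open>\<Sum> \<kappa>(l) exp(-(l - 1) \<sigma>) u(x - (l - 1) h)\<close> have the symbol \<open>exp(z) \<Sum> \<kappa>(l) exp(-z)^l\<close> at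
  \<open>z = \<sigma> + \<i> \<omega> h\<close>, a point of the half plane where the bound on the symbols is available. The inequality is proved for
  \<open>\<sigma> > 0\<close> and carried over to \<open>\<sigma> = 0\<close>: the sums converge by Tannery's theorem, the integrals by
  dominated convergence.
\<close>

lemma left_diff_fourier_error:
  fixes \<kappa> :: "nat \<Rightarrow> real" and \<alpha> q :: real
  assumes u: "integrable_derivs n u" "2 \<le> n" and q: "0 < \<alpha>" "\<alpha> \<le> q" "q + 1 < n"
    and \<kappa>: "\<And>l. \<bar>\<kappa> l\<bar> \<le> M" and h: "0 < h"
    and bound: "\<And>z. 0 < Re z \<Longrightarrow> Re z \<le> 1 \<Longrightarrow>
      norm (exp z * (\<Sum>l. of_real (\<kappa> l) * exp (- z) ^ l) - z powr of_real \<alpha>) \<le> C * norm z powr q"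
  shows "summable (\<lambda>l. \<kappa> l * u (x - (real l - 1) * h))"
    and "norm (2 * pi * complex_of_real (\<Sum>l. \<kappa> l * u (x - (real l - 1) * h))
        - (LINT \<omega>|lborel. fourier u \<omega> * (\<i> * \<omega> * h) powr of_real \<alpha> * iexp (\<omega> * x)))
      \<le> C * (LINT \<omega>|lborel. (\<bar>\<omega>\<bar> * h) powr q * norm (fourier u \<omega>))"
proof -
  have n1: "1 \<le> n" using u by simp
  have u_int: "integrable lborel u" using integrable_derivs_DERIV[OF u(1) n1] by simp
  then have [measurable]: "u \<in> borel_measurable borel" by (auto dest: borel_measurable_integrable)
  obtain B where B: "\<bar>u t\<bar> \<le> B" for t using bounded_of_integrable_deriv[OF u(1) n1] by blast
  have cont: "continuous_on UNIV u"
    using integrable_derivs_DERIV(1)[OF u(1) n1]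
    by (meson DERIV_isCont continuous_at_imp_continuous_on)
  note uhn = integrable_norm_fourier(1)[OF u] and uh = integrable_norm_fourier(2)[OF u]
  have inv: "(LINT \<omega>|lborel. fourier u \<omega> * iexp (\<omega> * x)) = 2 * pi * u x" for x
    by (rule fourier_inversion[OF u_int cont B uh])
  have M0: "0 \<le> M" using \<kappa>[of 0] by linarith
  have uhq: "integrable lborel (\<lambda>\<omega>. (\<bar>\<omega>\<bar> * h) powr q * norm (fourier u \<omega>))"
  proof -
    have "integrable lborel (\<lambda>\<omega>. h powr q * (\<bar>\<omega>\<bar> powr q * norm (fourier u \<omega>)))"
      using q by (intro integrable_mult_right integrable_powr_fourier[OF u(1)]) auto
    then show ?thesis using h by (simp add: powr_mult mult_ac)
  qed
  have dom_int: "integrable lborel (\<lambda>\<omega>. (1 + \<bar>\<omega>\<bar> * h) powr q * norm (fourier u \<omega>))"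
  proof (rule Bochner_Integration.integrable_bound)
    show "integrable lborel (\<lambda>\<omega>. 2 powr q * (norm (fourier u \<omega>) + (\<bar>\<omega>\<bar> * h) powr q * norm (fourier u \<omega>)))"
      by (intro integrable_mult_right Bochner_Integration.integrable_add uhn uhq)
    \<comment> \<open>\<open>1 + a \<le> 2 max 1 a\<close>.\<close>
    have le: "(1 + a) powr q \<le> 2 powr q * (1 + a powr q)" if "0 \<le> a" for a :: real
    proof -
      have "(1 + a) powr q \<le> (2 * max 1 a) powr q" using that q by (intro powr_mono2) auto
      also have "\<dots> = 2 powr q * (max 1 a) powr q" using that by (simp add: powr_mult)
      also have "\<dots> \<le> 2 powr q * (1 + a powr q)"
        by (intro mult_left_mono) (auto simp: max_def)
      finally show ?thesis .
    qed
    have "(1 + \<bar>\<omega>\<bar> * h) powr q * norm (fourier u \<omega>) \<le> 2 powr q * (norm (fourier u \<omega>) + (\<bar>\<omega>\<bar> * h) powr q * norm (fourier u \<omega>))" for \<omega>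
      using mult_right_mono[OF le[of "\<bar>\<omega>\<bar> * h"], of "norm (fourier u \<omega>)"] h by (simp add: algebra_simps)
    then show "AE \<omega> in lborel. norm ((1 + \<bar>\<omega>\<bar> * h) powr q * norm (fourier u \<omega>)) \<le> norm (2 powr q * (norm (fourier u \<omega>) + (\<bar>\<omega>\<bar> * h) powr q * norm (fourier u \<omega>)))"
      by (intro AE_I2) (simp add: abs_mult)
  qed measurable
  have samples: "summable (\<lambda>l. \<bar>u (x - (real l - 1) * h)\<bar>)"
    using summable_samples[OF u(1) n1 h, of "x + h"] by (simp add: algebra_simps)
  then have M_samples: "summable (\<lambda>l. exp 1 * M * \<bar>u (x - (real l - 1) * h)\<bar>)" by (rule summable_mult)
  show "summable (\<lambda>l. \<kappa> l * u (x - (real l - 1) * h))"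
    by (rule summable_comparison_test'[OF summable_mult[OF samples, of M]])
      (use \<kappa> in \<open>auto simp: abs_mult intro: mult_right_mono\<close>)
  \<comment> \<open>The damping parameters do not exceed \<open>1\<close>, since the symbols are compared for \<open>Re z \<le> 1\<close> only.\<close>
  define \<sigma> where "\<sigma> k = inverse (real (Suc k))" for k
  have \<sigma>: "\<sigma> k > 0" "\<sigma> k \<le> 1" for k by (simp_all add: \<sigma>_def field_simps)
  have \<sigma>0: "\<sigma> \<longlonglongrightarrow> 0" unfolding \<sigma>_def by (rule LIMSEQ_inverse_real_of_nat)
  define Z where "Z k \<omega> = of_real (\<sigma> k) + \<i> * complex_of_real \<omega> * of_real h" for k \<omega>
  have Re_Z: "Re (Z k \<omega>) = \<sigma> k" for k \<omega> by (simp add: Z_def)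
  have Z_norm: "norm (Z k \<omega>) \<le> 1 + \<bar>\<omega>\<bar> * h" for k \<omega>
  proof -
    have "norm (Z k \<omega>) \<le> norm (complex_of_real (\<sigma> k)) + norm (\<i> * complex_of_real \<omega> * of_real h)"
      unfolding Z_def by (rule norm_triangle_ineq)
    then show ?thesis using \<sigma>[of k] h by (simp add: norm_mult)
  qed
  have Z_lim: "(\<lambda>k. Z k \<omega>) \<longlonglongrightarrow> \<i> * \<omega> * h" for \<omega>
  proof -
    have "(\<lambda>k. Z k \<omega>) \<longlonglongrightarrow> of_real 0 + \<i> * \<omega> * h"
      unfolding Z_def by (intro tendsto_intros \<sigma>0)
    then show ?thesis by simp
  qed
  have Z_cont: "continuous_on UNIV (Z k)" for k unfolding Z_def by (intro continuous_intros)
  have [measurable]: "Z k \<in> borel_measurable borel" for k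
    using Z_cont by (rule borel_measurable_continuous_onI)
  have "continuous_on UNIV (\<lambda>\<omega>. Z k \<omega> powr of_real \<alpha>)" for k
    using \<sigma>[of k] q(1) by (intro continuous_intros Z_cont) (auto simp: complex_nonpos_Reals_iff Re_Z)
  then have [measurable]: "(\<lambda>\<omega>. Z k \<omega> powr of_real \<alpha>) \<in> borel_measurable borel" for k
    by (rule borel_measurable_continuous_onI)
  define E where "E z = exp z * (\<Sum>l. complex_of_real (\<kappa> l) * exp (- z) ^ l)" for z
  define T where "T k = (\<Sum>l. \<kappa> l * exp (- (real l - 1) * \<sigma> k) * u (x - (real l - 1) * h))" for k
  have exp_geom: "exp (- (real l - 1) * \<sigma> k) = exp (\<sigma> k) * exp (- \<sigma> k) ^ l" for l k
    by (simp add: exp_of_nat_mult[symmetric] exp_add[symmetric] algebra_simps)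
  have "T \<longlonglongrightarrow> (\<Sum>l. \<kappa> l * u (x - (real l - 1) * h))"
  proof -
    have "((\<lambda>k. \<Sum>l. \<kappa> l * exp (- (real l - 1) * \<sigma> k) * u (x - (real l - 1) * h)) \<longlongrightarrow> (\<Sum>l. \<kappa> l * exp (- (real l - 1) * 0) * u (x - (real l - 1) * h))) sequentially"
    proof (rule tannerys_theorem[THEN conjunct2, THEN conjunct2])
      show "((\<lambda>k. \<kappa> l * exp (- (real l - 1) * \<sigma> k) * u (x - (real l - 1) * h)) \<longlongrightarrow> \<kappa> l * exp (- (real l - 1) * 0) * u (x - (real l - 1) * h)) sequentially" for l
        by (intro tendsto_intros \<sigma>0)
      have "norm (\<kappa> l * exp (- (real l - 1) * \<sigma> k) * u (x - (real l - 1) * h)) \<le> exp 1 * M * \<bar>u (x - (real l - 1) * h)\<bar>" for l k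
      proof -
        have "exp (- (real l - 1) * \<sigma> k) \<le> exp 1"
          unfolding exp_le_cancel_iff
        proof -
          have "0 \<le> real l * \<sigma> k" using \<sigma>(1)[of k] by simp
          moreover have "- (real l - 1) * \<sigma> k = \<sigma> k - real l * \<sigma> k" by (simp add: algebra_simps)
          ultimately show "- (real l - 1) * \<sigma> k \<le> 1" using \<sigma>(2)[of k] by linarith
        qed
        then have "\<bar>\<kappa> l\<bar> * exp (- (real l - 1) * \<sigma> k) \<le> M * exp 1"
          using \<kappa> M0 by (intro mult_mono) auto
        then show ?thesis
          unfolding real_norm_def abs_mult abs_exp_cancel by (intro mult_right_mono) (simp_all add: mult.commute)
      qed
      then show "eventually (\<lambda>(l, k). norm (\<kappa> l * exp (- (real l - 1) * \<sigma> k) * u (x - (real l - 1) * h)) \<le> exp 1 * M * \<bar>u (x - (real l - 1) * h)\<bar>) (at_top \<times>\<^sub>F sequentially)"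
        by (intro always_eventually allI) (simp only: case_prod_beta)
    qed (use M_samples in auto)
    then show ?thesis unfolding T_def by simp
  qed
  then have T_lim: "(\<lambda>k. 2 * pi * complex_of_real (T k)) \<longlonglongrightarrow> 2 * pi * complex_of_real (\<Sum>l. \<kappa> l * u (x - (real l - 1) * h))"
    by (intro tendsto_intros)
  have T_eq: "integrable lborel (\<lambda>\<omega>. fourier u \<omega> * E (Z k \<omega>) * iexp (\<omega> * x))"
    "2 * pi * complex_of_real (T k) = (LINT \<omega>|lborel. fourier u \<omega> * E (Z k \<omega>) * iexp (\<omega> * x))" for k
  proof -
    define f where "f l \<omega> = complex_of_real (\<kappa> l * exp (- (real l - 1) * \<sigma> k)) * (fourier u \<omega> * iexp (\<omega> * (x - (real l - 1) * h)))" for l \<omega>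
    have geom: "summable (\<lambda>l. exp (\<sigma> k) * M * (exp (- \<sigma> k) ^ l))"
      using \<sigma>[of k] by (intro summable_mult summable_geometric) auto
    have coef: "\<bar>\<kappa> l * exp (- (real l - 1) * \<sigma> k)\<bar> \<le> exp (\<sigma> k) * M * (exp (- \<sigma> k) ^ l)" for l
    proof -
      have "\<bar>\<kappa> l * exp (- (real l - 1) * \<sigma> k)\<bar> = \<bar>\<kappa> l\<bar> * (exp (\<sigma> k) * exp (- \<sigma> k) ^ l)"
        unfolding exp_geom by (simp add: abs_mult)
      also have "\<dots> \<le> M * (exp (\<sigma> k) * exp (- \<sigma> k) ^ l)"
        by (rule mult_right_mono[OF \<kappa>]) simp
      finally show ?thesis by (simp only: mult_ac)
    qed
    have f_norm: "norm (f l \<omega>) = \<bar>\<kappa> l * exp (- (real l - 1) * \<sigma> k)\<bar> * norm (fourier u \<omega>)" for l \<omega>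
      unfolding f_def norm_mult[of "complex_of_real (\<kappa> l * exp (- (real l - 1) * \<sigma> k))"] norm_of_real
      by (simp add: norm_mult)
    have f_sum: "(\<Sum>l. f l \<omega>) = fourier u \<omega> * E (Z k \<omega>) * iexp (\<omega> * x)" for \<omega>
    proof -
      have summ: "summable (\<lambda>l. complex_of_real (\<kappa> l) * exp (- Z k \<omega>) ^ l)"
      proof (rule summable_comparison_test')
        show "summable (\<lambda>l. M * (exp (- \<sigma> k) ^ l))"
          using \<sigma>[of k] by (intro summable_mult summable_geometric) auto
        show "norm (complex_of_real (\<kappa> l) * exp (- Z k \<omega>) ^ l) \<le> M * (exp (- \<sigma> k) ^ l)" for l
          using \<kappa>[of l] by (simp add: norm_mult norm_power Re_Z mult_right_mono)
      qed
      have "f l \<omega> = fourier u \<omega> * iexp (\<omega> * x) * exp (Z k \<omega>) * (complex_of_real (\<kappa> l) * exp (- Z k \<omega>) ^ l)" for l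
      proof -
        have "complex_of_real (exp (- (real l - 1) * \<sigma> k)) * iexp (\<omega> * (x - (real l - 1) * h))
            = iexp (\<omega> * x) * exp (Z k \<omega>) * exp (- Z k \<omega>) ^ l"
          unfolding exp_of_real[symmetric] exp_of_nat_mult[symmetric] exp_add[symmetric]
          by (simp add: Z_def algebra_simps)
        then show ?thesis unfolding f_def by simp
      qed
      then have "(\<Sum>l. f l \<omega>) = fourier u \<omega> * iexp (\<omega> * x) * exp (Z k \<omega>) * (\<Sum>l. complex_of_real (\<kappa> l) * exp (- Z k \<omega>) ^ l)"
        using suminf_mult[OF summ] by simp
      then show ?thesis by (simp add: E_def)
    qed
    have f_int: "integrable lborel (f l)" for l
    proof (rule Bochner_Integration.integrable_bound)
      show "integrable lborel (\<lambda>\<omega>. \<bar>\<kappa> l * exp (- (real l - 1) * \<sigma> k)\<bar> * norm (fourier u \<omega>))"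
        using uhn by (rule integrable_mult_right)
      show "f l \<in> borel_measurable lborel" unfolding f_def by measurable
      show "AE \<omega> in lborel. norm (f l \<omega>) \<le> norm (\<bar>\<kappa> l * exp (- (real l - 1) * \<sigma> k)\<bar> * norm (fourier u \<omega>))"
        by (intro AE_I2) (simp only: f_norm norm_mult real_norm_def abs_abs abs_norm_cancel order_refl)
    qed
    have coef_sum: "summable (\<lambda>l. \<bar>\<kappa> l * exp (- (real l - 1) * \<sigma> k)\<bar>)"
      by (rule summable_comparison_test'[OF geom]) (simp only: real_norm_def abs_abs coef)
    then have sum1: "AE \<omega> in lborel. summable (\<lambda>l. norm (f l \<omega>))"
      unfolding f_norm by (intro AE_I2 summable_mult2)
    have sum2: "summable (\<lambda>l. LINT \<omega>|lborel. norm (f l \<omega>))"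
      unfolding f_norm integral_mult_right_zero by (rule summable_mult2[OF coef_sum])
    show "integrable lborel (\<lambda>\<omega>. fourier u \<omega> * E (Z k \<omega>) * iexp (\<omega> * x))"
      using integrable_suminf[OF f_int sum1 sum2] unfolding f_sum .
    have "(\<lambda>l. LINT \<omega>|lborel. f l \<omega>) sums (LINT \<omega>|lborel. fourier u \<omega> * E (Z k \<omega>) * iexp (\<omega> * x))"
      using sums_integral[OF f_int sum1 sum2] unfolding f_sum .
    moreover have "(LINT \<omega>|lborel. f l \<omega>) = complex_of_real (2 * pi * (\<kappa> l * exp (- (real l - 1) * \<sigma> k) * u (x - (real l - 1) * h)))" for l
      unfolding f_def integral_mult_right_zero inv by simp
    ultimately have s: "(\<lambda>l. complex_of_real (2 * pi * (\<kappa> l * exp (- (real l - 1) * \<sigma> k) * u (x - (real l - 1) * h)))) sums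
        (LINT \<omega>|lborel. fourier u \<omega> * E (Z k \<omega>) * iexp (\<omega> * x))" by simp
    have "summable (\<lambda>l. exp (\<sigma> k) * M * (exp (- \<sigma> k) ^ l) * B)" using geom by (rule summable_mult2)
    then have "summable (\<lambda>l. \<kappa> l * exp (- (real l - 1) * \<sigma> k) * u (x - (real l - 1) * h))"
    proof (rule summable_comparison_test')
      show "norm (\<kappa> l * exp (- (real l - 1) * \<sigma> k) * u (x - (real l - 1) * h)) \<le> exp (\<sigma> k) * M * (exp (- \<sigma> k) ^ l) * B" for l
        unfolding real_norm_def abs_mult[of _ "u _"] by (intro mult_mono coef B) (use M0 in auto)
    qed
    then have "(\<lambda>l. 2 * pi * (\<kappa> l * exp (- (real l - 1) * \<sigma> k) * u (x - (real l - 1) * h))) sums (2 * pi * T k)"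
      unfolding T_def by (intro sums_mult summable_sums)
    then have "(\<lambda>l. complex_of_real (2 * pi * (\<kappa> l * exp (- (real l - 1) * \<sigma> k) * u (x - (real l - 1) * h)))) sums complex_of_real (2 * pi * T k)"
      by (rule sums_of_real)
    from sums_unique2[OF this s] have "complex_of_real (2 * pi * T k) = (LINT \<omega>|lborel. fourier u \<omega> * E (Z k \<omega>) * iexp (\<omega> * x))" .
    moreover have "complex_of_real (2 * pi * T k) = 2 * pi * complex_of_real (T k)" by simp
    ultimately show "2 * pi * complex_of_real (T k) = (LINT \<omega>|lborel. fourier u \<omega> * E (Z k \<omega>) * iexp (\<omega> * x))"
      by (simp only:)
  qed
  have pow_le: "norm (Z k \<omega>) powr r \<le> (1 + \<bar>\<omega>\<bar> * h) powr q" if "0 < r" "r \<le> q" for k \<omega> r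
  proof -
    have "norm (Z k \<omega>) powr r \<le> (1 + \<bar>\<omega>\<bar> * h) powr r"
      using Z_norm that by (intro powr_mono2) auto
    also have "\<dots> \<le> (1 + \<bar>\<omega>\<bar> * h) powr q" using that h by (intro powr_mono) auto
    finally show ?thesis .
  qed
  have main_norm: "norm (fourier u \<omega> * Z k \<omega> powr of_real \<alpha> * iexp (\<omega> * x)) \<le> (1 + \<bar>\<omega>\<bar> * h) powr q * norm (fourier u \<omega>)" for k \<omega>
    using mult_right_mono[OF pow_le[of \<alpha> k \<omega>], of "norm (fourier u \<omega>)"] q
    unfolding norm_mult norm_iexp_eq_1 by (simp add: norm_powr_real_powr' mult.commute)
  have main_int: "integrable lborel (\<lambda>\<omega>. fourier u \<omega> * Z k \<omega> powr of_real \<alpha> * iexp (\<omega> * x))" for k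
  proof (rule Bochner_Integration.integrable_bound[OF dom_int])
    show "AE \<omega> in lborel. norm (fourier u \<omega> * Z k \<omega> powr of_real \<alpha> * iexp (\<omega> * x)) \<le> norm ((1 + \<bar>\<omega>\<bar> * h) powr q * norm (fourier u \<omega>))"
      using main_norm by (intro AE_I2) (simp add: abs_mult)
  qed measurable
  have main_lim: "(\<lambda>k. LINT \<omega>|lborel. fourier u \<omega> * Z k \<omega> powr of_real \<alpha> * iexp (\<omega> * x))
      \<longlonglongrightarrow> (LINT \<omega>|lborel. fourier u \<omega> * (\<i> * \<omega> * h) powr of_real \<alpha> * iexp (\<omega> * x))"
  proof (rule integral_dominated_convergence[OF _ _ dom_int])
    have "(\<lambda>k. fourier u \<omega> * Z k \<omega> powr of_real \<alpha> * iexp (\<omega> * x)) \<longlonglongrightarrow> fourier u \<omega> * (\<i> * \<omega> * h) powr of_real \<alpha> * iexp (\<omega> * x)"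
      if "\<omega> \<noteq> 0" for \<omega> :: real
      by (intro tendsto_intros Z_lim) (use that h in \<open>auto simp: complex_nonpos_Reals_iff\<close>)
    then show "AE \<omega> in lborel. (\<lambda>k. fourier u \<omega> * Z k \<omega> powr of_real \<alpha> * iexp (\<omega> * x)) \<longlonglongrightarrow> fourier u \<omega> * (\<i> * \<omega> * h) powr of_real \<alpha> * iexp (\<omega> * x)"
      using AE_lborel_singleton[of "0::real"] by (auto elim!: eventually_mono)
    show "AE \<omega> in lborel. norm (fourier u \<omega> * Z k \<omega> powr of_real \<alpha> * iexp (\<omega> * x)) \<le> (1 + \<bar>\<omega>\<bar> * h) powr q * norm (fourier u \<omega>)" for k
      using main_norm by (intro AE_I2)
    have eq: "(\<i> * complex_of_real \<omega> * h) powr of_real \<alpha> = of_real h powr of_real \<alpha> * (\<i> * \<omega>) powr of_real \<alpha>" for \<omega>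
      using powr_times_real_left[of "of_real h" "\<i> * \<omega>" "of_real \<alpha>"] h by (simp add: mult_ac)
    show "(\<lambda>\<omega>. fourier u \<omega> * (\<i> * \<omega> * h) powr of_real \<alpha> * iexp (\<omega> * x)) \<in> borel_measurable lborel"
      unfolding eq by measurable
  qed measurable
  have err_int: "integrable lborel (\<lambda>\<omega>. norm (Z k \<omega>) powr q * norm (fourier u \<omega>))" for k
  proof (rule Bochner_Integration.integrable_bound[OF dom_int])
    show "AE \<omega> in lborel. norm (norm (Z k \<omega>) powr q * norm (fourier u \<omega>)) \<le> norm ((1 + \<bar>\<omega>\<bar> * h) powr q * norm (fourier u \<omega>))"
      using pow_le[of q] q by (intro AE_I2) (simp add: abs_mult mult_right_mono)
  qed measurable
  have err_lim: "(\<lambda>k. LINT \<omega>|lborel. norm (Z k \<omega>) powr q * norm (fourier u \<omega>))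
      \<longlonglongrightarrow> (LINT \<omega>|lborel. (\<bar>\<omega>\<bar> * h) powr q * norm (fourier u \<omega>))"
  proof (rule integral_dominated_convergence[OF _ _ dom_int])
    have "(\<lambda>k. norm (Z k \<omega>) powr q * norm (fourier u \<omega>)) \<longlonglongrightarrow> (\<bar>\<omega>\<bar> * h) powr q * norm (fourier u \<omega>)"
      if "\<omega> \<noteq> 0" for \<omega> :: real
    proof -
      have "(\<lambda>k. norm (Z k \<omega>) powr q * norm (fourier u \<omega>)) \<longlonglongrightarrow> norm (\<i> * \<omega> * h) powr q * norm (fourier u \<omega>)"
        by (intro tendsto_intros Z_lim) (use that h in auto)
      then show ?thesis using h by (simp add: norm_mult)
    qed
    then show "AE \<omega> in lborel. (\<lambda>k. norm (Z k \<omega>) powr q * norm (fourier u \<omega>)) \<longlonglongrightarrow> (\<bar>\<omega>\<bar> * h) powr q * norm (fourier u \<omega>)"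
      using AE_lborel_singleton[of "0::real"] by (auto elim!: eventually_mono)
    show "AE \<omega> in lborel. norm (norm (Z k \<omega>) powr q * norm (fourier u \<omega>)) \<le> (1 + \<bar>\<omega>\<bar> * h) powr q * norm (fourier u \<omega>)" for k
      using pow_le[of q] q by (intro AE_I2) (simp add: abs_mult mult_right_mono)
  qed measurable
  have "norm (2 * pi * complex_of_real (T k) - (LINT \<omega>|lborel. fourier u \<omega> * Z k \<omega> powr of_real \<alpha> * iexp (\<omega> * x)))
      \<le> C * (LINT \<omega>|lborel. norm (Z k \<omega>) powr q * norm (fourier u \<omega>))" for k
  proof -
    have "2 * pi * complex_of_real (T k) - (LINT \<omega>|lborel. fourier u \<omega> * Z k \<omega> powr of_real \<alpha> * iexp (\<omega> * x))
        = (LINT \<omega>|lborel. fourier u \<omega> * E (Z k \<omega>) * iexp (\<omega> * x) - fourier u \<omega> * Z k \<omega> powr of_real \<alpha> * iexp (\<omega> * x))"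
      unfolding T_eq(2) using Bochner_Integration.integral_diff[OF T_eq(1) main_int] by simp
    also have "norm \<dots> \<le> (LINT \<omega>|lborel. C * (norm (Z k \<omega>) powr q * norm (fourier u \<omega>)))"
    proof (rule Bochner_Integration.integral_norm_bound_integral)
      show "integrable lborel (\<lambda>\<omega>. fourier u \<omega> * E (Z k \<omega>) * iexp (\<omega> * x) - fourier u \<omega> * Z k \<omega> powr of_real \<alpha> * iexp (\<omega> * x))"
        using T_eq(1) main_int by (rule Bochner_Integration.integrable_diff)
      show "integrable lborel (\<lambda>\<omega>. C * (norm (Z k \<omega>) powr q * norm (fourier u \<omega>)))"
        using err_int by (rule integrable_mult_right)
      fix \<omega>
      have "fourier u \<omega> * E (Z k \<omega>) * iexp (\<omega> * x) - fourier u \<omega> * Z k \<omega> powr of_real \<alpha> * iexp (\<omega> * x)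
          = (E (Z k \<omega>) - Z k \<omega> powr of_real \<alpha>) * fourier u \<omega> * iexp (\<omega> * x)"
        by (simp add: algebra_simps)
      moreover have "norm (E (Z k \<omega>) - Z k \<omega> powr of_real \<alpha>) \<le> C * norm (Z k \<omega>) powr q"
        unfolding E_def by (rule bound) (simp_all add: Re_Z \<sigma>)
      ultimately show "norm (fourier u \<omega> * E (Z k \<omega>) * iexp (\<omega> * x) - fourier u \<omega> * Z k \<omega> powr of_real \<alpha> * iexp (\<omega> * x))
          \<le> C * (norm (Z k \<omega>) powr q * norm (fourier u \<omega>))"
        unfolding norm_mult norm_iexp_eq_1 using mult_right_mono[of _ _ "norm (fourier u \<omega>)"]
        by (simp add: norm_mult mult.assoc[symmetric])
    qed
    finally show ?thesis by simp
  qed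
  then show "norm (2 * pi * complex_of_real (\<Sum>l. \<kappa> l * u (x - (real l - 1) * h))
        - (LINT \<omega>|lborel. fourier u \<omega> * (\<i> * \<omega> * h) powr of_real \<alpha> * iexp (\<omega> * x)))
      \<le> C * (LINT \<omega>|lborel. (\<bar>\<omega>\<bar> * h) powr q * norm (fourier u \<omega>))"
    by (intro LIMSEQ_le[OF tendsto_norm[OF tendsto_diff[OF T_lim main_lim]] tendsto_mult_left[OF err_lim]]) auto
qed

text \<open>
  Dividing the error on the Fourier side by \<open>h powr \<alpha>\<close> leaves \<open>h^p\<close>, as the symbols differ by order
  \<open>\<alpha> + p\<close>.
\<close>

lemma left_diff_order:
  fixes \<kappa> :: "nat \<Rightarrow> real"
  assumes \<alpha>: "1 < \<alpha>" "\<alpha> < 2" and p: "1 \<le> p" and u: "integrable_derivs (p + 3) u"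
    and \<kappa>: "\<And>l. \<bar>\<kappa> l\<bar> \<le> M"
    and bound: "\<And>z. 0 < Re z \<Longrightarrow> Re z \<le> 1 \<Longrightarrow>
      norm (exp z * (\<Sum>l. of_real (\<kappa> l) * exp (- z) ^ l) - z powr of_real \<alpha>) \<le> C * norm z powr (\<alpha> + real p)"
  shows "\<And>h x. 0 < h \<Longrightarrow> summable (\<lambda>l. \<kappa> l * u (x - (real l - 1) * h))"
    and "\<And>x. (\<lambda>h. left_liouville \<alpha> u x - left_diff \<alpha> \<kappa> u h x) \<in> O[at_right 0](\<lambda>h. h ^ p)"
proof -
  define q where "q = \<alpha> + real p"
  have q: "0 < \<alpha>" "\<alpha> \<le> q" "q + 1 < real (p + 3)" using \<alpha> by (auto simp: q_def)
  note err = left_diff_fourier_error[OF u _ q \<kappa> _ bound[folded q_def]]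
  show "summable (\<lambda>l. \<kappa> l * u (x - (real l - 1) * h))" if "0 < h" for h x
    using err(1)[OF _ that] p by simp
  fix x
  define J where "J = (LINT \<omega>|lborel. \<bar>\<omega>\<bar> powr q * norm (fourier u \<omega>))"
  have "norm (left_liouville \<alpha> u x - left_diff \<alpha> \<kappa> u h x) \<le> (C * J / (2 * pi)) * norm (h ^ p)" if h: "0 < h" for h
  proof -
    let ?T = "\<Sum>l. \<kappa> l * u (x - (real l - 1) * h)"
    have "(\<i> * complex_of_real \<omega> * h) powr of_real \<alpha> = of_real (h powr \<alpha>) * (\<i> * \<omega>) powr of_real \<alpha>" for \<omega>
      using powr_times_real_left[of "of_real h" "\<i> * \<omega>" "of_real \<alpha>"] h by (simp add: mult_ac powr_of_real)
    then have "(LINT \<omega>|lborel. fourier u \<omega> * (\<i> * \<omega> * h) powr of_real \<alpha> * iexp (\<omega> * x))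
        = (LINT \<omega>|lborel. of_real (h powr \<alpha>) * (fourier u \<omega> * (\<i> * \<omega>) powr of_real \<alpha> * iexp (\<omega> * x)))"
      by (intro Bochner_Integration.integral_cong) (simp_all add: mult_ac)
    also have "\<dots> = of_real (h powr \<alpha>) * (2 * pi * complex_of_real (left_liouville \<alpha> u x))"
      unfolding integral_mult_right_zero
      by (subst left_liouville_fourier(2)[OF \<alpha> u]) (use p in auto)
    finally have main: "(LINT \<omega>|lborel. fourier u \<omega> * (\<i> * \<omega> * h) powr of_real \<alpha> * iexp (\<omega> * x))
        = of_real (2 * pi * h powr \<alpha> * left_liouville \<alpha> u x)" by simp
    have "(LINT \<omega>|lborel. (\<bar>\<omega>\<bar> * h) powr q * norm (fourier u \<omega>)) = (LINT \<omega>|lborel. h powr q * (\<bar>\<omega>\<bar> powr q * norm (fourier u \<omega>)))"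
      using h by (intro Bochner_Integration.integral_cong) (simp_all add: powr_mult)
    also have "\<dots> = h powr \<alpha> * h ^ p * J"
      using h by (simp add: J_def q_def powr_add powr_realpow)
    finally have rhs: "(LINT \<omega>|lborel. (\<bar>\<omega>\<bar> * h) powr q * norm (fourier u \<omega>)) = h powr \<alpha> * h ^ p * J" .
    have "norm (complex_of_real (2 * pi * ?T - 2 * pi * h powr \<alpha> * left_liouville \<alpha> u x)) \<le> C * (h powr \<alpha> * h ^ p * J)"
      using err(2)[OF _ h, of x] p unfolding main rhs by simp
    then have "\<bar>2 * pi * ?T - 2 * pi * h powr \<alpha> * left_liouville \<alpha> u x\<bar> \<le> C * (h powr \<alpha> * h ^ p * J)"
      unfolding norm_of_real .
    moreover have "2 * pi * ?T - 2 * pi * h powr \<alpha> * left_liouville \<alpha> u x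
        = - (2 * pi * h powr \<alpha> * (left_liouville \<alpha> u x - left_diff \<alpha> \<kappa> u h x))"
      using h by (simp add: left_diff_def algebra_simps)
    ultimately have "h powr \<alpha> * (2 * pi * \<bar>left_liouville \<alpha> u x - left_diff \<alpha> \<kappa> u h x\<bar>) \<le> h powr \<alpha> * (C * J * h ^ p)"
      by (simp add: abs_mult mult_ac)
    then have "2 * pi * \<bar>left_liouville \<alpha> u x - left_diff \<alpha> \<kappa> u h x\<bar> \<le> C * J * h ^ p"
      using h by simp
    then show ?thesis using h by (simp add: field_simps)
  qed
  then show "(\<lambda>h. left_liouville \<alpha> u x - left_diff \<alpha> \<kappa> u h x) \<in> O[at_right 0](\<lambda>h. h ^ p)"
    by (intro bigoI[of _ "C * J / (2 * pi)"]) (auto simp: eventually_at_right_field intro!: exI[of _ 1])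
qed

section \<open>Reflection and the approximation theorem\<close>

lemma iterated_deriv_reflect:
  assumes "derivs_exist n f" "k \<le> n"
  shows "(deriv ^^ k) (\<lambda>x. f (- x)) = (\<lambda>x. (- 1) ^ k * (deriv ^^ k) f (- x))"
  using assms(2)
proof (induction k)
  case (Suc k)
  have "deriv (\<lambda>x. (- 1) ^ k * (deriv ^^ k) f (- x)) x = (- 1) ^ Suc k * (deriv ^^ Suc k) f (- x)" for x
  proof (rule DERIV_imp_deriv)
    have "((deriv ^^ k) f has_real_derivative (deriv ^^ Suc k) f (- x)) (at (- x))"
      using assms(1) Suc.prems by (auto simp: derivs_exist_def DERIV_deriv_iff_real_differentiable)
    then have "((\<lambda>x. (deriv ^^ k) f (- x)) has_real_derivative (deriv ^^ Suc k) f (- x) * (- 1)) (at x)"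
      by (rule DERIV_chain2) (auto intro!: derivative_eq_intros)
    from DERIV_cmult[OF this, of "(- 1) ^ k"]
    show "((\<lambda>x. (- 1) ^ k * (deriv ^^ k) f (- x)) has_real_derivative (- 1) ^ Suc k * (deriv ^^ Suc k) f (- x)) (at x)"
      by simp
  qed
  then have "deriv (\<lambda>x. (- 1) ^ k * (deriv ^^ k) f (- x)) = (\<lambda>x. (- 1) ^ Suc k * (deriv ^^ Suc k) f (- x))"
    by (rule ext)
  moreover have "(deriv ^^ Suc k) (\<lambda>x. f (- x)) = deriv (\<lambda>x. (- 1) ^ k * (deriv ^^ k) f (- x))"
    using Suc by simp
  ultimately show ?case by (simp only:)
qed simp

lemma derivs_exist_reflect:
  assumes "derivs_exist n f"
  shows "derivs_exist n (\<lambda>x. f (- x))"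
  unfolding derivs_exist_def
proof (intro allI impI)
  fix k x assume k: "k < n"
  have "((deriv ^^ k) f has_real_derivative (deriv ^^ Suc k) f (- x)) (at (- x))"
    using assms k by (auto simp: derivs_exist_def DERIV_deriv_iff_real_differentiable)
  then have "((\<lambda>x. (deriv ^^ k) f (- x)) has_real_derivative (deriv ^^ Suc k) f (- x) * (- 1)) (at x)"
    by (rule DERIV_chain2) (auto intro!: derivative_eq_intros)
  from DERIV_cmult[OF this, of "(- 1) ^ k"]
  show "(deriv ^^ k) (\<lambda>x. f (- x)) differentiable at x"
    using iterated_deriv_reflect[OF assms, of k] k by (auto simp: real_differentiable_def)
qed

lemma integrable_derivs_reflect:
  assumes u: "integrable_derivs n u"
  shows "integrable_derivs n (\<lambda>x. u (- x))"
proof -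
  have ex: "derivs_exist n u" using u by (simp add: integrable_derivs_def)
  have "integrable lborel ((deriv ^^ k) (\<lambda>x. u (- x)))" if "k \<le> n" for k
  proof -
    have "integrable lborel (\<lambda>x. (deriv ^^ k) u (0 + (- 1) * x))"
      using u that by (intro lborel_integrable_real_affine) (auto simp: integrable_derivs_def)
    then show ?thesis
      unfolding iterated_deriv_reflect[OF ex that] by (intro integrable_mult_right) simp
  qed
  then show ?thesis using derivs_exist_reflect[OF ex] by (simp add: integrable_derivs_def)
qed

lemma right_liouville_integral_reflect:
  "right_liouville_integral \<alpha> u x = left_liouville_integral \<alpha> (\<lambda>y. u (- y)) (- x)"
  "set_integrable lborel {x<..} (\<lambda>s. u s / (s - x) powr (\<alpha> - 1))
    \<longleftrightarrow> set_integrable lborel {..<- x} (\<lambda>s. u (- s) / (- x - s) powr (\<alpha> - 1))"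
proof -
  have eq: "indicator {..<- x} (0 + (- 1) * s) *\<^sub>R (u (- (0 + (- 1) * s)) / (- x - (0 + (- 1) * s)) powr (\<alpha> - 1))
      = indicator {x<..} s *\<^sub>R (u s / (s - x) powr (\<alpha> - 1))" for s
    by (auto simp: indicator_def)
  show "right_liouville_integral \<alpha> u x = left_liouville_integral \<alpha> (\<lambda>y. u (- y)) (- x)"
    unfolding right_liouville_integral_def left_liouville_integral_def set_lebesgue_integral_def
    by (subst (2) lborel_integral_real_affine[of "-1" _ 0], simp) (simp only: eq, simp)
  show "set_integrable lborel {x<..} (\<lambda>s. u s / (s - x) powr (\<alpha> - 1))
    \<longleftrightarrow> set_integrable lborel {..<- x} (\<lambda>s. u (- s) / (- x - s) powr (\<alpha> - 1))"
    unfolding set_integrable_def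
    by (subst (2) lborel_integrable_real_affine_iff[of "-1" _ 0, symmetric], simp) (simp only: eq)
qed

lemma right_liouville_reflect:
  assumes "left_liouville_exists \<alpha> (\<lambda>y. u (- y))"
  shows "right_liouville_exists \<alpha> u"
    and "right_liouville \<alpha> u x = left_liouville \<alpha> (\<lambda>y. u (- y)) (- x)"
proof -
  let ?L = "left_liouville_integral \<alpha> (\<lambda>y. u (- y))"
  have ex: "derivs_exist 2 ?L" using assms by (simp add: left_liouville_exists_def)
  have eq: "right_liouville_integral \<alpha> u = (\<lambda>x. ?L (- x))"
    using right_liouville_integral_reflect(1) by blast
  show "right_liouville_exists \<alpha> u"
    unfolding right_liouville_exists_def eq right_liouville_integral_reflect(2)
    using assms derivs_exist_reflect[OF ex] by (simp add: left_liouville_exists_def)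
  show "right_liouville \<alpha> u x = left_liouville \<alpha> (\<lambda>y. u (- y)) (- x)"
    unfolding right_liouville_def left_liouville_def eq iterated_deriv_reflect[OF ex order_refl] by simp
qed


theorem theorem4:
  fixes \<alpha> :: real and p :: nat and u :: "real \<Rightarrow> real"
    and lam :: "nat \<Rightarrow> nat \<Rightarrow> real" and W :: "complex \<Rightarrow> complex" and \<kappa> :: "nat \<Rightarrow> real"
  assumes "1 < \<alpha>" and "\<alpha> < 2" and "p \<ge> 3"
    and "C_class (nat \<lfloor>\<alpha>\<rfloor> + p + 1) u"
    and "derivs_exist (nat \<lfloor>\<alpha>\<rfloor> + p + 2) u"
    and "\<forall>k \<le> nat \<lfloor>\<alpha>\<rfloor> + p + 2. integrable lborel ((deriv ^^ k) u)"
    and "gen_parameters \<alpha> lam"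
    and "is_gen_fun \<alpha> lam p W"
    and "\<And>z. norm z < 1 \<Longrightarrow> (\<lambda>l. of_real (\<kappa> l) * z ^ l) sums W z"
  shows "left_liouville_exists \<alpha> u
    \<and> (\<forall>h>0. \<forall>x. summable (\<lambda>l. \<kappa> l * u (x - (real l - 1) * h)))
    \<and> (\<forall>x. (\<lambda>h. left_liouville \<alpha> u x - left_diff \<alpha> \<kappa> u h x) \<in> O[at_right 0](\<lambda>h. h ^ p))
    \<and> right_liouville_exists \<alpha> u
    \<and> (\<forall>h>0. \<forall>x. summable (\<lambda>l. \<kappa> l * u (x + (real l - 1) * h)))
    \<and> (\<forall>x. (\<lambda>h. right_liouville \<alpha> u x - right_diff \<alpha> \<kappa> u h x) \<in> O[at_right 0](\<lambda>h. h ^ p))"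
proof -
  note \<alpha> = assms(1,2)
  have p: "1 \<le> p" "2 \<le> p" "4 \<le> p + 3" using assms(3) by auto
  have "\<lfloor>\<alpha>\<rfloor> = 1" using \<alpha> by linarith
  then have u: "integrable_derivs (p + 3) u"
    using assms(5,6) by (simp add: integrable_derivs_def numeral_3_eq_3)
  have v: "integrable_derivs (p + 3) (\<lambda>y. u (- y))"
    using u by (rule integrable_derivs_reflect)
  obtain M where M: "\<And>z. norm z < 1 \<Longrightarrow> norm (W z) \<le> M"
    using gen_fun_bounded[OF \<alpha> p(2) assms(7,8)] by blast
  have hW: "W holomorphic_on ball 0 1" using assms(8) by (simp add: is_gen_fun_def)
  have \<kappa>: "\<bar>\<kappa> l\<bar> \<le> M" for l
    using bounded_power_series_coeffs[OF hW assms(9) M, of l] by simp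
  obtain C where C: "\<And>z. 0 < Re z \<Longrightarrow> Re z \<le> 1 \<Longrightarrow>
      norm (exp z * W (exp (- z)) - z powr of_real \<alpha>) \<le> C * norm z powr (\<alpha> + real p)"
    using gen_fun_symbol_error[OF \<alpha> p(2) assms(7,8,9)] by blast
  have bound: "norm (exp z * (\<Sum>l. of_real (\<kappa> l) * exp (- z) ^ l) - z powr of_real \<alpha>) \<le> C * norm z powr (\<alpha> + real p)"
    if "0 < Re z" "Re z \<le> 1" for z
    using C[OF that] assms(9)[of "exp (- z)"] that by (simp add: sums_iff)
  have left: "summable (\<lambda>l. \<kappa> l * w (x - (real l - 1) * h))"
    if "integrable_derivs (p + 3) w" "0 < h" for w h x
    by (rule left_diff_order(1)[OF \<alpha> p(1) that(1) \<kappa> _ that(2), where C = C]) (rule bound)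
  have left_order: "(\<lambda>h. left_liouville \<alpha> w x - left_diff \<alpha> \<kappa> w h x) \<in> O[at_right 0](\<lambda>h. h ^ p)"
    if "integrable_derivs (p + 3) w" for w x
    by (rule left_diff_order(2)[OF \<alpha> p(1) that \<kappa>, where C = C]) (rule bound)
  note ex = left_liouville_fourier(1)[OF \<alpha> u p(3)]
  note ex' = left_liouville_fourier(1)[OF \<alpha> v p(3)]
  have arg: "u (- (- x - (real l - 1) * h)) = u (x + (real l - 1) * h)" for x h l by (simp add: add.commute)
  have "summable (\<lambda>l. \<kappa> l * u (x + (real l - 1) * h))" if "0 < h" for h x
    using left[OF v that, of "- x"] unfolding arg .
  moreover have "(\<lambda>h. right_liouville \<alpha> u x - right_diff \<alpha> \<kappa> u h x) \<in> O[at_right 0](\<lambda>h. h ^ p)" for x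
    using left_order[OF v, of "- x"] unfolding left_diff_def right_diff_def arg
    by (simp add: right_liouville_reflect(2)[OF ex'])
  ultimately show ?thesis
    using ex left[OF u] left_order[OF u] right_liouville_reflect(1)[OF ex'] by blast
qed

end
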